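(* Let $\mu\in\mathcal{P}(\mathbb{R})$ and let $\{\nu_t\}_{t\ge0}$ be a weakly continuous $\rhd$-convolution semigroup of probability measures on $\mathbb{R}$ ($\nu_s\rhd\nu_t=\nu_{s+t}$, $\nu_0=\delta_0$), with generator $J(z):=\frac{d}{dt}\big|_{t=0}F_{\nu_t}(z)$. Then $G(t,z):=z-F_{\mathbb{A}_{\nu_t}(\mu)}(z)$ satisfies $$\frac{\partial G}{\partial t}=J(z-G)\frac{\partial G}{\partial z},\qquad z\in\mathbb{C}^+.$$
   Context: For $\mu\in\mathcal{P}(\mathbb{R})$, $G_\mu(z)=\int\frac{1}{z-x}\mu(dx)$, $F_\mu=1/G_\mu$ on $\mathbb{C}^+$, and the Voiculescu transform $\phi_\mu(z)=F_\mu^{-1}(z)-z$ on a truncated cone $\Gamma_{\lambda,M}=\{z\in\mathbb{C}^+:|\mathrm{Re}\,z|<\lambda\mathrm{Im}\,z,\ \mathrm{Im}\,z>M\}$ where $F_\mu^{-1}$ exists. $\boxplus$ is additive free convolution ($\phi_{\mu\boxplus\nu}=\phi_\mu+\phi_\nu$), $\rhd$ additive monotone convolution ($F_{\mu\rhd\nu}=F_\mu\circ F_\nu$). For $\mu,\sigma\in\mathcal{P}(\mathbb{R})$, $\mathbb{A}_\sigma(\mu)$ is the unique probability measure with $\sigma\boxplus\mu=\sigma\rhd\mathbb{A}_\sigma(\mu)$, characterized by $\phi_{\mathbb{A}_\sigma(\mu)}(z)=\phi_\mu(F_\sigma(z))$ on some cone. *)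

theory Defs
  imports "HOL-Probability.Probability"
begin

definition real_prob :: "real measure \<Rightarrow> bool" where
  "real_prob \<mu> \<longleftrightarrow> prob_space \<mu> \<and> sets \<mu> = sets borel"

definition cauchy_G :: "real measure \<Rightarrow> complex \<Rightarrow> complex" where
  "cauchy_G \<mu> z = (\<integral>x. 1 / (z - complex_of_real x) \<partial>\<mu>)"

definition cauchy_F :: "real measure \<Rightarrow> complex \<Rightarrow> complex" where
  "cauchy_F \<mu> z = 1 / cauchy_G \<mu> z"

definition cone :: "real \<Rightarrow> real \<Rightarrow> complex set" where
  "cone l M = {z. 0 < Im z \<and> \<bar>Re z\<bar> < l * Im z \<and> Im z > M}"

definition voiculescu_on :: "real measure \<Rightarrow> real \<Rightarrow> real \<Rightarrow> (complex \<Rightarrow> complex) \<Rightarrow> bool" where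
  "voiculescu_on \<mu> l M \<phi> \<longleftrightarrow> l > 0 \<and> M > 0 \<and>
     (\<exists>a b. a > 0 \<and> b > 0 \<and> inj_on (cauchy_F \<mu>) (cone a b) \<and>
        cone l M \<subseteq> cauchy_F \<mu> ` cone a b \<and>
        (\<forall>z\<in>cone l M. \<phi> z = inv_into (cone a b) (cauchy_F \<mu>) z - z))"

definition free_conv :: "real measure \<Rightarrow> real measure \<Rightarrow> real measure \<Rightarrow> bool" where
  "free_conv \<mu> \<nu> \<rho> \<longleftrightarrow> (\<exists>l M \<phi>\<mu> \<phi>\<nu> \<phi>\<rho>.
     voiculescu_on \<mu> l M \<phi>\<mu> \<and> voiculescu_on \<nu> l M \<phi>\<nu> \<and> voiculescu_on \<rho> l M \<phi>\<rho> \<and>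
     (\<forall>z\<in>cone l M. \<phi>\<rho> z = \<phi>\<mu> z + \<phi>\<nu> z))"

definition mono_conv :: "real measure \<Rightarrow> real measure \<Rightarrow> real measure \<Rightarrow> bool" where
  "mono_conv \<mu> \<nu> \<rho> \<longleftrightarrow> (\<forall>z. Im z > 0 \<longrightarrow> cauchy_F \<rho> z = cauchy_F \<mu> (cauchy_F \<nu> z))"

definition A_op :: "real measure \<Rightarrow> real measure \<Rightarrow> real measure" where
  "A_op \<sigma> \<mu> = (THE \<rho>. real_prob \<rho> \<and>
      (\<exists>\<pi>. real_prob \<pi> \<and> free_conv \<sigma> \<mu> \<pi> \<and> mono_conv \<sigma> \<rho> \<pi>))"

end

theory Submission
  imports Defs "HOL-Complex_Analysis.Complex_Analysis"
begin

text \<open>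
  Write \<open>H\<close> for the upper half-plane. The subordination function \<open>w = F\<^bsub>A\<^esub> z\<close> of \<open>A = A_op \<sigma> \<mu>\<close>
  is the unique fixed point in \<open>H\<close> of
  \<open>w \<mapsto> z + (F\<^sub>\<mu> v - v)\<close> with \<open>v = z + (F\<^sub>\<sigma> w - w)\<close>.
  This is an analytic map of \<open>H\<close> into \<open>{Im \<ge> Im z}\<close>, so Schwarz--Pick makes it a strict contraction
  towards any fixed point; this gives uniqueness, stability, and a multiplier of modulus less than 1.
  Existence follows from Brouwer's theorem applied to perturbations whose image stays in a compact
  convex set, as escape of the fixed points to infinity would force \<open>Im a \<le> Im (f a)\<close> for all \<open>a\<close>.
  The fixed point, as a function of \<open>z\<close>, is the reciprocal Cauchy transform of a probability
  measure by a Poisson integral and Helly's theorem.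

  Differentiating the fixed point equation for \<open>\<sigma> = \<nu>\<^sub>t\<close> in \<open>t\<close> and in \<open>z\<close>, with
  \<open>\<partial>\<^sub>t F\<^sub>t = F\<^sub>t' J\<close> from the semigroup law \<open>F\<^bsub>t+h\<^esub> = F\<^sub>t \<circ> F\<^sub>h\<close>, gives
  \<open>\<partial>\<^sub>t w = J w (\<partial>\<^sub>z w - 1)\<close>.
\<close>

section \<open>Analytic self-maps of the upper half-plane\<close>

text \<open>The fixed point equation encodes additivity of Voiculescu transforms. If
  \<open>u = F_P z\<close> for the free convolution \<open>P\<close> of \<sigma> and \<mu>, the
  inverse branches at \<open>u\<close> are \<open>z\<close>, \<open>w\<close> (for \<sigma>) and
  \<open>v\<close> (for \<mu>), and additivity reads \<open>w + v = z + u\<close>; substituting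
  \<open>u = F_\<sigma> w\<close> or \<open>u = F_\<mu> v\<close> gives the two shifts. The
  transforms live on distant cones only, whereas the equation makes sense on all of
  \<open>H\<close>, where the PDE is claimed. Since \<open>A_op\<close> is a definite description,
  existence and uniqueness of the measure come before any statement about it.

  The generator is given pointwise, as a one-sided derivative at time 0. Hence derivatives in
  \<open>z\<close> and in \<open>t\<close> are both obtained from exact identities for finite
  increments, written with divided differences of \<open>F\<close>, which are jointly continuous in
  the measure and the two points. With \<open>p = F_\<mu>' v\<close>, \<open>q = F_t' w\<close> and
  \<open>d = 1 - (p - 1) (q - 1)\<close> one finds \<open>w_z = p / d\<close> and
  \<open>w_t = (p - 1) q J w / d\<close>; the PDE is then the identity
  \<open>p - d = (p - 1) q\<close>.\<close>

abbreviation uhp :: "complex set" where "uhp \<equiv> {z. 0 < Im z}"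

lemma open_uhp: "open uhp"
  by (rule open_halfspace_Im_gt)

lemma connected_uhp: "connected uhp"
  using convex_halfspace_Im_gt[of 0] by (rule convex_connected)

section \<open>The Schwarz--Pick inequality on the half-plane\<close>

lemma norm_diff_cnj_sq: "(cmod (a - cnj b))\<^sup>2 = (cmod (a - b))\<^sup>2 + 4 * Im a * Im b"
  unfolding cmod_power2 by (simp add: power2_eq_square algebra_simps)

text \<open>Cayley maps turn \<open>f\<close> into a self-map of the disc fixing 0, to which
  Schwarz's lemma applies. The conclusion is the contraction of the pseudo-hyperbolic distance,
  cleared of denominators.\<close>

lemma schwarz_pick_uhp:
  assumes hol: "f holomorphic_on uhp" and pos: "\<And>w. 0 < Im w \<Longrightarrow> 0 < Im (f w)"
    and a: "0 < Im a" and b: "0 < Im b"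
  shows "(cmod (f a - f b))\<^sup>2 * (Im a * Im b) \<le> (cmod (a - b))\<^sup>2 * (Im (f a) * Im (f b))"
proof -
  \<comment> \<open>\<open>m b\<close> is the Cayley map of the half-plane to the disc that sends
    \<open>b\<close> to 0, and \<open>k\<close> is its inverse for the \<open>b\<close> of the
    lemma.\<close>
  define m where "m b w = (w - b) / (w - cnj b)" for b w :: complex
  define k where "k \<zeta> = (b - cnj b * \<zeta>) / (1 - \<zeta>)" for \<zeta> :: complex
  have nz: "w - cnj c \<noteq> 0" if "0 < Im w" "0 < Im c" for w c
    using that by (auto simp: complex_eq_iff)
  have m_lt: "cmod (m c w) < 1" if "0 < Im w" "0 < Im c" for w c
  proof -
    have "(cmod (w - c))\<^sup>2 < (cmod (w - cnj c))\<^sup>2"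
      unfolding norm_diff_cnj_sq using that by simp
    then have "cmod (w - c) < cmod (w - cnj c)"
      by (rule power2_less_imp_less) simp
    then show ?thesis
      using nz[OF that] by (simp add: m_def norm_divide)
  qed
  have k_pos: "0 < Im (k \<zeta>)" and ne1: "1 - \<zeta> \<noteq> 0" if "cmod \<zeta> < 1" for \<zeta>
  proof -
    show ne: "1 - \<zeta> \<noteq> 0" using that by auto
    have "(Re \<zeta>)\<^sup>2 + (Im \<zeta>)\<^sup>2 < 1"
      using that unfolding cmod_power2[symmetric] by (simp add: power_less_one_iff)
    then have *: "0 < Im b * (1 - (Re \<zeta>)\<^sup>2 - (Im \<zeta>)\<^sup>2)" using b by simp
    have "(1 - Re \<zeta>)\<^sup>2 + (Im \<zeta>)\<^sup>2 > 0"
      using ne by (auto simp: complex_eq_iff sum_power2_gt_zero_iff)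
    then show "0 < Im (k \<zeta>)"
      unfolding k_def Im_divide using * by (auto intro!: divide_pos_pos simp: power2_eq_square algebra_simps)
  qed
  define \<phi> where "\<phi> \<zeta> = m (f b) (f (k \<zeta>))" for \<zeta>
  have "k holomorphic_on ball 0 1"
    unfolding k_def by (intro holomorphic_intros) (use ne1 in auto)
  then have "(\<lambda>\<zeta>. f (k \<zeta>)) holomorphic_on ball 0 1"
    by (rule holomorphic_on_compose_gen[OF _ hol, unfolded comp_def]) (use k_pos in auto)
  then have "\<phi> holomorphic_on ball 0 1"
    unfolding \<phi>_def m_def by (intro holomorphic_intros) (use nz pos b k_pos in auto)
  moreover have "\<phi> 0 = 0" by (simp add: \<phi>_def m_def k_def)
  moreover have "cmod (\<phi> \<zeta>) < 1" if "cmod \<zeta> < 1" for \<zeta>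
    unfolding \<phi>_def using that k_pos pos b by (intro m_lt) auto
  ultimately have "cmod (\<phi> (m b a)) \<le> cmod (m b a)"
    using m_lt[OF a b] by (rule Schwarz_Lemma(1))
  moreover have "k (m b a) = a"
  proof -
    have "1 - m b a = (b - cnj b) / (a - cnj b)"
      using nz[OF a b] by (simp add: m_def divide_simps)
    moreover have "b - cnj b * m b a = a * (b - cnj b) / (a - cnj b)"
      using nz[OF a b] by (simp add: m_def divide_simps) (simp add: algebra_simps)
    moreover have "b - cnj b \<noteq> 0" using nz[OF b b] .
    ultimately show ?thesis
      unfolding k_def using nz[OF a b] by simp
  qed
  ultimately have le: "cmod ((f a - f b) / (f a - cnj (f b))) \<le> cmod ((a - b) / (a - cnj b))"
    by (simp add: \<phi>_def m_def)
  have pp: "cmod (f a - cnj (f b)) > 0" "cmod (a - cnj b) > 0"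
    using nz[OF pos[OF a] pos[OF b]] nz[OF a b] by auto
  have "cmod (f a - f b) * cmod (a - cnj b) \<le> cmod (a - b) * cmod (f a - cnj (f b))"
    using le pp by (simp add: norm_divide divide_simps mult.commute)
  then have "(cmod (f a - f b) * cmod (a - cnj b))\<^sup>2 \<le> (cmod (a - b) * cmod (f a - cnj (f b)))\<^sup>2"
    by (rule power_mono) simp
  \<comment> \<open>By \<open>norm_diff_cnj_sq\<close> both sides contain the same product of two
    squared distances, which cancels.\<close>
  then show ?thesis
    unfolding power_mult_distrib norm_diff_cnj_sq by (simp add: algebra_simps)
qed

text \<open>Subtracting \<open>\<i> (c - e)\<close> with \<open>e > 0\<close> brings the values into
  the open half-plane; letting \<open>e\<close> tend to 0 afterwards admits values on the line
  \<open>Im = c\<close>.\<close>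

lemma schwarz_pick_uhp_shift:
  assumes hol: "f holomorphic_on uhp" and ge: "\<And>w. 0 < Im w \<Longrightarrow> c \<le> Im (f w)"
    and a: "0 < Im a" and b: "0 < Im b"
  shows "(cmod (f a - f b))\<^sup>2 * (Im a * Im b) \<le> (cmod (a - b))\<^sup>2 * ((Im (f a) - c) * (Im (f b) - c))"
proof (rule tendsto_le)
  show "((\<lambda>e. (cmod (a - b))\<^sup>2 * ((Im (f a) - c + e) * (Im (f b) - c + e))) \<longlongrightarrow>
      (cmod (a - b))\<^sup>2 * ((Im (f a) - c) * (Im (f b) - c))) (at_right 0)"
    by (auto intro!: tendsto_eq_intros)
  show "eventually (\<lambda>e. (cmod (f a - f b))\<^sup>2 * (Im a * Im b) \<le>
      (cmod (a - b))\<^sup>2 * ((Im (f a) - c + e) * (Im (f b) - c + e))) (at_right 0)"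
    using eventually_at_right_less
  proof eventually_elim
    case (elim e)
    show ?case
      using schwarz_pick_uhp[of "\<lambda>w. f w - of_real (c - e) * \<i>" a b] a b ge elim
      by (force intro!: holomorphic_intros hol simp: algebra_simps)
  qed
qed auto

section \<open>Fixed points of self-maps: stability, multiplier, existence\<close>

lemma fixpoint_stable:
  assumes hol: "f holomorphic_on uhp" and ge: "\<And>w. 0 < Im w \<Longrightarrow> c \<le> Im (f w)"
    and w: "0 < Im w" "f w = w" and a: "0 < Im a" and c: "0 < c"
  shows "(cmod (f a - w))\<^sup>2 * Im a \<le> (cmod (a - w))\<^sup>2 * (Im (f a) - c)"
proof -
  have "(cmod (f a - w))\<^sup>2 * (Im a * Im w) \<le> (cmod (a - w))\<^sup>2 * ((Im (f a) - c) * (Im w - c))"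
    using schwarz_pick_uhp_shift[OF hol ge a w(1)] w by simp
  \<comment> \<open>Only one of the two gains of \<open>c\<close> is kept. The factor
    \<open>Im w\<close> then cancels, and the remaining ratio \<open>(Im (f a) - c) / Im a\<close>
    is still below 1 whenever \<open>Im (f a)\<close> is close to \<open>Im a\<close>.\<close>
  also have "\<dots> \<le> (cmod (a - w))\<^sup>2 * ((Im (f a) - c) * Im w)"
    using ge[OF a] c by (intro mult_left_mono) auto
  finally show ?thesis using w(1) by simp
qed

lemma fixpoint_unique:
  assumes hol: "f holomorphic_on uhp" and ge: "\<And>w. 0 < Im w \<Longrightarrow> c \<le> Im (f w)"
    and c: "0 < c" and w: "0 < Im w" "f w = w" and w': "0 < Im w'" "f w' = w'"
  shows "w = w'"
proof (rule ccontr)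
  assume "w \<noteq> w'"
  then have "(cmod (w' - w))\<^sup>2 > 0" by simp
  moreover have "(cmod (w' - w))\<^sup>2 * Im w' \<le> (cmod (w' - w))\<^sup>2 * (Im w' - c)"
    using fixpoint_stable[OF hol ge w w'(1) c] w' by simp
  ultimately show False using c by simp
qed

text \<open>Dividing the stability bound by \<open>|a - w|^2\<close> and letting \<open>a\<close>
  tend to \<open>w\<close> bounds the squared modulus of \<open>D\<close> by
  \<open>(Im w - c) / Im w\<close>.\<close>

lemma fixpoint_multiplier:
  assumes hol: "f holomorphic_on uhp" and ge: "\<And>w. 0 < Im w \<Longrightarrow> c \<le> Im (f w)"
    and c: "0 < c" and w: "0 < Im w" "f w = w"
    and D: "(f has_field_derivative D) (at w)"
  shows "cmod D < 1"
proof -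
  have lim1: "((\<lambda>a. (cmod ((f a - f w) / (a - w)))\<^sup>2) \<longlongrightarrow> (cmod D)\<^sup>2) (at w)"
    using D unfolding has_field_derivative_iff by (intro tendsto_intros)
  have "(f \<longlongrightarrow> f w) (at w)"
    using DERIV_isCont[OF D] by (simp add: isCont_def)
  then have lim2: "((\<lambda>a. (Im (f a) - c) / Im a) \<longlongrightarrow> (Im (f w) - c) / Im w) (at w)"
    by (intro tendsto_intros) (use w in auto)
  have "eventually (\<lambda>a. a \<in> uhp) (at w)"
    by (rule eventually_at_in_open'[OF open_uhp]) (use w in simp)
  then have "eventually (\<lambda>a. (cmod ((f a - f w) / (a - w)))\<^sup>2 \<le> (Im (f a) - c) / Im a) (at w)"
    using eventually_neq_at_within[of w w UNIV]
  proof eventually_elim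
    case (elim a)
    with fixpoint_stable[OF hol ge w, of a] c w show ?case
      by (auto simp: norm_divide power_divide divide_simps mult.commute)
  qed
  from tendsto_le[OF _ lim2 lim1 this] have "(cmod D)\<^sup>2 \<le> (Im w - c) / Im w"
    using w by simp
  also have "\<dots> < 1" using w c by (simp add: divide_simps)
  finally show ?thesis by (simp add: power_less_one_iff)
qed

text \<open>
  \<open>T e\<close> is the Moebius map with \<open>- 1 / T e u = - 1 / u + \<i> e\<close>: it sends \<open>H\<close> into the disc
  \<open>cball (\<i> / 2e) (1 / 2e)\<close> and tends to the identity as \<open>e \<rightarrow> 0\<close>.
\<close>

lemma fixpoint_exists:
  assumes hol: "f holomorphic_on uhp" and ge: "\<And>w. 0 < Im w \<Longrightarrow> c \<le> Im (f w)"
    and c: "0 < c" and a: "0 < Im a" "Im (f a) < Im a"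
  shows "\<exists>w. 0 < Im w \<and> f w = w"
proof -
  define T where "T e u = u / (1 - \<i> * of_real e * u)" for e :: real and u :: complex
  have N: "(cmod (1 - \<i> * of_real e * u))\<^sup>2 = 1 + 2 * e * Im u + e\<^sup>2 * (cmod u)\<^sup>2" for e u
    unfolding cmod_power2 by (simp add: power2_eq_square algebra_simps)
  have ImT: "Im (T e u) = (Im u + e * (cmod u)\<^sup>2) / (cmod (1 - \<i> * of_real e * u))\<^sup>2" for e u
    unfolding T_def Im_divide cmod_power2 by (simp add: power2_eq_square algebra_simps)
  have Tne: "1 - \<i> * of_real e * u \<noteq> 0" if "0 < e" "0 < Im u" for e u
    using that by (auto simp: complex_eq_iff algebra_simps) (smt (verit) mult_pos_pos)
  have contf: "continuous_on uhp f"
    using hol by (rule holomorphic_on_imp_continuous_on)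
  have ex: "\<exists>w. c / 2 \<le> Im w \<and> T e (f w) = w" if e: "0 < e" "e * c \<le> 1 / 2" for e
  proof -
    \<comment> \<open>The disc, rewritten in \<open>S_iff\<close> as
      \<open>e |w|^2 \<le> Im w\<close>, gives compactness. The half-plane
      \<open>Im w \<ge> c / 2\<close> keeps the fixed points away from the real axis uniformly in
      \<open>e\<close>, so that a limit of them stays in \<open>H\<close>.\<close>
    define S where "S = cball (\<i> / of_real (2 * e)) (1 / (2 * e)) \<inter> {w. Im w \<ge> c / 2}"
    have S_iff: "w \<in> S \<longleftrightarrow> e * (cmod w)\<^sup>2 \<le> Im w \<and> c / 2 \<le> Im w" for w
    proof -
      have "w \<in> cball (\<i> / of_real (2 * e)) (1 / (2 * e)) \<longleftrightarrow> (cmod (w - \<i> / of_real (2 * e)))\<^sup>2 \<le> (1 / (2 * e))\<^sup>2"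
        using e by (simp add: dist_norm norm_minus_commute abs_le_square_iff[symmetric])
      also have "(cmod (w - \<i> / of_real (2 * e)))\<^sup>2 = (cmod w)\<^sup>2 - Im w / e + (1 / (2 * e))\<^sup>2"
        unfolding cmod_power2 using e by (simp add: power2_eq_square field_simps)
      also have "\<dots> \<le> (1 / (2 * e))\<^sup>2 \<longleftrightarrow> e * (cmod w)\<^sup>2 \<le> Im w"
        using e by (simp add: field_simps)
      finally show ?thesis by (simp add: S_def)
    qed
    have "compact S" unfolding S_def
      by (intro compact_Int_closed compact_cball closed_halfspace_Im_ge)
    moreover have "convex S" unfolding S_def
      by (intro convex_Int convex_cball convex_halfspace_Im_ge)
    moreover have "\<i> * of_real (c / 2) \<in> S"
    proof -
      have "(e * c) * c \<le> (1/2) * c" using e c by (intro mult_right_mono) auto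
      then show ?thesis unfolding S_iff using c
        by (simp add: norm_mult power2_eq_square algebra_simps)
    qed
    moreover have "S \<subseteq> uhp" using c by (auto simp: S_def)
    then have "continuous_on S (\<lambda>w. T e (f w))"
      unfolding T_def using e c ge
      by (intro continuous_intros continuous_on_subset[OF contf]) (use Tne in fastforce)+
    moreover have "T e (f w) \<in> S" if "w \<in> S" for w
    proof -
      define u where "u = f w"
      have u: "c \<le> Im u" using that \<open>S \<subseteq> uhp\<close> ge by (auto simp: u_def)
      define N where "N = (cmod (1 - \<i> * of_real e * u))\<^sup>2"
      have N_eq: "N = 1 + 2 * e * Im u + e\<^sup>2 * (cmod u)\<^sup>2" unfolding N_def N ..
      have N_pos: "0 < N" using Tne[of e u] e u c by (simp add: N_def)
      have 1: "e * (cmod (T e u))\<^sup>2 \<le> Im (T e u)"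
        unfolding ImT N_def[symmetric] unfolding T_def norm_divide power_divide N_def[symmetric]
        using N_pos u c by (simp add: divide_simps)
      \<comment> \<open>The three summands of \<open>c / 2 * N\<close> are each dominated
        separately; this is where \<open>e * c \<le> 1 / 2\<close> enters.\<close>
      have "(e * c) * Im u \<le> (1/2) * Im u" using e u c by (intro mult_right_mono) auto
      moreover have "(e * c) * (e * (cmod u)\<^sup>2) \<le> (1/2) * (e * (cmod u)\<^sup>2)"
        using e by (intro mult_right_mono) auto
      moreover have "0 \<le> e * (cmod u)\<^sup>2" using e by simp
      ultimately have "c / 2 * N \<le> Im u + e * (cmod u)\<^sup>2"
        unfolding N_eq using u by (simp add: algebra_simps power2_eq_square)
      then have 2: "c / 2 \<le> Im (T e u)"
        unfolding ImT N_def[symmetric] using N_pos by (simp add: field_simps)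
      show ?thesis unfolding S_iff u_def[symmetric] using 1 2 by simp
    qed
    ultimately obtain w where "w \<in> S" "T e (f w) = w"
      using brouwer[of S "\<lambda>w. T e (f w)"] by blast
    then show ?thesis unfolding S_def by auto
  qed
  define e where "e n = 1 / (2 * c * real (Suc n))" for n
  have e: "0 < e n" "e n * c \<le> 1 / 2" for n
    using c by (auto simp: e_def divide_simps)
  have e_lim: "e \<longlonglongrightarrow> 0"
    unfolding e_def using c
    by (intro tendsto_divide_0[OF tendsto_const] filterlim_at_top_imp_at_infinity
        filterlim_tendsto_pos_mult_at_top[OF tendsto_const] filterlim_compose[OF filterlim_real_sequentially] filterlim_Suc) auto
  obtain w where w: "\<And>n. c / 2 \<le> Im (w n)" "\<And>n. T (e n) (f (w n)) = w n"
    using ex[OF e] by metis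
  have w_pos: "0 < Im (w n)" for n using w(1)[of n] c by linarith
  define \<beta> where "\<beta> n = T (e n) (f a)" for n
  have T_lim: "(\<lambda>n. T (e n) (g n)) \<longlonglongrightarrow> l" if "g \<longlonglongrightarrow> l" for g l
    unfolding T_def by (rule tendsto_eq_intros that e_lim tendsto_of_real refl | simp)+
  have \<beta>_lim: "\<beta> \<longlonglongrightarrow> f a" unfolding \<beta>_def by (intro T_lim tendsto_const)
  have Tpos: "0 < Im (T (e n) u)" if "0 < Im u" for n u
    unfolding ImT using Tne[OF e(1)[of n] that] e(1)[of n] that
    by (intro divide_pos_pos add_pos_nonneg) auto
  \<comment> \<open>Schwarz--Pick for the perturbed map between \<open>a\<close> and its fixed point
    \<open>w n\<close>, whose imaginary part occurs on both sides and cancels.\<close>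
  have sp: "(cmod (\<beta> n - w n))\<^sup>2 * Im a \<le> (cmod (a - w n))\<^sup>2 * Im (\<beta> n)" for n
  proof -
    have pos: "0 < Im (f u)" if "0 < Im u" for u using ge[OF that] c by linarith
    have "(\<lambda>u. T (e n) (f u)) holomorphic_on uhp"
      unfolding T_def by (intro holomorphic_intros hol) (use Tne[OF e(1)] pos in auto)
    from schwarz_pick_uhp[OF this _ a(1) w_pos[of n]]
    have "(cmod (\<beta> n - w n))\<^sup>2 * (Im a * Im (w n)) \<le> (cmod (a - w n))\<^sup>2 * (Im (\<beta> n) * Im (w n))"
      using Tpos pos w(2) by (simp add: \<beta>_def)
    then show ?thesis using w_pos[of n] by simp
  qed
  \<comment> \<open>\<open>q\<close> is the mean of 1 and \<open>Im (f a) / Im a < 1\<close>, so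
    \<open>Im (\<beta> n) < q * Im a\<close> for large \<open>n\<close>. Then
    \<open>|\<beta> n - w n| \<le> sqrt q * |a - w n|\<close> with \<open>\<beta> n\<close> bounded,
    and \<open>B\<close> is what this yields when solved for \<open>|w n|\<close>.\<close>
  define q where "q = (Im (f a) + Im a) / (2 * Im a)"
  have q: "Im (f a) < q * Im a" "q < 1" "0 < q"
    using a c ge[OF a(1)] by (auto simp: q_def field_simps)
  define B where "B = (cmod (f a) + 1 + sqrt q * cmod a) / (1 - sqrt q)"
  have sq: "sqrt q < 1" "0 < sqrt q" using q by auto
  have "eventually (\<lambda>n. cmod (\<beta> n) < cmod (f a) + 1) sequentially"
    using tendsto_norm[OF \<beta>_lim] by (rule order_tendstoD) simp
  moreover have "eventually (\<lambda>n. Im (\<beta> n) < q * Im a) sequentially"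
    using tendsto_Im[OF \<beta>_lim] q(1) by (rule order_tendstoD)
  ultimately have "eventually (\<lambda>n. cmod (w n) \<le> B) sequentially"
  proof eventually_elim
    case (elim n)
    have "(cmod (\<beta> n - w n))\<^sup>2 * Im a \<le> (cmod (a - w n))\<^sup>2 * (q * Im a)"
      using elim by (intro order_trans[OF sp mult_left_mono]) auto
    then have "(cmod (\<beta> n - w n))\<^sup>2 \<le> q * (cmod (a - w n))\<^sup>2"
      using a(1) by (simp add: mult.commute)
    then have "cmod (\<beta> n - w n) \<le> sqrt q * cmod (a - w n)"
      by (metis real_le_rsqrt real_sqrt_mult real_sqrt_unique norm_ge_zero)
    also have "\<dots> \<le> sqrt q * (cmod a + cmod (w n))"
      using sq by (intro mult_left_mono norm_triangle_ineq4) auto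
    finally have "cmod (w n) - cmod (\<beta> n) \<le> sqrt q * (cmod a + cmod (w n))"
      using norm_triangle_ineq2[of "w n" "\<beta> n"] by (simp add: norm_minus_commute)
    then show ?case unfolding B_def using elim sq by (simp add: field_simps)
  qed
  then obtain n0 where n0: "\<And>n. n \<ge> n0 \<Longrightarrow> cmod (w n) \<le> B"
    unfolding eventually_sequentially by auto
  define K where "K = cball 0 B \<inter> {w. Im w \<ge> c / 2}"
  have "compact K" unfolding K_def
    by (intro compact_Int_closed compact_cball closed_halfspace_Im_ge)
  moreover have "\<forall>n. w (n + n0) \<in> K" using n0 w(1) by (auto simp: K_def)
  ultimately obtain l r where l: "l \<in> K" "strict_mono r" "((\<lambda>n. w (n + n0)) \<circ> r) \<longlonglongrightarrow> l"
    using seq_compactE[of K "\<lambda>n. w (n + n0)"] unfolding compact_eq_seq_compact_metric by metis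
  have l_pos: "0 < Im l" using l(1) c by (auto simp: K_def)
  define s where "s n = r n + n0" for n
  have s: "strict_mono s" using l(2) by (simp add: s_def strict_mono_def)
  have ws: "(\<lambda>n. w (s n)) \<longlonglongrightarrow> l" using l(3) by (simp add: s_def comp_def)
  have "isCont f l"
    using contf l_pos open_uhp by (simp add: continuous_on_eq_continuous_at)
  then have fs: "(\<lambda>n. f (w (s n))) \<longlonglongrightarrow> f l" using ws by (rule isCont_tendsto_compose)
  have es: "(\<lambda>n. e (s n)) \<longlonglongrightarrow> 0" using LIMSEQ_subseq_LIMSEQ[OF e_lim s] by (simp add: comp_def)
  have "(\<lambda>n. T (e (s n)) (f (w (s n)))) \<longlonglongrightarrow> f l"
    unfolding T_def by (rule tendsto_eq_intros fs es tendsto_of_real refl | simp)+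
  then have "(\<lambda>n. w (s n)) \<longlonglongrightarrow> f l" by (simp add: w(2))
  with ws have "f l = l" using LIMSEQ_unique by blast
  with l_pos show ?thesis by blast
qed

text \<open>
  The intermediate point \<open>g2 (\<i> y)\<close> need not stay in a cone, so the growth of \<open>g1\<close> along cones is of no
  use here; Schwarz--Pick for \<open>g2\<close> shows instead that \<open>|g2 (\<i> y)|\<^sup>2 / Im (g2 (\<i> y))\<close> is \<open>o(y)\<close>.
\<close>

lemma comp_Im_less:
  assumes hol1: "g1 holomorphic_on uhp" and ge1: "\<And>w. 0 < Im w \<Longrightarrow> c \<le> Im (g1 w)"
    and hol2: "g2 holomorphic_on uhp" and ge2: "\<And>w. 0 < Im w \<Longrightarrow> c \<le> Im (g2 w)"
    and c: "0 < c"
    and lim: "((\<lambda>y. Im (g2 (\<i> * of_real y)) / y) \<longlongrightarrow> 0) at_top"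
  shows "\<exists>a. 0 < Im a \<and> Im (g1 (g2 a)) < Im a"
proof (rule ccontr)
  assume "\<not> ?thesis"
  then have neg: "Im a \<le> Im (g1 (g2 a))" if "0 < Im a" for a
    using that by (meson linorder_not_le)
  have pos1: "0 < Im (g1 w)" and pos2: "0 < Im (g2 w)" if "0 < Im w" for w
    using ge1[OF that] ge2[OF that] c by linarith+
  define C where "C = Im (g1 \<i>)"
  have C: "0 < C" using pos1 by (simp add: C_def)
  \<comment> \<open>Chosen to make \<open>2 * \<epsilon> * C = 1 / 2\<close>, so that in the final
    estimate half of \<open>y\<close> is left over.\<close>
  define \<epsilon> where "\<epsilon> = 1 / (4 * C)"
  have "eventually (\<lambda>y. Im (g2 (\<i> * of_real y)) / y < \<epsilon>) at_top"
    using lim by (rule order_tendstoD) (use C in \<open>simp add: \<epsilon>_def\<close>)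
  then have "eventually (\<lambda>y. Im (g2 (\<i> * of_real y)) / y < \<epsilon> \<and> 0 < y) at_top"
    using eventually_gt_at_top by (rule eventually_conj)
  then obtain B where B: "Im (g2 (\<i> * of_real B)) / B < \<epsilon>" "0 < B"
    by (auto dest!: eventually_happens)
  define p where "p = g2 (\<i> * of_real B)"
  define P where "P = (cmod (p - \<i>))\<^sup>2"
  \<comment> \<open>Large enough that \<open>(y / 2 - 2 * C) * c\<close> exceeds
    \<open>2 * P * C\<close>, by exactly \<open>(B / 2 + C) * c\<close>.\<close>
  define y where "y = B + 6 * C + 4 * P * C / c"
  define v where "v = g2 (\<i> * of_real y)"
  define Y where "Y = Im (g1 v)"
  have P: "0 \<le> P" by (simp add: P_def)
  have y: "B \<le> y" "4 * C < y" "0 < y" using B C P c by (auto simp: y_def intro: add_pos_nonneg add_strict_increasing2)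
  have v: "c \<le> Im v" using ge2 y by (simp add: v_def)
  have yY: "y \<le> Y" using neg[of "\<i> * of_real y"] y by (simp add: Y_def v_def)
  \<comment> \<open>Comparison of \<open>g2\<close> at \<open>\<i> y\<close> and
    \<open>\<i> B\<close>: since \<open>Im p < \<epsilon> B\<close>, dividing by \<open>y B\<close>
    leaves \<open>|v - p|^2 \<le> \<epsilon> y Im v\<close>.\<close>
  have "(cmod (v - p))\<^sup>2 * (y * B) \<le> (cmod (\<i> * of_real y - \<i> * of_real B))\<^sup>2 * (Im v * Im p)"
    using schwarz_pick_uhp[OF hol2 pos2, of "\<i> * of_real y" "\<i> * of_real B"] y B
    by (simp add: v_def p_def)
  also have "cmod (\<i> * of_real y - \<i> * of_real B) = y - B"
    using y by (simp add: cmod_def)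
  also have "(y - B)\<^sup>2 * (Im v * Im p) \<le> y\<^sup>2 * (Im v * (\<epsilon> * B))"
    using y B v c pos2[of "\<i> * of_real B"] by (intro mult_mono power_mono) (auto simp: p_def field_simps less_imp_le)
  finally have "(cmod (v - p))\<^sup>2 * (y * B) \<le> (\<epsilon> * y * Im v) * (y * B)"
    by (simp add: power2_eq_square mult_ac)
  then have vp: "(cmod (v - p))\<^sup>2 \<le> \<epsilon> * y * Im v"
    by (rule mult_right_le_imp_le) (use y B in simp)
  have "(cmod (v - \<i>))\<^sup>2 \<le> (cmod (v - p) + cmod (p - \<i>))\<^sup>2"
    using norm_triangle_ineq[of "v - p" "p - \<i>"] by (intro power_mono) simp_all
  also have "\<dots> \<le> 2 * (cmod (v - p))\<^sup>2 + 2 * P"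
    unfolding P_def using sum_squares_bound[of "cmod (v - p)" "cmod (p - \<i>)"]
    by (simp add: power2_sum)
  finally have vi: "(cmod (v - \<i>))\<^sup>2 \<le> 2 * (\<epsilon> * y * Im v) + 2 * P" using vp by simp
  \<comment> \<open>Schwarz--Pick for \<open>g1\<close> between \<open>v\<close> and
    \<open>\<i>\<close> controls \<open>Y\<close> by \<open>|v - \<i>|^2 / Im v\<close>. The factor
    \<open>Im v\<close> in the bound on \<open>|v - p|^2\<close> compensates the denominator,
    wherever \<open>v\<close> lies.\<close>
  have "(Y - C)\<^sup>2 * Im v \<le> (cmod (g1 v - g1 \<i>))\<^sup>2 * Im v"
    using v c abs_Im_le_cmod[of "g1 v - g1 \<i>"]
    by (intro mult_right_mono abs_le_square_iff[THEN iffD1]) (auto simp: Y_def C_def)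
  also have "\<dots> \<le> (cmod (v - \<i>))\<^sup>2 * (Y * C)"
    using schwarz_pick_uhp[OF hol1 pos1, of v \<i>] v c by (simp add: Y_def C_def)
  also have "\<dots> \<le> (2 * (\<epsilon> * y * Im v) + 2 * P) * (Y * C)"
    using vi yY y C by (intro mult_right_mono) auto
  finally have "(Y - C)\<^sup>2 * Im v \<le> (2 * (\<epsilon> * y * Im v) + 2 * P) * (Y * C)" .
  moreover have "Y * (Y - 2 * C) * Im v \<le> (Y - C)\<^sup>2 * Im v"
    using v c by (intro mult_right_mono) (auto simp: power2_eq_square algebra_simps)
  ultimately have "Y * ((Y - 2 * C) * Im v) \<le> Y * ((2 * (\<epsilon> * y * Im v) + 2 * P) * C)"
    by (simp add: algebra_simps)
  then have "(Y - 2 * C) * Im v \<le> (2 * (\<epsilon> * y * Im v) + 2 * P) * C"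
    using yY y by simp
  also have "\<dots> = y / 2 * Im v + 2 * P * C"
    using C by (simp add: \<epsilon>_def field_simps)
  finally have "(Y - 2 * C - y / 2) * Im v \<le> 2 * P * C"
    by (simp add: algebra_simps)
  moreover have "(y / 2 - 2 * C) * c \<le> (Y - 2 * C - y / 2) * Im v"
    using yY y v c by (intro mult_mono) auto
  ultimately have "(y / 2 - 2 * C) * c \<le> 2 * P * C" by linarith
  moreover have "(y / 2 - 2 * C) * c = (B / 2 + C) * c + 2 * P * C"
    using c by (simp add: y_def field_simps)
  moreover have "(B / 2 + C) * c > 0" using B C c by simp
  ultimately show False by linarith
qed

section \<open>Reciprocal Cauchy transforms\<close>

lemma real_prob_iff: "real_prob M \<longleftrightarrow> real_distribution M"
  by (simp add: real_prob_def real_distribution_def real_distribution_axioms_def)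

text \<open>Minus the divided difference of \<open>cauchy_G\<close>. As a single integral it makes
  sense on the diagonal and passes to weak limits of the measure.\<close>

definition cauchy_G2 :: "real measure \<Rightarrow> complex \<Rightarrow> complex \<Rightarrow> complex" where
  "cauchy_G2 M a b = (\<integral>x. 1 / ((a - complex_of_real x) * (b - complex_of_real x)) \<partial>M)"

text \<open>
  The divided difference of \<open>cauchy_F M\<close>, extended by the derivative to the diagonal.
\<close>

definition secant_F :: "real measure \<Rightarrow> complex \<Rightarrow> complex \<Rightarrow> complex" where
  "secant_F M a b = cauchy_F M a * cauchy_F M b * cauchy_G2 M a b"

lemma uhp_minus_real_ne: "0 < Im z \<Longrightarrow> z - complex_of_real x \<noteq> 0"
  by (auto simp: complex_eq_iff)

lemma norm_resolvent_le:
  assumes "0 < Im z" shows "cmod (1 / (z - complex_of_real x)) \<le> 1 / Im z"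
proof -
  have "Im z \<le> cmod (z - complex_of_real x)"
    using abs_Im_le_cmod[of "z - complex_of_real x"] by simp
  then show ?thesis using assms by (simp add: norm_divide frac_le)
qed

lemma resolvent_diff:
  assumes "0 < Im a" "0 < Im b"
  shows "1 / (a - complex_of_real x) - 1 / (b - complex_of_real x) =
    (b - a) * (1 / ((a - complex_of_real x) * (b - complex_of_real x)))"
  using uhp_minus_real_ne[OF assms(1), of x] uhp_minus_real_ne[OF assms(2), of x]
  by (simp add: divide_simps)

lemma norm_resolvent_prod_le:
  assumes "0 < Im a" "0 < Im b"
  shows "cmod (1 / ((a - complex_of_real x) * (b - complex_of_real x))) \<le> 1 / (Im a * Im b)"
  using mult_mono[OF norm_resolvent_le[OF assms(1), of x] norm_resolvent_le[OF assms(2), of x]] assms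
  by (simp add: norm_mult norm_divide)

lemma norm_resolvent_diff_le:
  assumes "0 < Im a" "0 < Im b"
  shows "cmod (1 / (a - complex_of_real x) - 1 / (b - complex_of_real x)) \<le> cmod (b - a) * (1 / (Im a * Im b))"
  unfolding resolvent_diff[OF assms] norm_mult
  by (intro mult_left_mono norm_resolvent_prod_le assms) simp

lemma isCont_resolvent: "0 < Im a \<Longrightarrow> isCont (\<lambda>x. 1 / (a - complex_of_real x)) x"
  by (intro continuous_intros uhp_minus_real_ne)

context real_distribution
begin

lemma prob_UNIV [simp]: "prob UNIV = 1"
  using prob_space by simp

lemma integrable_resolvent:
  "0 < Im z \<Longrightarrow> integrable M (\<lambda>x. 1 / (z - complex_of_real x))"
  by (rule integrable_const_bound[where B = "1 / Im z"]) (use norm_resolvent_le in auto)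

lemma integrable_resolvent_prod:
  "0 < Im a \<Longrightarrow> 0 < Im b \<Longrightarrow> integrable M (\<lambda>x. 1 / ((a - complex_of_real x) * (b - complex_of_real x)))"
  by (rule integrable_const_bound[where B = "1 / (Im a * Im b)"]) (use norm_resolvent_prod_le in auto)

lemma cauchy_G_diff:
  assumes "0 < Im a" "0 < Im b"
  shows "cauchy_G M a - cauchy_G M b = (b - a) * cauchy_G2 M a b"
proof -
  have "cauchy_G M a - cauchy_G M b = (\<integral>x. 1 / (a - complex_of_real x) - 1 / (b - complex_of_real x) \<partial>M)"
    unfolding cauchy_G_def using assms
    by (intro Bochner_Integration.integral_diff[symmetric] integrable_resolvent)
  also have "\<dots> = (b - a) * cauchy_G2 M a b"
    unfolding resolvent_diff[OF assms] cauchy_G2_def by (rule integral_mult_right_zero)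
  finally show ?thesis .
qed

lemma Im_cauchy_G:
  assumes z: "0 < Im z"
  shows "Im (cauchy_G M z) = - Im z * (\<integral>x. (cmod (1 / (z - complex_of_real x)))\<^sup>2 \<partial>M)"
proof -
  have "Im (1 / (z - complex_of_real x)) = - Im z * (cmod (1 / (z - complex_of_real x)))\<^sup>2" for x
    by (simp add: Im_divide norm_divide power_divide cmod_power2)
  then show ?thesis
    unfolding cauchy_G_def using integral_Im[OF integrable_resolvent[OF z]] by simp
qed

lemma norm_cauchy_G_sq_le:
  assumes z: "0 < Im z"
  shows "(cmod (cauchy_G M z))\<^sup>2 \<le> (\<integral>x. (cmod (1 / (z - complex_of_real x)))\<^sup>2 \<partial>M)"
    and "0 < (\<integral>x. (cmod (1 / (z - complex_of_real x)))\<^sup>2 \<partial>M)"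
proof -
  let ?g = "\<lambda>x. cmod (1 / (z - complex_of_real x))"
  have le: "?g x \<le> 1 / Im z" for x using norm_resolvent_le[OF z] .
  have int: "integrable M ?g" using integrable_resolvent[OF z] by (rule integrable_norm)
  have int2: "integrable M (\<lambda>x. (?g x)\<^sup>2)"
    by (rule integrable_const_bound[where B = "(1 / Im z)\<^sup>2"])
      (use power_mono[OF le, of _ 2] in auto)
  have "(cmod (cauchy_G M z))\<^sup>2 \<le> (expectation ?g)\<^sup>2"
    unfolding cauchy_G_def by (intro power_mono integral_norm_bound) simp
  \<comment> \<open>Cauchy--Schwarz, in the form that a variance is nonnegative.\<close>
  also have "\<dots> \<le> expectation (\<lambda>x. (?g x)\<^sup>2)"
    using variance_positive[of ?g] variance_eq[OF int int2] by simp
  finally show "(cmod (cauchy_G M z))\<^sup>2 \<le> expectation (\<lambda>x. (?g x)\<^sup>2)" .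
  show "0 < expectation (\<lambda>x. (?g x)\<^sup>2)"
    by (rule expectation_greater[OF int2]) (use uhp_minus_real_ne[OF z] in auto)
qed

lemma Im_cauchy_G_neg: "0 < Im z \<Longrightarrow> Im (cauchy_G M z) < 0"
  using norm_cauchy_G_sq_le(2)[of z] by (simp add: Im_cauchy_G)

lemma cauchy_G_nonzero: "0 < Im z \<Longrightarrow> cauchy_G M z \<noteq> 0"
  using Im_cauchy_G_neg[of z] by auto

text \<open>\<open>Im F = Im z * Q / |G|^2\<close>, where \<open>Q\<close> is the mean of
  \<open>|1 / (z - x)|^2\<close> and dominates \<open>|G|^2\<close>. Thus \<open>F w - w\<close> has
  nonnegative imaginary part, which is what makes the subordination map send \<open>H\<close> into
  \<open>{Im \<ge> Im z}\<close>.\<close>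

lemma Im_cauchy_F_ge:
  assumes z: "0 < Im z"
  shows "Im z \<le> Im (cauchy_F M z)"
proof -
  define Q where "Q = (\<integral>x. (cmod (1 / (z - complex_of_real x)))\<^sup>2 \<partial>M)"
  have *: "(cmod (cauchy_G M z))\<^sup>2 \<le> Q" "0 < (cmod (cauchy_G M z))\<^sup>2"
    using norm_cauchy_G_sq_le[OF z] cauchy_G_nonzero[OF z] by (auto simp: Q_def)
  have "Im (cauchy_F M z) = Im z * Q / (cmod (cauchy_G M z))\<^sup>2"
    unfolding cauchy_F_def Im_divide cmod_power2[symmetric] using Im_cauchy_G[OF z] by (simp add: Q_def)
  moreover have "Im z * (cmod (cauchy_G M z))\<^sup>2 \<le> Im z * Q" using * z by simp
  ultimately show ?thesis using * by (simp only: pos_le_divide_eq)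
qed

lemma Im_cauchy_F_pos: "0 < Im z \<Longrightarrow> 0 < Im (cauchy_F M z)"
  using Im_cauchy_F_ge[of z] by linarith

lemma cauchy_F_diff:
  assumes "0 < Im a" "0 < Im b"
  shows "cauchy_F M a - cauchy_F M b = (a - b) * secant_F M a b"
proof -
  have "cauchy_F M a - cauchy_F M b = - (cauchy_G M a - cauchy_G M b) * (cauchy_F M a * cauchy_F M b)"
    using cauchy_G_nonzero[OF assms(1)] cauchy_G_nonzero[OF assms(2)]
    by (simp add: cauchy_F_def divide_simps)
  then show ?thesis
    unfolding cauchy_G_diff[OF assms] secant_F_def by (simp add: algebra_simps)
qed

end

section \<open>Continuity of transforms under weak convergence\<close>

lemma weak_conv_integral_uniform:
  fixes h :: "nat \<Rightarrow> real \<Rightarrow> complex"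
  assumes N: "\<And>n. real_distribution (N n)" and M: "real_distribution M" and w: "weak_conv_m N M"
    and cont: "\<And>x. isCont h0 x" and bd: "\<And>x. cmod (h0 x) \<le> B"
    and int: "\<And>n. integrable (N n) (h n)"
    and unif: "\<And>n x. cmod (h n x - h0 x) \<le> e n" and e: "e \<longlonglongrightarrow> 0"
  shows "(\<lambda>n. \<integral>x. h n x \<partial>N n) \<longlonglongrightarrow> (\<integral>x. h0 x \<partial>M)"
proof -
  have 1: "(\<lambda>n. \<integral>x. h0 x \<partial>N n) \<longlonglongrightarrow> (\<integral>x. h0 x \<partial>M)"
    by (rule weak_conv_imp_integral_bdd_continuous_conv[OF N M w cont bd])
  have h0m: "h0 \<in> borel_measurable borel"
    using cont by (intro borel_measurable_continuous_onI) (simp add: continuous_at_imp_continuous_on)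
  \<comment> \<open>Weak convergence handles the fixed integrand \<open>h0\<close>; the moving part
    costs at most \<open>e n\<close> because the measures have mass 1.\<close>
  have 2: "(\<lambda>n. (\<integral>x. h n x \<partial>N n) - (\<integral>x. h0 x \<partial>N n)) \<longlonglongrightarrow> 0"
  proof (rule Lim_null_comparison[OF always_eventually e], rule allI)
    fix n
    interpret real_distribution "N n" by (rule N)
    have int0: "integrable (N n) h0"
      by (rule integrable_const_bound[where B = B]) (use bd h0m in auto)
    have "cmod ((\<integral>x. h n x \<partial>N n) - (\<integral>x. h0 x \<partial>N n)) = cmod (\<integral>x. h n x - h0 x \<partial>N n)"
      using int int0 by simp
    also have "\<dots> \<le> (\<integral>x. cmod (h n x - h0 x) \<partial>N n)" by (rule integral_norm_bound)
    also have "\<dots> \<le> (\<integral>x. e n \<partial>N n)"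
      using int int0 unif by (intro integral_mono integrable_norm) auto
    finally show "cmod ((\<integral>x. h n x \<partial>N n) - (\<integral>x. h0 x \<partial>N n)) \<le> e n"
      by (simp add: prob_space)
  qed
  show ?thesis using tendsto_add[OF 2 1] by simp
qed

lemma weak_conv_cauchy_G:
  assumes N: "\<And>n. real_distribution (N n)" and M: "real_distribution M" and w: "weak_conv_m N M"
    and a: "a \<longlonglongrightarrow> a0" "\<And>n. 0 < Im (a n)" "0 < Im a0"
  shows "(\<lambda>n. cauchy_G (N n) (a n)) \<longlonglongrightarrow> cauchy_G M a0"
  unfolding cauchy_G_def
proof (rule weak_conv_integral_uniform[OF N M w])
  show "integrable (N n) (\<lambda>x. 1 / (a n - complex_of_real x))" for n
    by (rule real_distribution.integrable_resolvent[OF N a(2)])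
  show "cmod (1 / (a n - complex_of_real x) - 1 / (a0 - complex_of_real x)) \<le> cmod (a0 - a n) * (1 / (Im (a n) * Im a0))" for n x
    by (rule norm_resolvent_diff_le[OF a(2,3)])
  show "(\<lambda>n. cmod (a0 - a n) * (1 / (Im (a n) * Im a0))) \<longlonglongrightarrow> 0"
    by (rule tendsto_eq_intros a(1) refl | use a(3) in simp)+
qed (use a norm_resolvent_le in \<open>auto intro: isCont_resolvent\<close>)

lemma weak_conv_cauchy_G2:
  assumes N: "\<And>n. real_distribution (N n)" and M: "real_distribution M" and w: "weak_conv_m N M"
    and a: "a \<longlonglongrightarrow> a0" "\<And>n. 0 < Im (a n)" "0 < Im a0"
    and b: "b \<longlonglongrightarrow> b0" "\<And>n. 0 < Im (b n)" "0 < Im b0"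
  shows "(\<lambda>n. cauchy_G2 (N n) (a n) (b n)) \<longlonglongrightarrow> cauchy_G2 M a0 b0"
  unfolding cauchy_G2_def
proof (rule weak_conv_integral_uniform[OF N M w])
  let ?e = "\<lambda>n. cmod (a0 - a n) * (1 / (Im (a n) * Im a0)) * (1 / Im (b n)) +
      1 / Im a0 * (cmod (b0 - b n) * (1 / (Im (b n) * Im b0)))"
  show "integrable (N n) (\<lambda>x. 1 / ((a n - complex_of_real x) * (b n - complex_of_real x)))" for n
    by (rule real_distribution.integrable_resolvent_prod[OF N a(2) b(2)])
  show "cmod (1 / ((a n - complex_of_real x) * (b n - complex_of_real x)) -
      1 / ((a0 - complex_of_real x) * (b0 - complex_of_real x))) \<le> ?e n" for n x
  proof -
    let ?r = "\<lambda>z. 1 / (z - complex_of_real x)"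
    have "1 / ((a n - complex_of_real x) * (b n - complex_of_real x)) -
      1 / ((a0 - complex_of_real x) * (b0 - complex_of_real x)) =
      (?r (a n) - ?r a0) * ?r (b n) + ?r a0 * (?r (b n) - ?r b0)"
      by (simp add: algebra_simps)
    also have "cmod \<dots> \<le> cmod (?r (a n) - ?r a0) * cmod (?r (b n)) + cmod (?r a0) * cmod (?r (b n) - ?r b0)"
      unfolding norm_mult[symmetric] by (rule norm_triangle_ineq)
    also have "\<dots> \<le> ?e n"
      by (intro add_mono mult_mono norm_resolvent_diff_le norm_resolvent_le a b)
        (use a(2)[of n] a(3) in \<open>auto intro: less_imp_le\<close>)
    finally show ?thesis .
  qed
  show "?e \<longlonglongrightarrow> 0"
    by (rule tendsto_eq_intros a(1) b(1) refl | use a(3) b(3) in simp)+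
  show "isCont (\<lambda>x. 1 / ((a0 - complex_of_real x) * (b0 - complex_of_real x))) x" for x
    using uhp_minus_real_ne[OF a(3), of x] uhp_minus_real_ne[OF b(3), of x]
    by (intro continuous_intros) simp
  show "cmod (1 / ((a0 - complex_of_real x) * (b0 - complex_of_real x))) \<le> 1 / (Im a0 * Im b0)" for x
    by (rule norm_resolvent_prod_le[OF a(3) b(3)])
qed

lemma weak_conv_cauchy_F:
  assumes N: "\<And>n. real_distribution (N n)" and M: "real_distribution M" and w: "weak_conv_m N M"
    and a: "a \<longlonglongrightarrow> a0" "\<And>n. 0 < Im (a n)" "0 < Im a0"
  shows "(\<lambda>n. cauchy_F (N n) (a n)) \<longlonglongrightarrow> cauchy_F M a0"
  unfolding cauchy_F_def
  by (intro tendsto_divide tendsto_const weak_conv_cauchy_G assms real_distribution.cauchy_G_nonzero[OF M a(3)])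

text \<open>Joint continuity in the measure and in both points. A constant sequence of measures
  gives complex derivatives; a sequence \<open>\<nu> (X n)\<close> serves the derivative in
  time.\<close>

lemma weak_conv_secant_F:
  assumes N: "\<And>n. real_distribution (N n)" and M: "real_distribution M" and w: "weak_conv_m N M"
    and a: "a \<longlonglongrightarrow> a0" "\<And>n. 0 < Im (a n)" "0 < Im a0"
    and b: "b \<longlonglongrightarrow> b0" "\<And>n. 0 < Im (b n)" "0 < Im b0"
  shows "(\<lambda>n. secant_F (N n) (a n) (b n)) \<longlonglongrightarrow> secant_F M a0 b0"
  unfolding secant_F_def by (intro tendsto_mult weak_conv_cauchy_F weak_conv_cauchy_G2 assms)

lemma weak_conv_m_const: "weak_conv_m (\<lambda>_. M) M"
  by (simp add: weak_conv_m_def weak_conv_def)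

context real_distribution
begin

lemma has_field_derivative_cauchy_F:
  assumes b: "0 < Im b"
  shows "(cauchy_F M has_field_derivative secant_F M b b) (at b)"
  unfolding has_field_derivative_iff
proof (rule Lim_transform_eventually)
  \<comment> \<open>Sequential continuity, from the weak convergence lemma for a constant sequence
    of measures.\<close>
  have "((\<lambda>a. secant_F M a b) \<longlongrightarrow> secant_F M b b) (at b within uhp)"
    unfolding tendsto_at_iff_sequentially comp_def
    using weak_conv_secant_F[OF real_distribution_axioms real_distribution_axioms weak_conv_m_const]
    using b by auto
  then show "((\<lambda>a. secant_F M a b) \<longlongrightarrow> secant_F M b b) (at b)"
    using at_within_open[OF _ open_uhp, of b] b by simp
  have "eventually (\<lambda>a. a \<in> uhp - {b}) (at b)"
    by (rule eventually_at_in_open[OF open_uhp]) (use b in simp)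
  then show "eventually (\<lambda>a. secant_F M a b = (cauchy_F M a - cauchy_F M b) / (a - b)) (at b)"
    by eventually_elim (use b in \<open>auto simp: cauchy_F_diff\<close>)
qed

lemma holomorphic_cauchy_F: "cauchy_F M holomorphic_on uhp"
  using has_field_derivative_cauchy_F
  by (auto simp: holomorphic_on_open[OF open_uhp])

lemma cauchy_G_eq: "cauchy_G M z = 1 / cauchy_F M z"
  by (simp add: cauchy_F_def)

section \<open>Behaviour of transforms at infinity in cones\<close>

definition cone_tail :: "real \<Rightarrow> real \<Rightarrow> real" where
  "cone_tail l T = expectation (\<lambda>x. min (l + 2) (\<bar>x\<bar> / T))"

lemma integrable_cone_tail: "0 \<le> l \<Longrightarrow> 0 < T \<Longrightarrow> integrable M (\<lambda>x. min (l + 2) (\<bar>x\<bar> / T))"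
  by (rule integrable_const_bound[where B = "l + 2"]) auto

text \<open>Capping \<open>|x| / T\<close> at \<open>l + 2\<close> makes the integrand bounded, so
  dominated convergence works for measures with no moments. Both bounds in the minimum are valid for
  \<open>|z / (z - x) - 1|\<close> on the cone.\<close>

lemma cone_tail_tendsto_0:
  assumes l: "0 \<le> l" shows "(cone_tail l \<longlongrightarrow> 0) at_top"
proof -
  have "((\<lambda>T. expectation (\<lambda>x. min (l + 2) (\<bar>x\<bar> / T))) \<longlongrightarrow> expectation (\<lambda>x. 0)) at_top"
  proof (rule integral_dominated_convergence_at_top[where w = "\<lambda>_. l + 2"])
    show "\<forall>\<^sub>F T in at_top. AE x in M. norm (min (l + 2) (\<bar>x\<bar> / T)) \<le> l + 2"
      using eventually_gt_at_top[of 0] by eventually_elim (use l in auto)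
    show "AE x in M. ((\<lambda>T. min (l + 2) (\<bar>x\<bar> / T)) \<longlongrightarrow> 0) at_top"
    proof (intro AE_I2)
      fix x :: real
      have "((\<lambda>T. \<bar>x\<bar> * inverse T) \<longlongrightarrow> 0) at_top"
        by (intro tendsto_mult_right_zero tendsto_inverse_0_at_top filterlim_ident)
      then have "((\<lambda>T. min (l + 2) (\<bar>x\<bar> / T)) \<longlongrightarrow> min (l + 2) 0) at_top"
        unfolding divide_inverse by (intro tendsto_intros)
      then show "((\<lambda>T. min (l + 2) (\<bar>x\<bar> / T)) \<longlongrightarrow> 0) at_top" using l by simp
    qed
  qed auto
  then show ?thesis by (simp add: cone_tail_def[abs_def])
qed

end

lemma norm_cone_le:
  assumes "z \<in> cone l T" "0 \<le> l" shows "cmod z \<le> (l + 1) * Im z"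
  using cmod_le[of z] assms by (auto simp: cone_def algebra_simps)

lemma cone_resolvent_bounds:
  assumes z: "z \<in> cone l T" and l: "0 \<le> l" and T: "0 < T"
  shows "cmod (z / (z - complex_of_real x)) \<le> l + 1"
    and "cmod (z / (z - complex_of_real x) - 1) \<le> min (l + 2) (\<bar>x\<bar> / T)"
proof -
  have Im: "0 < Im z" "T < Im z" using z by (auto simp: cone_def)
  have "cmod z * cmod (1 / (z - complex_of_real x)) \<le> ((l + 1) * Im z) * (1 / Im z)"
    using norm_cone_le[OF z l] norm_resolvent_le[OF Im(1)] Im l by (intro mult_mono) auto
  then show 1: "cmod (z / (z - complex_of_real x)) \<le> l + 1"
    using Im by (simp add: norm_divide)
  have "z / (z - complex_of_real x) - 1 = of_real x * (1 / (z - complex_of_real x))"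
    using uhp_minus_real_ne[OF Im(1), of x] by (simp add: divide_simps)
  then have "cmod (z / (z - complex_of_real x) - 1) = \<bar>x\<bar> * cmod (1 / (z - complex_of_real x))"
    by (simp only: norm_mult norm_of_real)
  also have "\<dots> \<le> \<bar>x\<bar> * (1 / Im z)"
    by (intro mult_left_mono norm_resolvent_le Im) simp
  also have "\<dots> \<le> \<bar>x\<bar> * (1 / T)"
    using Im T by (intro mult_left_mono divide_left_mono) auto
  finally have "cmod (z / (z - complex_of_real x) - 1) \<le> \<bar>x\<bar> / T" by simp
  moreover have "cmod (z / (z - complex_of_real x) - 1) \<le> l + 2"
    using norm_triangle_ineq4[of "z / (z - complex_of_real x)" 1] 1 by simp
  ultimately show "cmod (z / (z - complex_of_real x) - 1) \<le> min (l + 2) (\<bar>x\<bar> / T)" by simp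
qed

context real_distribution
begin

lemma cone_cauchy_G:
  assumes z: "z \<in> cone l T" and l: "0 \<le> l" and T: "0 < T"
  shows "cmod (z * cauchy_G M z - 1) \<le> cone_tail l T"
proof -
  have Im: "0 < Im z" using z by (auto simp: cone_def)
  note int = integrable_mult_right[OF integrable_resolvent[OF Im], of z, simplified]
  have "z * cauchy_G M z - 1 = (\<integral>x. z / (z - complex_of_real x) - 1 \<partial>M)"
    unfolding cauchy_G_def integral_mult_right_zero[symmetric]
    using int by (simp add: prob_space)
  also have "cmod \<dots> \<le> (\<integral>x. cmod (z / (z - complex_of_real x) - 1) \<partial>M)"
    by (rule integral_norm_bound)
  also have "\<dots> \<le> cone_tail l T"
    unfolding cone_tail_def using int cone_resolvent_bounds[OF z l T] integrable_cone_tail[OF l T]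
    by (intro integral_mono integrable_norm) auto
  finally show ?thesis .
qed

lemma cone_cauchy_G2:
  assumes a: "a \<in> cone l T" and b: "b \<in> cone l T" and l: "0 \<le> l" and T: "0 < T"
  shows "cmod (a * b * cauchy_G2 M a b - 1) \<le> (l + 2) * cone_tail l T"
proof -
  have Im: "0 < Im a" "0 < Im b" using a b by (auto simp: cone_def)
  let ?r = "\<lambda>z x. z / (z - complex_of_real x)"
  have int: "integrable M (\<lambda>x. ?r a x * ?r b x)"
    using integrable_mult_right[OF integrable_resolvent_prod[OF Im], of "a * b"] by simp
  have "a * b * cauchy_G2 M a b - 1 = (\<integral>x. ?r a x * ?r b x - 1 \<partial>M)"
    unfolding cauchy_G2_def integral_mult_right_zero[symmetric]
    using int by (simp add: prob_space)
  also have "cmod \<dots> \<le> (\<integral>x. cmod (?r a x * ?r b x - 1) \<partial>M)"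
    by (rule integral_norm_bound)
  also have "\<dots> \<le> (\<integral>x. (l + 2) * min (l + 2) (\<bar>x\<bar> / T) \<partial>M)"
  proof (intro integral_mono)
    fix x
    have "?r a x * ?r b x - 1 = ?r a x * (?r b x - 1) + (?r a x - 1)" by (simp add: algebra_simps)
    also have "cmod \<dots> \<le> cmod (?r a x) * cmod (?r b x - 1) + cmod (?r a x - 1)"
      unfolding norm_mult[symmetric] by (rule norm_triangle_ineq)
    also have "\<dots> \<le> (l + 1) * min (l + 2) (\<bar>x\<bar> / T) + min (l + 2) (\<bar>x\<bar> / T)"
      using l by (intro add_mono mult_mono cone_resolvent_bounds[OF a l T] cone_resolvent_bounds[OF b l T]) auto
    finally show "cmod (?r a x * ?r b x - 1) \<le> (l + 2) * min (l + 2) (\<bar>x\<bar> / T)"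
      by (simp add: algebra_simps)
  qed (use int integrable_cone_tail[OF l T] in auto)
  also have "\<dots> = (l + 2) * cone_tail l T"
    by (simp add: cone_tail_def)
  finally show ?thesis .
qed

lemma cauchy_F_asymptotic:
  assumes l: "0 \<le> l" and e: "0 < e"
  shows "\<exists>T>0. \<forall>z\<in>cone l T. cmod (cauchy_F M z - z) \<le> e * cmod z"
proof -
  \<comment> \<open>The solution of \<open>d / (1 - d) = e\<close>, the relative error that
    \<open>1 / u\<close> inherits from \<open>|u - 1| \<le> d\<close>.\<close>
  define d where "d = e / (1 + e)"
  have d: "0 < d" "d < 1" "d / (1 - d) = e" using e by (auto simp: d_def field_simps)
  have "eventually (\<lambda>T. cone_tail l T < d \<and> 0 < T) at_top"
    using order_tendstoD(2)[OF cone_tail_tendsto_0[OF l] d(1)] eventually_gt_at_top by (rule eventually_conj)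
  then obtain T where T: "cone_tail l T < d" "0 < T" by (auto dest!: eventually_happens)
  have "cmod (cauchy_F M z - z) \<le> e * cmod z" if z: "z \<in> cone l T" for z
  proof -
    define u where "u = z * cauchy_G M z"
    have u: "cmod (u - 1) \<le> d" using cone_cauchy_G[OF z l T(2)] T by (simp add: u_def)
    have "1 - d \<le> cmod u"
      using norm_triangle_ineq2[of 1 "1 - u"] u by (simp add: norm_minus_commute)
    have "0 < Im z" using z by (simp add: cone_def)
    then have "cauchy_F M z - z = z * ((1 - u) / u)"
      using cauchy_G_nonzero[of z] by (auto simp: cauchy_F_def u_def divide_simps)
    also have "cmod \<dots> = cmod z * (cmod (u - 1) / cmod u)"
      by (simp add: norm_mult norm_divide norm_minus_commute)
    also have "\<dots> \<le> cmod z * (d / (1 - d))"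
      using u \<open>1 - d \<le> cmod u\<close> d by (intro mult_left_mono frac_le) auto
    finally show ?thesis by (simp add: d(3) mult.commute)
  qed
  with T show ?thesis by blast
qed

text \<open>Far out, \<open>a * b * cauchy_G2 M a b\<close> is within distance less than 1 of 1, so
  the divided difference of \<open>G\<close> never vanishes there. The threshold
  \<open>1 / (l + 2)\<close> offsets the factor in \<open>cone_cauchy_G2\<close>.\<close>

lemma cauchy_F_inj_on_cone:
  assumes l: "0 \<le> l"
  shows "\<exists>T>0. inj_on (cauchy_F M) (cone l T)"
proof -
  have "eventually (\<lambda>T. cone_tail l T < 1 / (l + 2) \<and> 0 < T) at_top"
    using order_tendstoD(2)[OF cone_tail_tendsto_0[OF l], of "1 / (l + 2)"] l eventually_gt_at_top
    by (intro eventually_conj) auto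
  then obtain T where T: "cone_tail l T < 1 / (l + 2)" "0 < T" by (auto dest!: eventually_happens)
  have "inj_on (cauchy_F M) (cone l T)"
  proof (rule inj_onI)
    fix a b assume ab: "a \<in> cone l T" "b \<in> cone l T" "cauchy_F M a = cauchy_F M b"
    then have Im: "0 < Im a" "0 < Im b" by (auto simp: cone_def)
    have "(l + 2) * cone_tail l T < 1" using T l by (simp add: field_simps)
    then have "cmod (a * b * cauchy_G2 M a b - 1) < 1"
      using cone_cauchy_G2[OF ab(1,2) l T(2)] by linarith
    then have "cauchy_G2 M a b \<noteq> 0" by auto
    moreover have "(b - a) * cauchy_G2 M a b = 0"
      using cauchy_G_diff[OF Im] ab(3) by (simp add: cauchy_G_eq)
    ultimately show "a = b" by simp
  qed
  with T show ?thesis by blast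
qed

end

text \<open>Relative perturbations of size \<open>d\<close> cost a little aperture and half the
  height; \<open>d\<close> depends on the apertures only, not on \<open>T\<close>.\<close>

lemma cone_nbhd:
  assumes "0 < l" "l < l'"
  shows "\<exists>d>0. d \<le> 1 \<and> (\<forall>T\<ge>0. \<forall>u\<in>cone l (2 * T). \<forall>w. cmod (w - u) \<le> d * cmod u \<longrightarrow> w \<in> cone l' T)"
proof -
  \<comment> \<open>\<open>k \<le> 1 / 2\<close> preserves half of \<open>Im u\<close>, and
    \<open>k * (1 + l') < l' - l\<close> keeps \<open>|Re w|\<close> below \<open>l' * Im w\<close>.
    Division by \<open>l + 1\<close> converts \<open>k * Im u\<close> into a multiple of
    \<open>|u|\<close>.\<close>
  define k where "k = min (1 / 2) ((l' - l) / (2 * (1 + l')))"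
  have k: "0 < k" "k \<le> 1 / 2" "k * (1 + l') \<le> (l' - l) / 2"
    using assms by (auto simp: k_def min_def field_simps)
  define d where "d = k / (l + 1)"
  have "w \<in> cone l' T" if T: "0 \<le> T" and u: "u \<in> cone l (2 * T)" and w: "cmod (w - u) \<le> d * cmod u" for T u w
  proof -
    have Im: "0 < Im u" "\<bar>Re u\<bar> < l * Im u" "2 * T < Im u" using u by (auto simp: cone_def)
    have "d * cmod u \<le> d * ((l + 1) * Im u)"
      using norm_cone_le[OF u] assms k by (intro mult_left_mono) (auto simp: d_def)
    also have "\<dots> = k * Im u" using assms by (simp add: d_def)
    finally have wu: "cmod (w - u) \<le> k * Im u" using w by linarith
    have 1: "\<bar>Re w - Re u\<bar> \<le> k * Im u" "\<bar>Im w - Im u\<bar> \<le> k * Im u"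
      using abs_Re_le_cmod[of "w - u"] abs_Im_le_cmod[of "w - u"] wu by auto
    have "k * Im u \<le> 1 / 2 * Im u" using k Im by (intro mult_right_mono) auto
    then have 2: "Im u / 2 \<le> Im w" using 1 by linarith
    have "k * (1 + l') * Im u \<le> (l' - l) / 2 * Im u" using k Im by (intro mult_right_mono) auto
    also have "\<dots> < (l' - l) * Im u" using Im assms by simp
    finally have "l * Im u + k * Im u < l' * (Im u - k * Im u)" by (simp add: algebra_simps)
    also have "\<dots> \<le> l' * Im w" using 1 assms by (intro mult_left_mono) auto
    finally show ?thesis using 1 2 Im T by (auto simp: cone_def)
  qed
  moreover have "0 < d" "d \<le> 1" using k assms by (auto simp: d_def field_simps)
  ultimately show ?thesis by blast
qed

lemma cone_mono: "l \<le> l' \<Longrightarrow> T' \<le> T \<Longrightarrow> cone l T \<subseteq> cone l' T'"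
  by (auto simp: cone_def) (smt (verit) mult_right_mono)

text \<open>Solving \<open>F w = u\<close> means finding a fixed point of
  \<open>w \<mapsto> u - (F w - w)\<close>. Brouwer applies on the disc of radius
  \<open>d |u|\<close> about \<open>u\<close>: there \<open>|w| \<le> 2 |u|\<close>, so the relative
  error \<open>d / 2\<close> of \<open>F\<close> keeps the image in the disc.\<close>

lemma (in real_distribution) cone_subset_cauchy_F_image:
  assumes l: "0 < l" "l < l'"
  shows "\<exists>T>0. cone l T \<subseteq> cauchy_F M ` cone l' T'"
proof -
  obtain d where d: "0 < d" "d \<le> 1"
    and nb: "\<And>T u w. 0 \<le> T \<Longrightarrow> u \<in> cone l (2 * T) \<Longrightarrow> cmod (w - u) \<le> d * cmod u \<Longrightarrow> w \<in> cone l' T"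
    using cone_nbhd[OF l] by blast
  obtain T1 where T1: "0 < T1" "\<And>z. z \<in> cone l' T1 \<Longrightarrow> cmod (cauchy_F M z - z) \<le> (d / 2) * cmod z"
    using cauchy_F_asymptotic[of l' "d / 2"] l d by auto
  define T where "T = max T1 T'"
  have "u \<in> cauchy_F M ` cone l' T'" if u: "u \<in> cone l (2 * T)" for u
  proof -
    define S where "S = cball u (d * cmod u)"
    have S: "S \<subseteq> cone l' T"
      using nb[OF _ u] T1 by (auto simp: S_def T_def dist_norm norm_minus_commute)
    have S0: "compact S" "convex S" "S \<noteq> {}" using d by (auto simp: S_def not_less)
    have S1: "cone l' T \<subseteq> cone l' T1" "cone l' T \<subseteq> cone l' T'" "cone l' T \<subseteq> uhp"
      by (auto simp: cone_def T_def)
    have "(\<lambda>w. u - (cauchy_F M w - w)) \<in> S \<rightarrow> S"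
    proof
      fix w assume w: "w \<in> S"
      have "cmod w \<le> cmod u + cmod (w - u)"
        by (metis add_diff_cancel_left' diff_add_cancel norm_triangle_sub)
      also have "\<dots> \<le> cmod u + 1 * cmod u"
        using w d mult_right_mono[OF d(2), of "cmod u"] by (simp add: S_def dist_norm norm_minus_commute)
      finally have "(d / 2) * cmod w \<le> (d / 2) * (2 * cmod u)" using d by (intro mult_left_mono) auto
      then have "cmod (cauchy_F M w - w) \<le> d * cmod u"
        using T1(2)[of w] w S S1 by force
      then show "u - (cauchy_F M w - w) \<in> S" by (simp add: S_def dist_norm)
    qed
    moreover have "continuous_on S (\<lambda>w. u - (cauchy_F M w - w))"
      using S S1 by (intro continuous_intros continuous_on_subset[OF holomorphic_on_imp_continuous_on[OF holomorphic_cauchy_F]]) auto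
    ultimately obtain w where "w \<in> S" "u - (cauchy_F M w - w) = w"
      using brouwer[of S "\<lambda>w. u - (cauchy_F M w - w)"] S0 by blast
    then have "cauchy_F M w = u" "w \<in> cone l' T'" using S S1 by (auto simp: algebra_simps)
    then show ?thesis by blast
  qed
  moreover have "0 < 2 * T" using T1 by (simp add: T_def)
  ultimately show ?thesis by blast
qed

section \<open>Representation and uniqueness of Cauchy transforms\<close>

lemma nn_integral_restrict_has_integral:
  fixes f :: "real \<Rightarrow> real"
  assumes [measurable]: "f \<in> borel_measurable borel" and f: "\<And>x. 0 \<le> f x" and I: "(f has_integral I) {a..b}"
  shows "(\<integral>\<^sup>+x. ennreal (f x * indicator {a..b} x) \<partial>lborel) = ennreal I"
proof (rule nn_integral_has_integral_lborel)
  have "(\<lambda>x. f x * indicator {a..b} x) = (\<lambda>x. if x \<in> {a..b} then f x else 0)"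
    by (auto simp: fun_eq_iff)
  then show "((\<lambda>x. f x * indicator {a..b} x) has_integral I) UNIV"
    using I by (simp only: has_integral_restrict_UNIV)
qed (use f in \<open>auto simp: indicator_def\<close>)

text \<open>The factor \<open>(z - cnj z) / (\<zeta> - cnj z)\<close> equals 1 at \<open>z\<close>,
  so Cauchy's formula over a rectangle above \<open>[-R, R]\<close> still returns
  \<open>g z\<close>. On the real line it turns the Cauchy kernel into the Poisson kernel, and at
  infinity it adds one order of decay, which makes the other three sides negligible.\<close>

lemma poisson_uhp_truncated:
  assumes hol: "g holomorphic_on {\<zeta>. - e < Im \<zeta>}" and e: "0 < e"
    and bd: "\<And>\<zeta>. 0 \<le> Im \<zeta> \<Longrightarrow> cmod (g \<zeta>) \<le> B"
    and z: "0 < Im z" and R: "2 * cmod z < R"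
  shows "\<exists>I. ((\<lambda>x. - Im (g (of_real x)) * (Im z / ((x - Re z)\<^sup>2 + (Im z)\<^sup>2))) has_integral I) {-R..R} \<and>
    \<bar>I - pi * (- Im (g z))\<bar> \<le> 16 * B * Im z / R"
proof -
  \<comment> \<open>The minimum keeps \<open>S\<close> inside the domain of \<open>g\<close> and
    above the extra pole \<open>cnj z\<close>.\<close>
  define S where "S = {\<zeta>. - min e (Im z) < Im \<zeta>}"
  define f where "f \<zeta> = g \<zeta> * (z - cnj z) / (\<zeta> - cnj z)" for \<zeta>
  define F where "F \<zeta> = f \<zeta> / (\<zeta> - z)" for \<zeta>
  have B: "0 \<le> B" using order_trans[OF norm_ge_zero bd[of 0]] by simp
  have Rz: "\<bar>Re z\<bar> < R" "Im z < R" "0 < R"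
    using R z abs_Re_le_cmod[of z] abs_Im_le_cmod[of z] by auto
  have S: "open S" "convex S"
    unfolding S_def by (rule open_halfspace_Im_gt convex_halfspace_Im_gt)+
  have cn: "\<zeta> - cnj z \<noteq> 0" if "\<zeta> \<in> S" for \<zeta>
    using that by (auto simp: S_def complex_eq_iff)
  have holf: "f holomorphic_on S"
    unfolding f_def by (intro holomorphic_intros holomorphic_on_subset[OF hol]) (use cn in \<open>auto simp: S_def\<close>)
  define a1 a2 a3 a4 where a: "a1 = complex_of_real (- R)" "a2 = complex_of_real R" "a3 = Complex R R" "a4 = Complex (- R) R"
  have rp: "rectpath a1 a3 = linepath a1 a2 +++ linepath a2 a3 +++ linepath a3 a4 +++ linepath a4 a1"
    by (simp add: rectpath_def Let_def a complex_of_real_def)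
  have zb: "z \<in> box a1 a3" using Rz z by (auto simp: in_box_complex_iff a)
  have sub: "path_image (rectpath a1 a3) \<subseteq> cbox a1 a3"
    by (rule path_image_rectpath_subset_cbox) (use Rz in \<open>auto simp: a\<close>)
  have cS: "cbox a1 a3 \<subseteq> S" using e z by (auto simp: S_def in_cbox_complex_iff a)
  have pz: "z \<notin> path_image (rectpath a1 a3)"
    using path_image_rectpath_cbox_minus_box[of a1 a3] zb Rz by (auto simp: a)
  have wn: "winding_number (rectpath a1 a3) z = 1"
    by (rule winding_number_rectpath[OF zb])
  have "((\<lambda>w. f w / (w - z)) has_contour_integral (2 * pi * \<i> * winding_number (rectpath a1 a3) z * f z)) (rectpath a1 a3)"
    by (rule Cauchy_integral_formula_convex_simple[OF S(2) holf])
      (use sub cS pz zb box_subset_cbox[of a1 a3] interior_open[OF S(1)] in auto)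
  then have hci: "(F has_contour_integral (2 * pi * \<i> * g z)) (rectpath a1 a3)"
    using cn[of z] z e by (simp add: F_def[abs_def] wn f_def S_def)
  have contF: "continuous_on (S - {z}) F"
    unfolding F_def by (intro continuous_intros continuous_on_subset[OF holomorphic_on_imp_continuous_on[OF holf]]) auto
  have seg: "closed_segment a1 a2 \<subseteq> path_image (rectpath a1 a3)" "closed_segment a2 a3 \<subseteq> path_image (rectpath a1 a3)"
    "closed_segment a3 a4 \<subseteq> path_image (rectpath a1 a3)" "closed_segment a4 a1 \<subseteq> path_image (rectpath a1 a3)"
    unfolding rp by (auto simp: path_image_join)
  have segS: "path_image (rectpath a1 a3) \<subseteq> S - {z}" using sub cS pz by auto
  have int: "F contour_integrable_on linepath a1 a2" "F contour_integrable_on linepath a2 a3"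
    "F contour_integrable_on linepath a3 a4" "F contour_integrable_on linepath a4 a1"
    by (rule contour_integrable_continuous_linepath, rule continuous_on_subset[OF contF], use seg segS in blast)+
  define I1 where "I1 = contour_integral (linepath a1 a2) F"
  have tot: "I1 + (contour_integral (linepath a2 a3) F +
      (contour_integral (linepath a3 a4) F + contour_integral (linepath a4 a1) F)) = 2 * pi * \<i> * g z"
    using contour_integral_unique[OF hci] int unfolding rp I1_def by (simp add: contour_integrable_join)
  \<comment> \<open>On the three far sides both distances are at least \<open>R / 2\<close>; their
    total length is \<open>4 R\<close>, so their contribution is of order
    \<open>1 / R\<close>.\<close>
  have Fbd: "cmod (F \<zeta>) \<le> 8 * B * Im z / R\<^sup>2" if \<zeta>: "R \<le> cmod \<zeta>" "0 \<le> Im \<zeta>" for \<zeta>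
  proof -
    have 1: "R / 2 \<le> cmod (\<zeta> - z)" "R / 2 \<le> cmod (\<zeta> - cnj z)"
      using norm_triangle_ineq2[of \<zeta> z] norm_triangle_ineq2[of \<zeta> "cnj z"] \<zeta> R by auto
    have "cmod (z - cnj z) = 2 * Im z" using z by (simp add: cmod_def real_sqrt_mult)
    then have "cmod (F \<zeta>) = cmod (g \<zeta>) * (2 * Im z) / (cmod (\<zeta> - cnj z) * cmod (\<zeta> - z))"
      by (simp add: F_def f_def norm_mult norm_divide)
    also have "\<dots> \<le> B * (2 * Im z) / (R / 2 * (R / 2))"
      using 1 Rz z B bd[OF \<zeta>(2)] by (intro frac_le mult_mono mult_right_mono) auto
    finally show ?thesis using Rz by (simp add: power2_eq_square field_simps)
  qed
  have bd0: "0 \<le> 8 * B * Im z / R\<^sup>2" using B z by simp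
  have J2: "cmod (contour_integral (linepath a2 a3) F) \<le> 8 * B * Im z / R\<^sup>2 * cmod (a3 - a2)"
  proof (rule contour_integral_bound_linepath[OF int(2) bd0 Fbd])
    fix \<zeta> assume "\<zeta> \<in> closed_segment a2 a3"
    then have "Re \<zeta> = R" "0 \<le> Im \<zeta>" using Rz by (auto simp: closed_segment_same_Re a closed_segment_eq_real_ivl)
    then show "R \<le> cmod \<zeta>" "0 \<le> Im \<zeta>" using complex_Re_le_cmod[of \<zeta>] by auto
  qed
  have J3: "cmod (contour_integral (linepath a3 a4) F) \<le> 8 * B * Im z / R\<^sup>2 * cmod (a4 - a3)"
  proof (rule contour_integral_bound_linepath[OF int(3) bd0 Fbd])
    fix \<zeta> assume "\<zeta> \<in> closed_segment a3 a4"
    then have "Im \<zeta> = R" using Rz by (auto simp: closed_segment_same_Im a closed_segment_eq_real_ivl)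
    then show "R \<le> cmod \<zeta>" "0 \<le> Im \<zeta>" using abs_Im_le_cmod[of \<zeta>] Rz by auto
  qed
  have J4: "cmod (contour_integral (linepath a4 a1) F) \<le> 8 * B * Im z / R\<^sup>2 * cmod (a1 - a4)"
  proof (rule contour_integral_bound_linepath[OF int(4) bd0 Fbd])
    fix \<zeta> assume "\<zeta> \<in> closed_segment a4 a1"
    then have "Re \<zeta> = - R" "0 \<le> Im \<zeta>" using Rz by (auto simp: closed_segment_same_Re a closed_segment_eq_real_ivl)
    then show "R \<le> cmod \<zeta>" "0 \<le> Im \<zeta>" using abs_Re_le_cmod[of \<zeta>] Rz by auto
  qed
  have len: "cmod (a3 - a2) = R" "cmod (a4 - a3) = 2 * R" "cmod (a1 - a4) = R"
    using Rz by (auto simp: a cmod_def real_sqrt_mult)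
  have "I1 - 2 * pi * \<i> * g z = - (contour_integral (linepath a2 a3) F +
      (contour_integral (linepath a3 a4) F + contour_integral (linepath a4 a1) F))"
    using tot by (simp add: algebra_simps)
  then have "cmod (I1 - 2 * pi * \<i> * g z) \<le> cmod (contour_integral (linepath a2 a3) F) +
      (cmod (contour_integral (linepath a3 a4) F) + cmod (contour_integral (linepath a4 a1) F))"
    by (simp only: norm_minus_cancel) (intro order_trans[OF norm_triangle_ineq] add_left_mono norm_triangle_ineq)
  also have "\<dots> \<le> 8 * B * Im z / R\<^sup>2 * (4 * R)"
  proof -
    have "q * R + (q * (2 * R) + q * R) = q * (4 * R)" for q :: real by simp
    then show ?thesis using add_mono[OF J2 add_mono[OF J3 J4]] unfolding len by metis
  qed
  also have "\<dots> = 32 * B * Im z / R" using Rz by (simp add: power2_eq_square field_simps)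
  finally have err: "cmod (I1 - 2 * pi * \<i> * g z) \<le> 32 * B * Im z / R" .
  have "(F has_contour_integral I1) (linepath a1 a2)"
    unfolding I1_def using int(1) by (rule has_contour_integral_integral)
  then have "((\<lambda>x. F (of_real x)) has_integral I1) {-R..R}"
    using Rz by (subst (asm) has_contour_integral_linepath_Reals_iff) (auto simp: a)
  then have "((\<lambda>x. Re (F (of_real x)) / 2) has_integral (Re I1 / 2)) {-R..R}"
    by (intro has_integral_divide has_integral_Re)
  \<comment> \<open>For real \<open>x\<close> the denominators are conjugate and multiply to
    \<open>|x - z|^2\<close>, while \<open>z - cnj z\<close> is \<open>2 \<i> Im z\<close>. The real
    part therefore selects \<open>- Im g\<close>.\<close>
  moreover have "Re (F (of_real x)) / 2 = - Im (g (of_real x)) * (Im z / ((x - Re z)\<^sup>2 + (Im z)\<^sup>2))" for x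
  proof -
    have "(of_real x - cnj z) * (of_real x - z) = complex_of_real ((x - Re z)\<^sup>2 + (Im z)\<^sup>2)"
      by (simp add: complex_eq_iff power2_eq_square algebra_simps)
    moreover have "z - cnj z = \<i> * of_real (2 * Im z)" by (simp add: complex_eq_iff)
    moreover define q where "q = Im z / ((x - Re z)\<^sup>2 + (Im z)\<^sup>2)"
    ultimately have "F (of_real x) = \<i> * g (of_real x) * of_real (2 * q)"
      by (simp add: F_def f_def)
    then show ?thesis unfolding q_def[symmetric] by simp
  qed
  ultimately have 1: "((\<lambda>x. - Im (g (of_real x)) * (Im z / ((x - Re z)\<^sup>2 + (Im z)\<^sup>2))) has_integral (Re I1 / 2)) {-R..R}"
    by simp
  have "\<bar>Re I1 - 2 * (pi * (- Im (g z)))\<bar> = \<bar>Re (I1 - 2 * pi * \<i> * g z)\<bar>"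
    by (simp add: algebra_simps)
  also have "\<dots> \<le> 32 * B * Im z / R" using err abs_Re_le_cmod order_trans by blast
  finally have "\<bar>Re I1 / 2 - pi * (- Im (g z))\<bar> \<le> 16 * B * Im z / R" by (simp add: field_simps abs_if split: if_splits)
  with 1 show ?thesis by blast
qed

text \<open>The sign of \<open>Im g\<close> on the line makes the integrand nonnegative, so monotone
  convergence over growing intervals passes to the whole line; integrability is a consequence of the
  value being finite.\<close>

lemma poisson_uhp:
  assumes hol: "g holomorphic_on {\<zeta>. - e < Im \<zeta>}" and e: "0 < e"
    and bd: "\<And>\<zeta>. 0 \<le> Im \<zeta> \<Longrightarrow> cmod (g \<zeta>) \<le> B"
    and neg: "\<And>x. Im (g (of_real x)) \<le> 0"
    and z: "0 < Im z"
  shows "(\<integral>\<^sup>+x. ennreal (- Im (g (of_real x)) * (Im z / ((x - Re z)\<^sup>2 + (Im z)\<^sup>2))) \<partial>lborel) = ennreal (pi * (- Im (g z)))"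
proof -
  define f where "f x = - Im (g (of_real x)) * (Im z / ((x - Re z)\<^sup>2 + (Im z)\<^sup>2))" for x
  have f_nonneg: "0 \<le> f x" for x
    unfolding f_def using neg[of x] z by (intro mult_nonneg_nonneg divide_nonneg_nonneg) auto
  have "continuous_on UNIV (\<lambda>x. g (complex_of_real x))"
    using e by (intro continuous_on_compose2[OF holomorphic_on_imp_continuous_on[OF hol]] continuous_intros) auto
  then have "continuous_on UNIV f"
    unfolding f_def using z by (intro continuous_intros) (auto simp: sum_power2_eq_zero_iff)
  then have f_meas [measurable]: "f \<in> borel_measurable borel" by (rule borel_measurable_continuous_onI)
  define r where "r n = real n + (2 * cmod z + 1)" for n
  have r: "2 * cmod z < r n" "0 < r n" for n
    using norm_ge_zero[of z] unfolding r_def by linarith+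
  obtain I where I: "\<And>n. (f has_integral I n) {- r n..r n}"
    and I_err: "\<And>n. \<bar>I n - pi * (- Im (g z))\<bar> \<le> 16 * B * Im z / r n"
    using poisson_uhp_truncated[OF hol e bd z r(1)] unfolding f_def[symmetric] by metis
  have r_lim: "filterlim r at_top sequentially"
    by (rule filterlim_at_top_mono[OF filterlim_real_sequentially]) (simp add: r_def)
  have "(\<lambda>n. I n - pi * (- Im (g z))) \<longlonglongrightarrow> 0"
  proof (rule Lim_null_comparison[OF always_eventually])
    show "(\<lambda>n. 16 * B * Im z / r n) \<longlonglongrightarrow> 0"
      by (rule tendsto_divide_0[OF tendsto_const filterlim_at_top_imp_at_infinity[OF r_lim]])
  qed (use I_err in simp)
  then have I_lim: "I \<longlonglongrightarrow> pi * (- Im (g z))" by (rule LIM_zero_cancel)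
  have "(\<lambda>n. \<integral>\<^sup>+x. ennreal (f x * indicator {- r n..r n} x) \<partial>lborel) \<longlonglongrightarrow> (\<integral>\<^sup>+x. ennreal (f x) \<partial>lborel)"
  proof (rule nn_integral_LIMSEQ)
    show "incseq (\<lambda>n x. ennreal (f x * indicator {- r n..r n} x))"
      using f_nonneg by (auto simp: incseq_def le_fun_def r_def indicator_def intro!: ennreal_leI)
    show "(\<lambda>n. ennreal (f x * indicator {- r n..r n} x)) \<longlonglongrightarrow> ennreal (f x)" for x
    proof (rule tendsto_eventually)
      have "eventually (\<lambda>n. \<bar>x\<bar> \<le> r n) sequentially"
        using r_lim by (simp add: filterlim_at_top)
      then show "eventually (\<lambda>n. ennreal (f x * indicator {- r n..r n} x) = ennreal (f x)) sequentially"
        by eventually_elim (auto simp: indicator_def)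
    qed
  qed auto
  moreover have "(\<integral>\<^sup>+x. ennreal (f x * indicator {- r n..r n} x) \<partial>lborel) = ennreal (I n)" for n
    by (rule nn_integral_restrict_has_integral[OF f_meas f_nonneg I])
  ultimately have "(\<lambda>n. ennreal (I n)) \<longlonglongrightarrow> (\<integral>\<^sup>+x. ennreal (f x) \<partial>lborel)" by simp
  moreover have "(\<lambda>n. ennreal (I n)) \<longlonglongrightarrow> ennreal (pi * (- Im (g z)))"
    using I_lim by (rule tendsto_ennrealI)
  ultimately show ?thesis unfolding f_def by (rule LIMSEQ_unique)
qed


section \<open>Stieltjes inversion and uniqueness\<close>

context real_distribution
begin

lemma nn_integral_poisson_kernel:
  assumes z: "0 < Im z"
  shows "(\<integral>\<^sup>+u. ennreal (Im z / ((u - Re z)\<^sup>2 + (Im z)\<^sup>2)) \<partial>M) = ennreal (- Im (cauchy_G M z))"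
proof -
  have eq: "Im z / ((u - Re z)\<^sup>2 + (Im z)\<^sup>2) = - Im (1 / (z - complex_of_real u))" for u
    by (simp add: Im_divide power2_commute)
  have int: "integrable M (\<lambda>u. - Im (1 / (z - complex_of_real u)))"
    using integrable_resolvent[OF z] by (intro Bochner_Integration.integrable_minus integrable_Im)
  have "(\<integral>\<^sup>+u. ennreal (- Im (1 / (z - complex_of_real u))) \<partial>M) = ennreal (\<integral>u. - Im (1 / (z - complex_of_real u)) \<partial>M)"
  proof (rule nn_integral_eq_integral[OF int])
    show "AE u in M. 0 \<le> - Im (1 / (z - complex_of_real u))"
      unfolding eq[symmetric] using z by auto
  qed
  also have "(\<integral>u. - Im (1 / (z - complex_of_real u)) \<partial>M) = - Im (cauchy_G M z)"
    unfolding cauchy_G_def using integral_Im[OF integrable_resolvent[OF z]] by simp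
  finally show ?thesis unfolding eq .
qed

text \<open>Tonelli: integrating the Poisson kernel in \<open>x\<close> over
  \<open>[b, \<infinity>)\<close> first gives an arctangent, a smoothed indicator of
  \<open>u > b\<close> at scale \<open>e\<close>.\<close>

lemma stieltjes_inversion:
  assumes e: "0 < e"
  shows "(\<integral>\<^sup>+x. ennreal (- Im (cauchy_G M (Complex x e))) * indicator {b..} x \<partial>lborel) =
    ennreal (\<integral>u. pi / 2 - arctan ((b - u) / e) \<partial>M)"
proof -
  interpret pair_sigma_finite M lborel ..
  let ?k = "\<lambda>u x. ennreal (e / ((u - x)\<^sup>2 + e\<^sup>2)) * indicator {b..} x"
  have "(\<integral>\<^sup>+x. ennreal (- Im (cauchy_G M (Complex x e))) * indicator {b..} x \<partial>lborel) =
      (\<integral>\<^sup>+x. (\<integral>\<^sup>+u. ?k u x \<partial>M) \<partial>lborel)"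
    using nn_integral_poisson_kernel[of "Complex _ e"] e
    by (intro nn_integral_cong) (simp add: nn_integral_multc)
  also have "\<dots> = (\<integral>\<^sup>+u. (\<integral>\<^sup>+x. ?k u x \<partial>lborel) \<partial>M)"
    by (rule Fubini') measurable
  also have "\<dots> = (\<integral>\<^sup>+u. ennreal (pi / 2 - arctan ((b - u) / e)) \<partial>M)"
  proof (rule nn_integral_cong)
    fix u :: real
    show "(\<integral>\<^sup>+x. ?k u x \<partial>lborel) = ennreal (pi / 2 - arctan ((b - u) / e))"
    proof (rule nn_integral_FTC_atLeast)
      fix x :: real
      have "1 + ((x - u) / e)\<^sup>2 = ((u - x)\<^sup>2 + e\<^sup>2) / e\<^sup>2"
        using e by (simp add: power_divide power2_commute field_simps)
      then show "((\<lambda>x. arctan ((x - u) / e)) has_real_derivative e / ((u - x)\<^sup>2 + e\<^sup>2)) (at x)"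
        using e by (auto intro!: derivative_eq_intros simp: power2_eq_square divide_simps)
      have "filterlim (\<lambda>x. (x - u) / e) at_top at_top"
        using e by real_asymp
      then show "((\<lambda>x. arctan ((x - u) / e)) \<longlongrightarrow> pi / 2) at_top"
        by (rule filterlim_compose[OF tendsto_arctan_at_top])
    qed (use e in auto)
  qed
  also have "\<dots> = ennreal (\<integral>u. pi / 2 - arctan ((b - u) / e) \<partial>M)"
  proof (rule nn_integral_eq_integral)
    have *: "\<bar>arctan x\<bar> \<le> pi / 2" for x
      using arctan_ubound[of x] arctan_lbound[of x] by auto
    show "integrable M (\<lambda>u. pi / 2 - arctan ((b - u) / e))"
    proof (rule integrable_const_bound[where B = pi])
      show "AE u in M. norm (pi / 2 - arctan ((b - u) / e)) \<le> pi"
        using * by (intro AE_I2) (smt (verit, best) field_sum_of_halves real_norm_def)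
    qed measurable
    show "AE u in M. 0 \<le> pi / 2 - arctan ((b - u) / e)"
      using arctan_ubound by (intro AE_I2) (simp add: less_imp_le)
  qed
  finally show ?thesis .
qed

text \<open>
  The point \<open>b\<close> is approached from the right at distance \<open>1/n\<close>, which is much larger than the height \<open>1/n\<^sup>2\<close>; so
  the limit is the indicator of \<open>{b<..}\<close>, without the usual half weight of an atom at \<open>b\<close>.
\<close>

lemma arctan_integral_tendsto:
  "(\<lambda>n. \<integral>u. pi / 2 - arctan ((b + 1 / real (Suc n) - u) / (1 / (real (Suc n))\<^sup>2)) \<partial>M) \<longlonglongrightarrow> pi * (1 - cdf M b)"
proof -
  have "(\<lambda>n. \<integral>u. pi / 2 - arctan ((b + 1 / real (Suc n) - u) / (1 / (real (Suc n))\<^sup>2)) \<partial>M) \<longlonglongrightarrow>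
      (\<integral>u. pi * indicator {b<..} u \<partial>M)"
  proof (rule integral_dominated_convergence[where w = "\<lambda>_. pi"])
    have *: "\<bar>arctan x\<bar> \<le> pi / 2" for x
      using arctan_ubound[of x] arctan_lbound[of x] by auto
    show "AE u in M. norm (pi / 2 - arctan ((b + 1 / real (Suc n) - u) / (1 / (real (Suc n))\<^sup>2))) \<le> pi" for n
      using * by (intro AE_I2) (smt (verit, best) field_sum_of_halves real_norm_def)
    show "AE u in M. (\<lambda>n. pi / 2 - arctan ((b + 1 / real (Suc n) - u) / (1 / (real (Suc n))\<^sup>2))) \<longlonglongrightarrow> pi * indicator {b<..} u"
    proof (rule AE_I2)
      fix u :: real
      show "(\<lambda>n. pi / 2 - arctan ((b + 1 / real (Suc n) - u) / (1 / (real (Suc n))\<^sup>2))) \<longlonglongrightarrow> pi * indicator {b<..} u"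
      proof (cases "b < u")
        case True
        then have "filterlim (\<lambda>n. (b + 1 / real (Suc n) - u) / (1 / (real (Suc n))\<^sup>2)) at_bot sequentially"
          by real_asymp
        then have "(\<lambda>n. arctan ((b + 1 / real (Suc n) - u) / (1 / (real (Suc n))\<^sup>2))) \<longlonglongrightarrow> - (pi / 2)"
          by (rule filterlim_compose[OF tendsto_arctan_at_bot])
        from tendsto_diff[OF tendsto_const this, of "pi / 2"] True show ?thesis by simp
      next
        case False
        have "filterlim (\<lambda>n. (b + 1 / real (Suc n) - u) / (1 / (real (Suc n))\<^sup>2)) at_top sequentially"
        proof (cases "b = u")
          case True
          then show ?thesis by simp real_asymp
        next
          case False
          with \<open>\<not> b < u\<close> have "u < b" by simp
          then show ?thesis by real_asymp
        qed
        then have "(\<lambda>n. arctan ((b + 1 / real (Suc n) - u) / (1 / (real (Suc n))\<^sup>2))) \<longlonglongrightarrow> pi / 2"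
          by (rule filterlim_compose[OF tendsto_arctan_at_top])
        from tendsto_diff[OF tendsto_const this, of "pi / 2"] False show ?thesis by simp
      qed
    qed
  qed auto
  also have "(\<integral>u. pi * indicator {b<..} u \<partial>M) = pi * prob {b<..}"
    by simp
  also have "prob {b<..} = 1 - cdf M b"
    using prob_compl[of "{..b}"] by (simp add: cdf_def Compl_atMost[symmetric] Compl_eq_Diff_UNIV)
  finally show ?thesis .
qed

end

text \<open>Inversion at height \<open>1 / (n + 1)^2\<close> from the starting point
  \<open>b + 1 / (n + 1)\<close> recovers the distribution function at every \<open>b\<close>, atoms
  included.\<close>

lemma cauchy_G_unique:
  assumes M: "real_distribution M" and N: "real_distribution N"
    and eq: "\<And>z. 0 < Im z \<Longrightarrow> cauchy_G M z = cauchy_G N z"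
  shows "M = N"
proof (rule cdf_unique[OF M N], rule ext)
  fix b
  let ?f = "\<lambda>n u. pi / 2 - arctan ((b + 1 / real (Suc n) - u) / (1 / (real (Suc n))\<^sup>2))"
  have nonneg: "0 \<le> (\<integral>u. ?f n u \<partial>L)" for n and L :: "real measure"
    by (intro integral_nonneg_AE AE_I2) (use arctan_ubound in \<open>simp add: less_imp_le\<close>)
  have "ennreal (\<integral>u. ?f n u \<partial>M) = ennreal (\<integral>u. ?f n u \<partial>N)" for n
    using real_distribution.stieltjes_inversion[OF M, of "1 / (real (Suc n))\<^sup>2" "b + 1 / real (Suc n)"]
      real_distribution.stieltjes_inversion[OF N, of "1 / (real (Suc n))\<^sup>2" "b + 1 / real (Suc n)"]
    by (simp add: eq del: of_nat_Suc)
  then have "(\<integral>u. ?f n u \<partial>M) = (\<integral>u. ?f n u \<partial>N)" for n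
    using nonneg by (simp only: ennreal_inj)
  then have "pi * (1 - cdf M b) = pi * (1 - cdf N b)"
    using real_distribution.arctan_integral_tendsto[OF M, of b]
      real_distribution.arctan_integral_tendsto[OF N, of b] by (simp only: LIMSEQ_unique)
  then show "cdf M b = cdf N b" by simp
qed

section \<open>Reconstruction of a measure from its reciprocal Cauchy transform\<close>

lemma (in real_distribution) prob_interval_ge:
  assumes T: "0 < T"
  shows "- 2 * T * Im (cauchy_G M (\<i> * of_real T)) - 1 \<le> prob {-T<..T}"
proof -
  let ?g = "\<lambda>x. (cmod (1 / (\<i> * of_real T - complex_of_real x)))\<^sup>2"
  have g: "?g x = 1 / (x\<^sup>2 + T\<^sup>2)" for x
    by (simp add: norm_divide power_divide cmod_power2)
  have int: "integrable M ?g"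
    by (rule integrable_const_bound[where B = "1 / T\<^sup>2"]) (use T in \<open>auto simp: g intro!: frac_le\<close>)
  have "- 2 * T * Im (cauchy_G M (\<i> * of_real T)) - 1 = (\<integral>x. 2 * T\<^sup>2 * ?g x - 1 \<partial>M)"
    using Im_cauchy_G[of "\<i> * of_real T"] T int by (simp add: power2_eq_square)
  also have "\<dots> \<le> (\<integral>x. indicator {-T<..T} x \<partial>M)"
  proof (rule integral_mono)
    fix x :: real
    \<comment> \<open>\<open>T^2 / (x^2 + T^2)\<close> is at most 1 everywhere and at most
      \<open>1 / 2\<close> for \<open>|x| \<ge> T\<close>; the factor 2 makes the left side
      nonpositive off the interval.\<close>
    show "2 * T\<^sup>2 * ?g x - 1 \<le> indicator {-T<..T} x"
    proof (cases "x \<in> {-T<..T}")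
      case True
      have "T\<^sup>2 / (x\<^sup>2 + T\<^sup>2) \<le> 1" using T by (simp add: divide_simps add_nonneg_pos)
      then show ?thesis using True by (simp add: g)
    next
      case False
      then have "T\<^sup>2 \<le> x\<^sup>2" using T by (intro abs_le_square_iff[THEN iffD1]) auto
      then have "2 * T\<^sup>2 / (x\<^sup>2 + T\<^sup>2) \<le> 1" using T by (simp add: divide_simps add_nonneg_pos)
      then show ?thesis using False by (simp add: g)
    qed
  qed (use int in \<open>auto intro: integrable_const_bound[where B = 1]\<close>)
  finally show ?thesis by simp
qed


lemma (in real_distribution) norm_cauchy_G_le: "0 < Im z \<Longrightarrow> cmod (cauchy_G M z) \<le> 1 / Im z"
  unfolding cauchy_G_eq norm_divide using Im_cauchy_F_ge[of z] abs_Im_le_cmod[of "cauchy_F M z"]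
  by (auto intro!: frac_le)

text \<open>For \<open>c = 0\<close> the right-hand side of the shifted Schwarz--Pick bound is
  0.\<close>

lemma Im_eq_0_imp_const:
  assumes "d holomorphic_on uhp" "\<And>w. 0 < Im w \<Longrightarrow> Im (d w) = 0" "0 < Im a" "0 < Im b"
  shows "d a = d b"
  using schwarz_pick_uhp_shift[OF assms(1), of 0 a b] assms(2-4)
  by (simp add: mult_le_0_iff zero_less_mult_iff)

text \<open>
  The measures \<open>D n\<close> have density \<open>- Im \<Gamma> (x + \<i> / (n + 1)) / pi\<close>, and \<open>\<rho>\<close> is a weak limit point of them.
\<close>

theorem exists_cauchy_F:
  assumes hol: "\<Phi> holomorphic_on uhp" and ge: "\<And>z. 0 < Im z \<Longrightarrow> Im z \<le> Im (\<Phi> z)"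
    and lim: "((\<lambda>y. \<Phi> (\<i> * of_real y) / (\<i> * of_real y)) \<longlongrightarrow> 1) at_top"
  shows "\<exists>\<rho>. real_distribution \<rho> \<and> (\<forall>z. 0 < Im z \<longrightarrow> cauchy_F \<rho> z = \<Phi> z)"
proof -
  define \<Gamma> where "\<Gamma> z = 1 / \<Phi> z" for z
  have pos: "0 < Im (\<Phi> z)" if "0 < Im z" for z using ge[OF that] that by linarith
  have nz: "\<Phi> z \<noteq> 0" if "0 < Im z" for z using pos[OF that] by auto
  have hol\<Gamma>: "\<Gamma> holomorphic_on uhp"
    unfolding \<Gamma>_def by (intro holomorphic_intros hol) (use nz in auto)
  have neg: "Im (\<Gamma> z) < 0" if "0 < Im z" for z
    unfolding \<Gamma>_def Im_divide cmod_power2[symmetric] using pos[OF that] nz[OF that] by (simp add: divide_simps)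
  have bd: "cmod (\<Gamma> z) \<le> 1 / Im z" if "0 < Im z" for z
    unfolding \<Gamma>_def norm_divide using ge[OF that] abs_Im_le_cmod[of "\<Phi> z"] that by (auto intro!: frac_le)
  \<comment> \<open>For a measure this would be the mean of \<open>y^2 / (x^2 + y^2)\<close>. Its
    limit 1 carries the normalisation: it yields both total mass 1 and tightness.\<close>
  define \<alpha> where "\<alpha> y = y * (- Im (\<Gamma> (\<i> * of_real y)))" for y :: real
  have \<alpha>_lim: "(\<alpha> \<longlongrightarrow> 1) at_top"
  proof (rule Lim_transform_eventually)
    have "((\<lambda>y. Im (\<i> / (\<Phi> (\<i> * of_real y) / (\<i> * of_real y)))) \<longlongrightarrow> Im (\<i> / 1)) at_top"
      by (intro tendsto_intros lim) simp
    then show "((\<lambda>y. Im (\<i> / (\<Phi> (\<i> * of_real y) / (\<i> * of_real y)))) \<longlongrightarrow> 1) at_top" by simp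
    show "\<forall>\<^sub>F y in at_top. Im (\<i> / (\<Phi> (\<i> * of_real y) / (\<i> * of_real y))) = \<alpha> y"
      using eventually_gt_at_top[of 0]
    proof eventually_elim
      case (elim y)
      have "\<i> / (\<Phi> (\<i> * of_real y) / (\<i> * of_real y)) = of_real (- y) * \<Gamma> (\<i> * of_real y)"
        using nz[of "\<i> * of_real y"] elim by (simp add: \<Gamma>_def)
      then show ?case by (simp add: \<alpha>_def)
    qed
  qed
  define e where "e n = 1 / real (Suc n)" for n
  have e: "0 < e n" "e n \<le> 1" for n by (auto simp: e_def)
  have e_lim: "e \<longlonglongrightarrow> 0" unfolding e_def by real_asymp
  define g where "g n \<zeta> = \<Gamma> (\<zeta> + \<i> * of_real (e n))" for n \<zeta>
  have Im_g: "Im (\<zeta> + \<i> * of_real (e n)) = Im \<zeta> + e n" for n \<zeta> by simp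
  have holg: "g n holomorphic_on {\<zeta>. - e n < Im \<zeta>}" for n
    unfolding g_def by (rule holomorphic_on_compose_gen[OF _ hol\<Gamma>, unfolded comp_def])
      (auto intro!: holomorphic_intros)
  have g_neg: "Im (g n \<zeta>) < 0" if "0 \<le> Im \<zeta>" for n \<zeta>
    unfolding g_def using that e(1)[of n] by (intro neg) simp
  have g_bd: "cmod (g n \<zeta>) \<le> 1 / e n" if "0 \<le> Im \<zeta>" for n \<zeta>
  proof -
    have "cmod (g n \<zeta>) \<le> 1 / Im (\<zeta> + \<i> * of_real (e n))"
      unfolding g_def using that e(1)[of n] by (intro bd) simp
    also have "\<dots> \<le> 1 / e n" using that e(1)[of n] by (intro divide_left_mono) auto
    finally show ?thesis .
  qed
  define p where "p n x = - Im (g n (complex_of_real x))" for n x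
  have p: "0 \<le> p n x" for n x using g_neg[of "of_real x" n] by (simp add: p_def)
  have "continuous_on UNIV (p n)" for n
    unfolding p_def using e(1)[of n]
    by (intro continuous_intros continuous_on_compose2[OF holomorphic_on_imp_continuous_on[OF holg]]) auto
  then have p_meas [measurable]: "p n \<in> borel_measurable borel" for n
    by (rule borel_measurable_continuous_onI)
  have poisson: "(\<integral>\<^sup>+x. ennreal (p n x * (Im z / ((x - Re z)\<^sup>2 + (Im z)\<^sup>2))) \<partial>lborel) = ennreal (pi * (- Im (g n z)))"
    if "0 < Im z" for n z
    unfolding p_def using poisson_uhp[OF holg e(1) g_bd less_imp_le[OF g_neg] that] by simp
  define D where "D n = density lborel (\<lambda>x. ennreal (p n x / pi))" for n
  \<comment> \<open>The kernels \<open>k^2 / (x^2 + k^2)\<close> increase to 1, and their integrals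
    against the density are \<open>k / pi\<close> times Poisson's formula at \<open>\<i> k\<close>,
    hence expressible through \<alpha>.\<close>
  have mass: "(\<integral>\<^sup>+x. ennreal (p n x / pi) \<partial>lborel) = 1" for n
  proof (rule LIMSEQ_unique)
    let ?f = "\<lambda>k x. ennreal (p n x / pi * ((real k)\<^sup>2 / (x\<^sup>2 + (real k)\<^sup>2)))"
    show "(\<lambda>k. \<integral>\<^sup>+x. ?f k x \<partial>lborel) \<longlonglongrightarrow> (\<integral>\<^sup>+x. ennreal (p n x / pi) \<partial>lborel)"
    proof (rule nn_integral_LIMSEQ)
      have "(real k)\<^sup>2 / (x\<^sup>2 + (real k)\<^sup>2) \<le> (real m)\<^sup>2 / (x\<^sup>2 + (real m)\<^sup>2)" if "k \<le> m" for k m :: nat and x :: real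
      proof (cases "k = 0")
        case False
        with that have "(real k)\<^sup>2 \<le> (real m)\<^sup>2" "0 < (real k)\<^sup>2" "0 < (real m)\<^sup>2" by auto
        then show ?thesis
          using mult_left_mono[of "(real k)\<^sup>2" "(real m)\<^sup>2" "x\<^sup>2"] by (simp add: divide_simps add_nonneg_pos algebra_simps)
      qed auto
      then show "incseq ?f"
        unfolding incseq_def le_fun_def using p
        by (intro allI impI ennreal_leI mult_left_mono divide_nonneg_nonneg) simp_all
      show "(\<lambda>k. ?f k x) \<longlonglongrightarrow> ennreal (p n x / pi)" for x
      proof (rule tendsto_ennrealI)
        have "(\<lambda>k. (real k)\<^sup>2 / (x\<^sup>2 + (real k)\<^sup>2)) \<longlonglongrightarrow> 1" by real_asymp
        from tendsto_mult[OF tendsto_const this, of "p n x / pi"]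
        show "(\<lambda>k. p n x / pi * ((real k)\<^sup>2 / (x\<^sup>2 + (real k)\<^sup>2))) \<longlonglongrightarrow> p n x / pi" by simp
      qed
    qed auto
    show "(\<lambda>k. \<integral>\<^sup>+x. ?f k x \<partial>lborel) \<longlonglongrightarrow> 1"
    proof (rule Lim_transform_eventually)
      have "filterlim (\<lambda>k. real k + e n) at_top sequentially" by real_asymp
      then have "(\<lambda>k. \<alpha> (real k + e n)) \<longlonglongrightarrow> 1" by (rule filterlim_compose[OF \<alpha>_lim])
      moreover have "(\<lambda>k. real k / (real k + e n)) \<longlonglongrightarrow> 1" by real_asymp
      ultimately have "(\<lambda>k. real k / (real k + e n) * \<alpha> (real k + e n)) \<longlonglongrightarrow> 1 * 1" by (intro tendsto_mult)
      then show "(\<lambda>k. ennreal (real k / (real k + e n) * \<alpha> (real k + e n))) \<longlonglongrightarrow> 1"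
        using tendsto_ennrealI by fastforce
      show "\<forall>\<^sub>F k in sequentially. ennreal (real k / (real k + e n) * \<alpha> (real k + e n)) = (\<integral>\<^sup>+x. ?f k x \<partial>lborel)"
        using eventually_gt_at_top[of 0]
      proof eventually_elim
        case (elim k)
        let ?z = "\<i> * of_real (real k) :: complex"
        have "(\<integral>\<^sup>+x. ?f k x \<partial>lborel) = (\<integral>\<^sup>+x. ennreal (real k / pi) * ennreal (p n x * (Im ?z / ((x - Re ?z)\<^sup>2 + (Im ?z)\<^sup>2))) \<partial>lborel)"
          using p by (intro nn_integral_cong) (simp add: ennreal_mult'[symmetric] power2_eq_square)
        also have "\<dots> = ennreal (real k / pi) * ennreal (pi * (- Im (g n ?z)))"
          using poisson[of ?z n] elim by (subst nn_integral_cmult) auto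
        also have "\<dots> = ennreal (real k * (- Im (g n ?z)))"
          using g_neg[of ?z n] by (subst ennreal_mult'[symmetric]) auto
        also have "g n ?z = \<Gamma> (\<i> * of_real (real k + e n))"
          by (simp add: g_def algebra_simps)
        also have "real k * (- Im (\<Gamma> (\<i> * of_real (real k + e n)))) = real k / (real k + e n) * \<alpha> (real k + e n)"
          using e(1)[of n] elim by (simp add: \<alpha>_def)
        finally show ?case ..
      qed
    qed
  qed
  have D: "real_distribution (D n)" for n
  proof -
    have "prob_space (D n)"
      by (rule prob_spaceI) (simp add: D_def emeasure_density mass)
    then show ?thesis by (simp add: real_distribution_def real_distribution_axioms_def D_def)
  qed
  have Im_D: "Im (cauchy_G (D n) z) = Im (g n z)" if z: "0 < Im z" for n z
  proof -
    have "ennreal (- Im (cauchy_G (D n) z)) = (\<integral>\<^sup>+x. ennreal (Im z / ((x - Re z)\<^sup>2 + (Im z)\<^sup>2)) \<partial>D n)"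
      using real_distribution.nn_integral_poisson_kernel[OF D z] by simp
    also have "\<dots> = (\<integral>\<^sup>+x. ennreal (1 / pi) * ennreal (p n x * (Im z / ((x - Re z)\<^sup>2 + (Im z)\<^sup>2))) \<partial>lborel)"
      unfolding D_def using p z by (subst nn_integral_density) (auto simp: ennreal_mult'[symmetric] intro!: nn_integral_cong)
    also have "\<dots> = ennreal (1 / pi) * ennreal (pi * (- Im (g n z)))"
      using poisson[OF z, of n] by (subst nn_integral_cmult) auto
    also have "\<dots> = ennreal (- Im (g n z))"
      using g_neg[of z n] z by (subst ennreal_mult'[symmetric]) auto
    finally show ?thesis
      using real_distribution.Im_cauchy_G_neg[OF D z, of n] g_neg[of z n] z by simp
  qed
  \<comment> \<open>Because \<open>0 < e n \<le> 1\<close>, the heights \<open>T + e n\<close> lie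
    between \<open>T\<close> and \<open>T + 1\<close>, so one \<open>T\<close> serves all
    \<open>n\<close>. The losses in \<alpha> and in \<open>T / (T + 1)\<close> together stay below
    \<open>\<epsilon> / 2\<close>, and \<open>prob_interval_ge\<close> doubles this.\<close>
  have "tight D"
    unfolding tight_def
  proof (intro conjI allI impI D)
    fix \<epsilon> :: real assume \<epsilon>: "0 < \<epsilon>"
    have "\<forall>\<^sub>F T in at_top. 1 - \<epsilon> / 4 < \<alpha> T"
      by (rule order_tendstoD(1)[OF \<alpha>_lim]) (use \<epsilon> in simp)
    then obtain T0 where T0: "\<And>s. T0 \<le> s \<Longrightarrow> 1 - \<epsilon> / 4 < \<alpha> s"
      unfolding eventually_at_top_linorder by blast
    have "((\<lambda>T. (1 - \<epsilon> / 4) * (T / (T + 1))) \<longlongrightarrow> 1 - \<epsilon> / 4) at_top" by real_asymp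
    then have "\<forall>\<^sub>F T in at_top. 1 - \<epsilon> / 2 < (1 - \<epsilon> / 4) * (T / (T + 1))"
      by (rule order_tendstoD(1)) (use \<epsilon> in simp)
    then have "\<forall>\<^sub>F T in at_top. 1 - \<epsilon> / 2 < (1 - \<epsilon> / 4) * (T / (T + 1)) \<and> max T0 1 \<le> T"
      using eventually_ge_at_top by (rule eventually_conj)
    then obtain T where T: "1 - \<epsilon> / 2 < (1 - \<epsilon> / 4) * (T / (T + 1))" "T0 \<le> T" "1 \<le> T"
      by (auto dest!: eventually_happens)
    have "1 - \<epsilon> < measure (D n) {-T<..T}" for n
    proof -
      have \<alpha>0: "0 \<le> \<alpha> (T + e n)" unfolding \<alpha>_def
        using T e(1)[of n] neg[of "\<i> * of_real (T + e n)"] by (intro mult_nonneg_nonneg) auto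
      have "(1 - \<epsilon> / 4) * (T / (T + 1)) \<le> \<alpha> (T + e n) * (T / (T + 1))"
        using T0[of "T + e n"] T e(1)[of n] by (intro mult_right_mono) auto
      also have "\<dots> \<le> \<alpha> (T + e n) * (T / (T + e n))"
        using T e[of n] \<alpha>0 by (intro mult_left_mono divide_left_mono) auto
      also have "\<dots> = T * (- Im (\<Gamma> (\<i> * of_real (T + e n))))"
        using T e(1)[of n] by (simp add: \<alpha>_def)
      also have "\<Gamma> (\<i> * of_real (T + e n)) = g n (\<i> * of_real T)"
        by (simp add: g_def algebra_simps)
      finally have "1 - \<epsilon> / 2 < T * (- Im (cauchy_G (D n) (\<i> * of_real T)))"
        using T Im_D[of "\<i> * of_real T" n] by simp
      then show ?thesis
        using real_distribution.prob_interval_ge[OF D, of T n] T by simp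
    qed
    then show "\<exists>a b. a < b \<and> (\<forall>n. 1 - \<epsilon> < measure (D n) {a<..b})"
      using T by (intro exI[of _ "- T"] exI[of _ T]) auto
  qed
  from tight_imp_convergent_subsubsequence[OF this strict_mono_id]
  obtain r M where r: "strict_mono r" and M: "real_distribution M" and w: "weak_conv_m (\<lambda>n. D (r n)) M"
    by (auto simp: comp_def)
  have Im_eq: "Im (cauchy_G M z) = Im (\<Gamma> z)" if z: "0 < Im z" for z
  proof (rule LIMSEQ_unique)
    show "(\<lambda>n. Im (cauchy_G (D (r n)) z)) \<longlonglongrightarrow> Im (cauchy_G M z)"
      by (intro tendsto_Im weak_conv_cauchy_G[OF D M w]) (use z in auto)
    have "isCont \<Gamma> z"
      using holomorphic_on_imp_continuous_on[OF hol\<Gamma>] open_uhp z by (simp add: continuous_on_eq_continuous_at)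
    moreover have "(\<lambda>n. z + \<i> * of_real (e (r n))) \<longlonglongrightarrow> z"
      using LIMSEQ_subseq_LIMSEQ[OF e_lim r] by (auto intro!: tendsto_eq_intros simp: comp_def)
    ultimately have "(\<lambda>n. \<Gamma> (z + \<i> * of_real (e (r n)))) \<longlonglongrightarrow> \<Gamma> z" by (rule isCont_tendsto_compose)
    then show "(\<lambda>n. Im (cauchy_G (D (r n)) z)) \<longlonglongrightarrow> Im (\<Gamma> z)"
      unfolding Im_D[OF z] g_def by (rule tendsto_Im)
  qed
  have "cauchy_G M z = \<Gamma> z" if z: "0 < Im z" for z
  proof -
    \<comment> \<open>Equal imaginary parts make the difference constant; both terms are at most
      \<open>1 / y\<close> at \<open>\<i> y\<close>, so the constant is 0.\<close>
    define d where "d z = cauchy_G M z - \<Gamma> z" for z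
    have "d holomorphic_on uhp"
      unfolding d_def real_distribution.cauchy_G_eq[OF M]
      using real_distribution.holomorphic_cauchy_F[OF M] real_distribution.Im_cauchy_F_pos[OF M]
      by (intro holomorphic_intros hol\<Gamma>) force+
    then have const: "d z = d (\<i> * of_real y)" if "0 < y" for y
      by (rule Im_eq_0_imp_const) (use z that Im_eq in \<open>auto simp: d_def\<close>)
    have "cmod (d z) \<le> 2 / y" if "0 < y" for y
    proof -
      have "cmod (d (\<i> * of_real y)) \<le> cmod (cauchy_G M (\<i> * of_real y)) + cmod (\<Gamma> (\<i> * of_real y))"
        unfolding d_def by (rule norm_triangle_ineq4)
      also have "\<dots> \<le> 1 / y + 1 / y"
        using real_distribution.norm_cauchy_G_le[OF M, of "\<i> * of_real y"] bd[of "\<i> * of_real y"] that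
        by (intro add_mono) auto
      finally show ?thesis using const[OF that] by simp
    qed
    then have "\<forall>\<^sub>F y in at_top. cmod (d z) \<le> 2 / y"
      by (rule eventually_mono[OF eventually_gt_at_top[of 0]])
    moreover have "((\<lambda>y::real. 2 / y) \<longlongrightarrow> 0) at_top" by real_asymp
    ultimately have "cmod (d z) \<le> 0" by (intro tendsto_lowerbound[where F = at_top]) auto
    then show ?thesis by (simp add: d_def)
  qed
  then have "cauchy_F M z = \<Phi> z" if "0 < Im z" for z
    using that by (simp add: cauchy_F_def \<Gamma>_def)
  with M show ?thesis by blast
qed

section \<open>Subordination functions\<close>

text \<open>The stability bound is applied around \<open>w n\<close> to the point \<open>w0\<close>,
  so convergence of the maps at \<open>w0\<close> alone suffices:
  \<open>|w n - w0| \<le> e n + \<kappa> n * |w n - w0|\<close> with \<open>\<kappa> n\<close>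
  tending to a limit below 1. The same lemma gives continuity in \<open>z\<close> and in
  \<open>t\<close>.\<close>

lemma fixpoints_tendsto:
  fixes f :: "nat \<Rightarrow> complex \<Rightarrow> complex"
  assumes hol: "\<And>n. f n holomorphic_on uhp" and ge: "\<And>n w. 0 < Im w \<Longrightarrow> c n \<le> Im (f n w)"
    and c: "\<And>n. 0 < c n" and w: "\<And>n. 0 < Im (w n)" "\<And>n. f n (w n) = w n"
    and w0: "0 < Im w0" and lim: "(\<lambda>n. f n w0) \<longlonglongrightarrow> w0" and c_lim: "c \<longlonglongrightarrow> l" "0 < l"
  shows "w \<longlonglongrightarrow> w0"
proof -
  define \<kappa> where "\<kappa> n = sqrt ((Im (f n w0) - c n) / Im w0)" for n
  define e where "e n = cmod (f n w0 - w0)" for n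
  have \<kappa>_lim: "\<kappa> \<longlonglongrightarrow> sqrt ((Im w0 - l) / Im w0)"
    unfolding \<kappa>_def using w0 by (intro tendsto_intros lim c_lim) auto
  have \<kappa>1: "sqrt ((Im w0 - l) / Im w0) < 1" using w0 c_lim by simp
  have e_lim: "e \<longlonglongrightarrow> 0" unfolding e_def using lim by (simp add: tendsto_norm_zero LIM_zero)
  have le: "cmod (w n - w0) - e n \<le> \<kappa> n * cmod (w n - w0)" for n
  proof -
    have nonneg: "0 \<le> (Im (f n w0) - c n) / Im w0" using ge[OF w0] w0 by simp
    have "(cmod (f n w0 - w n))\<^sup>2 * Im w0 \<le> (cmod (w0 - w n))\<^sup>2 * (Im (f n w0) - c n)"
      by (rule fixpoint_stable[OF hol ge w w0 c])
    then have "(cmod (f n w0 - w n))\<^sup>2 \<le> (\<kappa> n * cmod (w n - w0))\<^sup>2"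
      using nonneg w0 by (simp add: \<kappa>_def power_mult_distrib norm_minus_commute field_simps)
    then have "cmod (f n w0 - w n) \<le> \<kappa> n * cmod (w n - w0)"
      by (rule power2_le_imp_le) (use nonneg in \<open>simp add: \<kappa>_def\<close>)
    moreover have "cmod (w n - w0) \<le> cmod (f n w0 - w n) + e n"
      using norm_triangle_ineq4[of "f n w0 - w0" "f n w0 - w n"] by (simp add: e_def)
    ultimately show ?thesis by linarith
  qed
  have "(\<lambda>n. w n - w0) \<longlonglongrightarrow> 0"
  proof (rule Lim_null_comparison)
    have "\<forall>\<^sub>F n in sequentially. \<kappa> n < 1" by (rule order_tendstoD(2)[OF \<kappa>_lim \<kappa>1])
    then show "\<forall>\<^sub>F n in sequentially. cmod (w n - w0) \<le> e n / (1 - \<kappa> n)"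
      by eventually_elim (use le in \<open>simp add: field_simps\<close>)
    have "(\<lambda>n. e n / (1 - \<kappa> n)) \<longlonglongrightarrow> 0 / (1 - sqrt ((Im w0 - l) / Im w0))"
      by (intro tendsto_divide tendsto_diff tendsto_const e_lim \<kappa>_lim) (use \<kappa>1 in linarith)
    then show "(\<lambda>n. e n / (1 - \<kappa> n)) \<longlonglongrightarrow> 0" by simp
  qed
  then show ?thesis by (rule LIM_zero_cancel)
qed

section \<open>Non-tangential asymptotics at infinity\<close>

definition asymp_id :: "real \<Rightarrow> (complex \<Rightarrow> complex) \<Rightarrow> bool" where
  "asymp_id l \<Phi> \<longleftrightarrow> (\<forall>e>0. \<exists>T>0. \<forall>z\<in>cone l T. cmod (\<Phi> z - z) \<le> e * cmod z)"

lemma asymp_idD: "asymp_id l \<Phi> \<Longrightarrow> 0 < e \<Longrightarrow> \<exists>T>0. \<forall>z\<in>cone l T. cmod (\<Phi> z - z) \<le> e * cmod z"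
  by (simp add: asymp_id_def)

lemma (in real_distribution) asymp_id_cauchy_F: "0 \<le> l \<Longrightarrow> asymp_id l (cauchy_F M)"
  using cauchy_F_asymptotic by (simp add: asymp_id_def)

lemma axis_in_cone: "0 < l \<Longrightarrow> 0 \<le> T \<Longrightarrow> T < y \<Longrightarrow> \<i> * complex_of_real y \<in> cone l T"
  by (simp add: cone_def)

lemma asymp_id_axis:
  assumes "asymp_id l \<Phi>" "0 < l"
  shows "((\<lambda>y. \<Phi> (\<i> * of_real y) / (\<i> * of_real y)) \<longlongrightarrow> 1) at_top"
proof (rule tendstoI)
  fix e :: real assume e: "0 < e"
  obtain T where T: "0 < T" "\<And>z. z \<in> cone l T \<Longrightarrow> cmod (\<Phi> z - z) \<le> e / 2 * cmod z"
    using asymp_idD[OF assms(1), of "e / 2"] e by auto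
  show "\<forall>\<^sub>F y in at_top. dist (\<Phi> (\<i> * of_real y) / (\<i> * of_real y)) 1 < e"
    using eventually_gt_at_top[of T]
  proof eventually_elim
    case (elim y)
    let ?z = "\<i> * complex_of_real y"
    have "cmod (\<Phi> ?z - ?z) \<le> e / 2 * y"
      using T(2)[OF axis_in_cone[OF assms(2) _ elim]] T(1) elim by (simp add: norm_mult)
    moreover have "\<Phi> ?z / ?z - 1 = (\<Phi> ?z - ?z) / ?z" using T(1) elim by (simp add: diff_divide_distrib)
    ultimately have "dist (\<Phi> ?z / ?z) 1 \<le> e / 2"
      using T(1) elim by (simp add: dist_norm norm_divide norm_mult field_simps)
    with e show ?case by simp
  qed
qed

lemma asymp_id_maps_cone:
  assumes "asymp_id l \<Phi>" "0 < l" "l < l'" "0 \<le> T"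
  shows "\<exists>T'>0. \<forall>z\<in>cone l T'. \<Phi> z \<in> cone l' T"
proof -
  obtain d where d: "0 < d"
    and nb: "\<And>T u w. 0 \<le> T \<Longrightarrow> u \<in> cone l (2 * T) \<Longrightarrow> cmod (w - u) \<le> d * cmod u \<Longrightarrow> w \<in> cone l' T"
    using cone_nbhd[OF assms(2,3)] by blast
  obtain T1 where T1: "0 < T1" "\<And>z. z \<in> cone l T1 \<Longrightarrow> cmod (\<Phi> z - z) \<le> d * cmod z"
    using asymp_idD[OF assms(1) d] by auto
  have "\<Phi> z \<in> cone l' T" if "z \<in> cone l (max T1 (2 * T))" for z
    using nb[OF assms(4), of z "\<Phi> z"] T1(2)[of z] that by (auto simp: cone_def)
  moreover have "0 < max T1 (2 * T)" using T1 by simp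
  ultimately show ?thesis by blast
qed

lemma asymp_id_compose:
  assumes \<Phi>: "asymp_id l \<Phi>" and \<Psi>: "asymp_id l' \<Psi>" and l: "0 < l" "l < l'"
  shows "asymp_id l (\<lambda>z. \<Psi> (\<Phi> z))"
  unfolding asymp_id_def
proof (intro allI impI)
  fix e :: real assume e: "0 < e"
  define d where "d = min 1 (e / 3)"
  have d: "0 < d" "d \<le> 1" "3 * d \<le> e" using e by (auto simp: d_def)
  obtain T1 where T1: "0 < T1" "\<And>z. z \<in> cone l T1 \<Longrightarrow> cmod (\<Phi> z - z) \<le> d * cmod z"
    using asymp_idD[OF \<Phi> d(1)] by auto
  obtain T2 where T2: "0 < T2" "\<And>z. z \<in> cone l' T2 \<Longrightarrow> cmod (\<Psi> z - z) \<le> d * cmod z"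
    using asymp_idD[OF \<Psi> d(1)] by auto
  obtain T3 where T3: "0 < T3" "\<And>z. z \<in> cone l T3 \<Longrightarrow> \<Phi> z \<in> cone l' T2"
    using asymp_id_maps_cone[OF \<Phi> l, of T2] T2(1) by auto
  have "cmod (\<Psi> (\<Phi> z) - z) \<le> e * cmod z" if "z \<in> cone l (max T1 T3)" for z
  proof -
    have z: "z \<in> cone l T1" "z \<in> cone l T3" using that by (auto simp: cone_def)
    have "cmod (\<Phi> z) \<le> cmod z + cmod (\<Phi> z - z)"
      using norm_triangle_ineq[of z "\<Phi> z - z"] by simp
    also have "\<dots> \<le> cmod z + 1 * cmod z"
      using T1(2)[OF z(1)] mult_right_mono[OF d(2), of "cmod z"] by simp
    finally have "d * cmod (\<Phi> z) \<le> d * (2 * cmod z)" using d by (intro mult_left_mono) auto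
    then have "cmod (\<Psi> (\<Phi> z) - \<Phi> z) + cmod (\<Phi> z - z) \<le> 3 * d * cmod z"
      using T2(2)[OF T3(2)[OF z(2)]] T1(2)[OF z(1)] by simp
    moreover have "cmod (\<Psi> (\<Phi> z) - z) \<le> cmod (\<Psi> (\<Phi> z) - \<Phi> z) + cmod (\<Phi> z - z)"
      using norm_triangle_ineq[of "\<Psi> (\<Phi> z) - \<Phi> z" "\<Phi> z - z"] by simp
    moreover have "3 * d * cmod z \<le> e * cmod z" using d by (intro mult_right_mono) auto
    ultimately show ?thesis by linarith
  qed
  moreover have "0 < max T1 T3" using T1 by simp
  ultimately show "\<exists>T>0. \<forall>z\<in>cone l T. cmod (\<Psi> (\<Phi> z) - z) \<le> e * cmod z" by blast
qed

section \<open>The fixed point equation and its solution\<close>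

definition shift_F :: "real measure \<Rightarrow> complex \<Rightarrow> complex \<Rightarrow> complex" where
  "shift_F M z w = z + cauchy_F M w - w"

context real_distribution
begin

lemma Im_shift_F_ge: "0 < Im w \<Longrightarrow> Im z \<le> Im (shift_F M z w)"
  using Im_cauchy_F_ge[of w] by (simp add: shift_F_def)

lemma holomorphic_shift_F: "shift_F M z holomorphic_on uhp"
  unfolding shift_F_def by (intro holomorphic_intros holomorphic_cauchy_F)

lemma shift_F_diff:
  "0 < Im w' \<Longrightarrow> 0 < Im w \<Longrightarrow> shift_F M z' w' - shift_F M z w = (z' - z) + (secant_F M w' w - 1) * (w' - w)"
  using cauchy_F_diff[of w' w] by (simp add: shift_F_def algebra_simps)

lemma has_field_derivative_shift_F:
  "0 < Im w \<Longrightarrow> (shift_F M z has_field_derivative secant_F M w w - 1) (at w)"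
  unfolding shift_F_def by (auto intro!: derivative_eq_intros has_field_derivative_cauchy_F)

text \<open>Supplies the growth hypothesis of \<open>comp_Im_less\<close>: the quotient is
  \<open>Im z / y\<close> plus the real part of \<open>F (\<i> y) / (\<i> y) - 1\<close>.\<close>

lemma shift_F_axis: "((\<lambda>y. Im (shift_F M z (\<i> * of_real y)) / y) \<longlongrightarrow> 0) at_top"
proof (rule Lim_transform_eventually)
  have "((\<lambda>y. Im z / y) \<longlongrightarrow> 0) at_top" by real_asymp
  then have "((\<lambda>y. Im z / y + (Re (cauchy_F M (\<i> * of_real y) / (\<i> * of_real y)) - 1)) \<longlongrightarrow> 0 + (Re 1 - 1)) at_top"
    by (intro tendsto_intros asymp_id_axis[OF asymp_id_cauchy_F[of 1]]) auto
  then show "((\<lambda>y. Im z / y + (Re (cauchy_F M (\<i> * of_real y) / (\<i> * of_real y)) - 1)) \<longlongrightarrow> 0) at_top" by simp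
  show "\<forall>\<^sub>F y in at_top. Im z / y + (Re (cauchy_F M (\<i> * of_real y) / (\<i> * of_real y)) - 1) =
      Im (shift_F M z (\<i> * of_real y)) / y"
    using eventually_gt_at_top[of 0]
    by eventually_elim (simp add: shift_F_def Re_divide power2_eq_square field_simps)
qed

end

definition sub_fix :: "real measure \<Rightarrow> real measure \<Rightarrow> complex \<Rightarrow> complex \<Rightarrow> bool" where
  "sub_fix S M z w \<longleftrightarrow> 0 < Im w \<and> shift_F M z (shift_F S z w) = w"

locale subordination =
  S: real_distribution S + M: real_distribution M for S M :: "real measure"
begin

definition sub_map :: "complex \<Rightarrow> complex \<Rightarrow> complex" where
  "sub_map z w = shift_F M z (shift_F S z w)"

lemma Im_shift_pos: "0 < Im z \<Longrightarrow> 0 < Im w \<Longrightarrow> 0 < Im (shift_F S z w)"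
  using S.Im_shift_F_ge[of w z] by linarith

lemma Im_sub_map_ge: "0 < Im z \<Longrightarrow> 0 < Im w \<Longrightarrow> Im z \<le> Im (sub_map z w)"
  unfolding sub_map_def by (intro M.Im_shift_F_ge Im_shift_pos)

lemma holomorphic_sub_map: "0 < Im z \<Longrightarrow> sub_map z holomorphic_on uhp"
  unfolding sub_map_def
  by (rule holomorphic_on_compose_gen[OF S.holomorphic_shift_F M.holomorphic_shift_F, unfolded comp_def])
    (auto intro: Im_shift_pos)

lemma sub_fix_unique: "0 < Im z \<Longrightarrow> sub_fix S M z w \<Longrightarrow> sub_fix S M z w' \<Longrightarrow> w = w'"
  using fixpoint_unique[OF holomorphic_sub_map Im_sub_map_ge] by (simp add: sub_fix_def sub_map_def)

lemma sub_fix_exists: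
  assumes z: "0 < Im z" shows "\<exists>w. sub_fix S M z w"
proof -
  obtain a where "0 < Im a" "Im (shift_F M z (shift_F S z a)) < Im a"
    using comp_Im_less[OF M.holomorphic_shift_F M.Im_shift_F_ge S.holomorphic_shift_F S.Im_shift_F_ge z S.shift_F_axis]
    by blast
  with fixpoint_exists[OF holomorphic_sub_map[OF z] Im_sub_map_ge[OF z] z, of a] show ?thesis
    by (auto simp: sub_fix_def sub_map_def)
qed

definition \<omega> :: "complex \<Rightarrow> complex" where
  "\<omega> z = (SOME w. sub_fix S M z w)"

lemma sub_fix_\<omega>: "0 < Im z \<Longrightarrow> sub_fix S M z (\<omega> z)"
  unfolding \<omega>_def using sub_fix_exists by (rule someI_ex)

lemma \<omega>_eqI: "0 < Im z \<Longrightarrow> sub_fix S M z w \<Longrightarrow> \<omega> z = w"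
  using sub_fix_unique sub_fix_\<omega> by blast

lemma sub_map_\<omega>: "0 < Im z \<Longrightarrow> sub_map z (\<omega> z) = \<omega> z" and Im_\<omega>_pos: "0 < Im z \<Longrightarrow> 0 < Im (\<omega> z)"
  using sub_fix_\<omega> by (auto simp: sub_fix_def sub_map_def)

lemma Im_\<omega>_ge: "0 < Im z \<Longrightarrow> Im z \<le> Im (\<omega> z)"
  using Im_sub_map_ge[of z "\<omega> z"] sub_map_\<omega>[of z] Im_\<omega>_pos[of z] by simp

text \<open>By the chain rule the product is the multiplier of the subordination map at its fixed
  point, of modulus less than 1. The expression is the denominator of both derivatives of the
  subordination function.\<close>

lemma multiplier_ne_1:
  assumes z: "0 < Im z" and w: "sub_fix S M z w"
  shows "1 - (secant_F M (shift_F S z w) (shift_F S z w) - 1) * (secant_F S w w - 1) \<noteq> 0"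
proof -
  have w: "0 < Im w" "sub_map z w = w" using w by (auto simp: sub_fix_def sub_map_def)
  have "(sub_map z has_field_derivative
      (secant_F M (shift_F S z w) (shift_F S z w) - 1) * (secant_F S w w - 1)) (at w)"
    unfolding sub_map_def using w z
    by (intro DERIV_chain2[OF M.has_field_derivative_shift_F S.has_field_derivative_shift_F] Im_shift_pos)
  from fixpoint_multiplier[OF holomorphic_sub_map[OF z] Im_sub_map_ge[OF z] z w this] show ?thesis by auto
qed

lemma continuous_\<omega>:
  assumes z: "0 < Im z0" and X: "\<And>n. 0 < Im (X n)" "X \<longlonglongrightarrow> z0"
  shows "(\<lambda>n. \<omega> (X n)) \<longlonglongrightarrow> \<omega> z0"
proof (rule fixpoints_tendsto[where f = "\<lambda>n. sub_map (X n)" and c = "\<lambda>n. Im (X n)" and l = "Im z0"])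
  have "(\<lambda>n. shift_F S (X n) (\<omega> z0)) \<longlonglongrightarrow> shift_F S z0 (\<omega> z0)"
    unfolding shift_F_def by (intro tendsto_intros X)
  moreover have "isCont (cauchy_F M) (shift_F S z0 (\<omega> z0))"
    using M.has_field_derivative_cauchy_F[OF Im_shift_pos[OF z Im_\<omega>_pos[OF z]]] by (rule DERIV_isCont)
  ultimately have "(\<lambda>n. sub_map (X n) (\<omega> z0)) \<longlonglongrightarrow> sub_map z0 (\<omega> z0)"
    unfolding sub_map_def shift_F_def[of M] by (intro tendsto_intros X isCont_tendsto_compose[where g = "cauchy_F M"])
  then show "(\<lambda>n. sub_map (X n) (\<omega> z0)) \<longlonglongrightarrow> \<omega> z0" using sub_map_\<omega>[OF z] by simp
qed (use z X in \<open>auto intro: holomorphic_sub_map Im_sub_map_ge Im_\<omega>_pos sub_map_\<omega> tendsto_Im\<close>)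

text \<open>Implicit differentiation by hand: the increments satisfy a linear equation whose
  coefficients are secant slopes, and continuity of \<omega> lets these converge to
  derivatives.\<close>

lemma has_field_derivative_\<omega>:
  assumes z: "0 < Im z"
  defines "v \<equiv> shift_F S z (\<omega> z)"
  shows "(\<omega> has_field_derivative
    secant_F M v v / (1 - (secant_F M v v - 1) * (secant_F S (\<omega> z) (\<omega> z) - 1))) (at z)"
proof -
  let ?q = "secant_F M v v / (1 - (secant_F M v v - 1) * (secant_F S (\<omega> z) (\<omega> z) - 1))"
  have "((\<lambda>a. (\<omega> a - \<omega> z) / (a - z)) \<longlongrightarrow> ?q) (at z within uhp)"
    unfolding tendsto_at_iff_sequentially comp_def
  proof (intro allI impI)
    fix X assume "\<forall>i. X i \<in> uhp - {z}" and Xz: "X \<longlonglongrightarrow> z"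
    then have X: "0 < Im (X i)" "X i \<noteq> z" for i by auto
    define w' where "w' n = \<omega> (X n)" for n
    define v' where "v' n = shift_F S (X n) (w' n)" for n
    have Im: "0 < Im (w' n)" "0 < Im (v' n)" "0 < Im (\<omega> z)" "0 < Im v" for n
      using X z by (auto simp: w'_def v'_def v_def intro!: Im_\<omega>_pos Im_shift_pos)
    have w'_lim: "w' \<longlonglongrightarrow> \<omega> z" unfolding w'_def by (rule continuous_\<omega>[OF z X(1) Xz])
    have "isCont (cauchy_F S) (\<omega> z)"
      using S.has_field_derivative_cauchy_F[OF Im(3)] by (rule DERIV_isCont)
    then have v'_lim: "v' \<longlonglongrightarrow> v"
      unfolding v'_def v_def shift_F_def by (intro tendsto_intros Xz w'_lim isCont_tendsto_compose[where g = "cauchy_F S"])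
    define sM where "sM n = secant_F M (v' n) v" for n
    define sS where "sS n = secant_F S (w' n) (\<omega> z)" for n
    have sM_lim: "sM \<longlonglongrightarrow> secant_F M v v" unfolding sM_def
      by (rule weak_conv_secant_F[OF M.real_distribution_axioms M.real_distribution_axioms weak_conv_m_const])
        (use v'_lim Im in auto)
    have sS_lim: "sS \<longlonglongrightarrow> secant_F S (\<omega> z) (\<omega> z)" unfolding sS_def
      by (rule weak_conv_secant_F[OF S.real_distribution_axioms S.real_distribution_axioms weak_conv_m_const])
        (use w'_lim Im in auto)
    have ne: "1 - (secant_F M v v - 1) * (secant_F S (\<omega> z) (\<omega> z) - 1) \<noteq> 0"
      unfolding v_def by (rule multiplier_ne_1[OF z sub_fix_\<omega>[OF z]])
    have den_lim: "(\<lambda>n. 1 - (sM n - 1) * (sS n - 1)) \<longlonglongrightarrow> 1 - (secant_F M v v - 1) * (secant_F S (\<omega> z) (\<omega> z) - 1)"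
      by (intro tendsto_intros sM_lim sS_lim)
    \<comment> \<open>Exact for every \<open>n\<close>: the two shift equations are subtracted and
      \<open>v' n - v\<close> is eliminated.\<close>
    have rel: "(w' n - \<omega> z) * (1 - (sM n - 1) * (sS n - 1)) = (X n - z) * sM n" for n
    proof -
      have "v' n - v = (X n - z) + (sS n - 1) * (w' n - \<omega> z)"
        unfolding v'_def v_def sS_def by (rule S.shift_F_diff[OF Im(1,3)])
      moreover have "w' n - \<omega> z = (X n - z) + (sM n - 1) * (v' n - v)"
        using M.shift_F_diff[OF Im(2,4), of "X n" n z] sub_map_\<omega>[OF X(1)[of n]] sub_map_\<omega>[OF z]
        by (simp add: sub_map_def v'_def v_def w'_def sM_def)
      ultimately show ?thesis by algebra
    qed
    show "(\<lambda>n. (\<omega> (X n) - \<omega> z) / (X n - z)) \<longlonglongrightarrow> ?q"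
    proof (rule Lim_transform_eventually)
      show "(\<lambda>n. sM n / (1 - (sM n - 1) * (sS n - 1))) \<longlonglongrightarrow> ?q"
        by (intro tendsto_divide sM_lim den_lim ne)
      show "\<forall>\<^sub>F n in sequentially. sM n / (1 - (sM n - 1) * (sS n - 1)) = (\<omega> (X n) - \<omega> z) / (X n - z)"
        using tendsto_imp_eventually_ne[OF den_lim ne]
      proof eventually_elim
        case (elim n)
        then show ?case using rel[of n] X(2)[of n] by (simp add: w'_def frac_eq_eq mult.commute)
      qed
    qed
  qed
  then show ?thesis
    unfolding has_field_derivative_iff using at_within_open[OF _ open_uhp, of z] z by simp
qed

lemma holomorphic_\<omega>: "\<omega> holomorphic_on uhp"
  unfolding holomorphic_on_open[OF open_uhp]
proof
  fix z assume "z \<in> uhp"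
  then show "\<exists>D. (\<omega> has_field_derivative D) (at z)"
    using has_field_derivative_\<omega>[of z] by blast
qed

text \<open>In a distant cone the subordination map sends the ball of radius \<open>d |z|\<close>
  about \<open>z\<close> into itself. Brouwer's fixed point in that ball must be
  \<open>\<omega> z\<close> by uniqueness, which locates \<open>\<omega> z\<close> without further
  estimates.\<close>

lemma asymp_id_\<omega>:
  assumes l: "0 < l" shows "asymp_id l \<omega>"
  unfolding asymp_id_def
proof (intro allI impI)
  fix e :: real assume e: "0 < e"
  obtain d0 where d0: "0 < d0" "d0 \<le> 1"
    and nb: "\<And>T u w. 0 \<le> T \<Longrightarrow> u \<in> cone l (2 * T) \<Longrightarrow> cmod (w - u) \<le> d0 * cmod u \<Longrightarrow> w \<in> cone (l + 1) T"
    using cone_nbhd[of l "l + 1"] l by auto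
  define d where "d = min e d0"
  have d: "0 < d" "d \<le> 1" "d \<le> e" "d \<le> d0" using d0 e by (auto simp: d_def)
  obtain T1 where T1: "0 < T1" "\<And>z. z \<in> cone (l + 1) T1 \<Longrightarrow> cmod (cauchy_F S z - z) \<le> d / 2 * cmod z"
    using S.cauchy_F_asymptotic[of "l + 1" "d / 2"] l d by auto
  obtain T2 where T2: "0 < T2" "\<And>z. z \<in> cone (l + 1) T2 \<Longrightarrow> cmod (cauchy_F M z - z) \<le> d / 2 * cmod z"
    using M.cauchy_F_asymptotic[of "l + 1" "d / 2"] l d by auto
  define T0 where "T0 = max T1 T2"
  have "cmod (\<omega> z - z) \<le> e * cmod z" if z: "z \<in> cone l (2 * T0)" for z
  proof -
    have Imz: "0 < Im z" using z by (simp add: cone_def)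
    define B where "B = cball z (d * cmod z)"
    have B0: "compact B" "convex B" "B \<noteq> {}" using d by (auto simp: B_def not_less)
    have B: "B \<subseteq> cone (l + 1) T0"
    proof
      fix w assume "w \<in> B"
      then have "cmod (w - z) \<le> d * cmod z" by (simp add: B_def dist_norm norm_minus_commute)
      also have "\<dots> \<le> d0 * cmod z" using d by (intro mult_right_mono) auto
      finally show "w \<in> cone (l + 1) T0" using T1 by (intro nb[OF _ z]) (auto simp: T0_def)
    qed
    have sub: "cone (l + 1) T0 \<subseteq> cone (l + 1) T1" "cone (l + 1) T0 \<subseteq> cone (l + 1) T2"
      "cone (l + 1) T0 \<subseteq> uhp" by (auto simp: cone_def T0_def)
    have shift_B: "shift_F N z w \<in> B" if w: "w \<in> B" and N: "cmod (cauchy_F N w - w) \<le> d / 2 * cmod w" for N w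
    proof -
      have "cmod w \<le> cmod z + cmod (w - z)"
        using norm_triangle_ineq[of z "w - z"] by simp
      also have "\<dots> \<le> cmod z + 1 * cmod z"
        using w mult_right_mono[OF d(2), of "cmod z"] by (simp add: B_def dist_norm norm_minus_commute)
      finally have "d / 2 * cmod w \<le> d / 2 * (2 * cmod z)" using d by (intro mult_left_mono) auto
      then have "cmod (cauchy_F N w - w) \<le> d * cmod z" using N by simp
      moreover have "z - shift_F N z w = - (cauchy_F N w - w)" by (simp add: shift_F_def)
      ultimately show ?thesis unfolding B_def mem_cball dist_norm by (simp only: norm_minus_cancel)
    qed
    have "sub_map z \<in> B \<rightarrow> B"
    proof
      fix w assume w: "w \<in> B"
      then have "shift_F S z w \<in> B" by (rule shift_B) (use w T1(2)[of w] B sub in auto)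
      then show "sub_map z w \<in> B" unfolding sub_map_def
        by (rule shift_B) (use \<open>shift_F S z w \<in> B\<close> T2(2)[of "shift_F S z w"] B sub in auto)
    qed
    moreover have "continuous_on B (sub_map z)"
      using B sub by (intro continuous_on_subset[OF holomorphic_on_imp_continuous_on[OF holomorphic_sub_map[OF Imz]]]) auto
    ultimately obtain w where w: "w \<in> B" "sub_map z w = w"
      using brouwer[OF B0, of "sub_map z"] by blast
    then have "sub_fix S M z w" using B sub by (auto simp: sub_fix_def sub_map_def)
    then have "\<omega> z = w" by (rule \<omega>_eqI[OF Imz])
    then have "cmod (\<omega> z - z) \<le> d * cmod z" using w by (simp add: B_def dist_norm norm_minus_commute)
    also have "\<dots> \<le> e * cmod z" using d by (intro mult_right_mono) auto
    finally show ?thesis .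
  qed
  moreover have "0 < 2 * T0" using T1 by (simp add: T0_def)
  ultimately show "\<exists>T>0. \<forall>z\<in>cone l T. cmod (\<omega> z - z) \<le> e * cmod z" by blast
qed

lemma exists_subordination:
  "\<exists>\<rho> \<pi>. real_distribution \<rho> \<and> real_distribution \<pi> \<and> (\<forall>z. 0 < Im z \<longrightarrow> cauchy_F \<rho> z = \<omega> z) \<and>
    (\<forall>z. 0 < Im z \<longrightarrow> cauchy_F \<pi> z = cauchy_F S (\<omega> z))"
proof -
  have "asymp_id 1 (\<lambda>z. cauchy_F S (\<omega> z))"
    using asymp_id_compose[OF asymp_id_\<omega>[of 1] S.asymp_id_cauchy_F[of 2]] by simp
  then have lim: "((\<lambda>y. cauchy_F S (\<omega> (\<i> * of_real y)) / (\<i> * of_real y)) \<longlongrightarrow> 1) at_top"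
    by (rule asymp_id_axis) simp
  have "(\<lambda>z. cauchy_F S (\<omega> z)) holomorphic_on uhp"
    by (rule holomorphic_on_compose_gen[OF holomorphic_\<omega> S.holomorphic_cauchy_F, unfolded comp_def])
      (auto intro: Im_\<omega>_pos)
  moreover have "Im z \<le> Im (cauchy_F S (\<omega> z))" if "0 < Im z" for z
    using S.Im_cauchy_F_ge[OF Im_\<omega>_pos[OF that]] Im_\<omega>_ge[OF that] by linarith
  ultimately have "\<exists>\<pi>. real_distribution \<pi> \<and> (\<forall>z. 0 < Im z \<longrightarrow> cauchy_F \<pi> z = cauchy_F S (\<omega> z))"
    using lim by (rule exists_cauchy_F)
  moreover have "\<exists>\<rho>. real_distribution \<rho> \<and> (\<forall>z. 0 < Im z \<longrightarrow> cauchy_F \<rho> z = \<omega> z)"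
    by (rule exists_cauchy_F[OF holomorphic_\<omega> Im_\<omega>_ge asymp_id_axis[OF asymp_id_\<omega>[of 1]]]) auto
  ultimately show ?thesis by blast
qed

end

section \<open>The operator A\<close>

lemma cauchy_F_eq_from_axis:
  assumes hol: "f holomorphic_on uhp" "g holomorphic_on uhp"
    and eq: "\<And>y. Y < y \<Longrightarrow> f (\<i> * complex_of_real y) = g (\<i> * complex_of_real y)"
    and z: "0 < Im z"
  shows "f z = g z"
proof -
  define Y0 where "Y0 = max Y 0"
  define U where "U = (\<lambda>y. \<i> * complex_of_real y) ` {Y0<..}"
  define \<xi> where "\<xi> = \<i> * complex_of_real (Y0 + 1)"
  have "\<xi> islimpt U"
    unfolding islimpt_sequential
  proof (intro exI conjI allI)
    let ?x = "\<lambda>n. \<i> * complex_of_real (Y0 + 1 + 1 / real (Suc n))"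
    show "?x n \<in> U - {\<xi>}" for n
      by (auto simp: U_def \<xi>_def complex_eq_iff simp del: of_nat_Suc of_real_add of_real_divide intro!: imageI add_pos_pos)
    have "(\<lambda>n. Y0 + 1 + 1 / real (Suc n)) \<longlonglongrightarrow> Y0 + 1" by real_asymp
    then show "?x \<longlonglongrightarrow> \<xi>" unfolding \<xi>_def by (intro tendsto_mult tendsto_const tendsto_of_real)
  qed
  moreover have "(\<lambda>z. f z - g z) holomorphic_on uhp" by (intro holomorphic_intros hol)
  moreover have "U \<subseteq> uhp" "\<xi> \<in> uhp" by (auto simp: U_def \<xi>_def Y0_def)
  moreover have "f z - g z = 0" if "z \<in> U" for z
    using that eq by (auto simp: U_def Y0_def)
  ultimately have "f z - g z = 0"
    using analytic_continuation[of "\<lambda>z. f z - g z" uhp U \<xi> z] open_uhp connected_uhp z by blast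
  then show ?thesis by simp
qed

text \<open>\<open>voiculescu_on\<close> leaves open the cone on which \<open>F\<close> is inverted.
  Far out every \<open>u\<close> has a preimage in the intersection of the two cones, and by
  injectivity both inverse branches return it. The half in \<open>A / 2\<close> makes the aperture
  strictly smaller, as the surjectivity lemma demands.\<close>

lemma voiculescu_unique:
  assumes N: "real_distribution N" and v: "voiculescu_on N l T \<phi>" and v': "voiculescu_on N l' T' \<phi>'"
  shows "\<exists>L>0. \<exists>R. \<forall>u\<in>cone L R. \<phi> u = \<phi>' u"
proof -
  from v obtain a b where ab: "0 < l" "0 < a" "0 < b" "inj_on (cauchy_F N) (cone a b)"
    and \<phi>: "\<And>z. z \<in> cone l T \<Longrightarrow> \<phi> z = inv_into (cone a b) (cauchy_F N) z - z"
    unfolding voiculescu_on_def by auto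
  from v' obtain a' b' where ab': "0 < l'" "0 < a'" "0 < b'" "inj_on (cauchy_F N) (cone a' b')"
    and \<phi>': "\<And>z. z \<in> cone l' T' \<Longrightarrow> \<phi>' z = inv_into (cone a' b') (cauchy_F N) z - z"
    unfolding voiculescu_on_def by auto
  define A where "A = min a a'"
  define L where "L = min (min l l') (A / 2)"
  have L: "0 < L" "L < A" using ab ab' by (auto simp: L_def A_def)
  obtain R where R: "cone L R \<subseteq> cauchy_F N ` cone A (max b b')"
    using real_distribution.cone_subset_cauchy_F_image[OF N L] by blast
  have "\<phi> u = \<phi>' u" if u: "u \<in> cone L (max R (max T T'))" for u
  proof -
    have "u \<in> cone L R" using u by (auto simp: cone_def)
    then obtain r where r: "r \<in> cone A (max b b')" "cauchy_F N r = u" using R by blast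
    have "r \<in> cone a b" using r cone_mono[of A a b "max b b'"] by (auto simp: A_def)
    then have 1: "inv_into (cone a b) (cauchy_F N) u = r" using ab(4) r(2) by (simp add: inv_into_f_eq)
    have "r \<in> cone a' b'" using r cone_mono[of A a' b' "max b b'"] by (auto simp: A_def)
    then have 2: "inv_into (cone a' b') (cauchy_F N) u = r" using ab'(4) r(2) by (simp add: inv_into_f_eq)
    have "L \<le> l" "L \<le> l'" by (auto simp: L_def)
    then have "u \<in> cone l T" "u \<in> cone l' T'"
      using u cone_mono[of L l T "max R (max T T')"] cone_mono[of L l' T' "max R (max T T')"]
      by (auto simp: le_max_iff_disj)
    then show ?thesis using 1 2 \<phi> \<phi>' by simp
  qed
  then show ?thesis using L by blast
qed

text \<open>Put \<open>u = F z\<close> for \<open>z\<close> high on the imaginary axis; such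
  \<open>u\<close> lies in a cone where the transforms agree, so the inverse branch of the second
  map at \<open>u\<close> is also \<open>z\<close>.\<close>

lemma voiculescu_eq_imp_axis_eq:
  assumes N: "real_distribution N" and v: "voiculescu_on N l T \<phi>" and v': "voiculescu_on N' l' T' \<phi>'"
    and L: "0 < L" and eq: "\<And>u. u \<in> cone L R \<Longrightarrow> \<phi> u = \<phi>' u"
  shows "\<exists>Y. \<forall>y>Y. cauchy_F N (\<i> * complex_of_real y) = cauchy_F N' (\<i> * complex_of_real y)"
proof -
  from v obtain a b where ab: "0 < l" "0 < T" "0 < a" "0 < b" "inj_on (cauchy_F N) (cone a b)"
    and \<phi>: "\<And>z. z \<in> cone l T \<Longrightarrow> \<phi> z = inv_into (cone a b) (cauchy_F N) z - z"
    unfolding voiculescu_on_def by auto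
  from v' obtain a' b' where ab': "0 < l'" "cone l' T' \<subseteq> cauchy_F N' ` cone a' b'"
    and \<phi>': "\<And>z. z \<in> cone l' T' \<Longrightarrow> \<phi>' z = inv_into (cone a' b') (cauchy_F N') z - z"
    unfolding voiculescu_on_def by auto
  define K where "K = min L (min l l')"
  define Q where "Q = max R (max T T')"
  have K: "0 < K" "0 \<le> Q" using L ab ab' by (auto simp: K_def Q_def)
  have sub: "cone K Q \<subseteq> cone L R" "cone K Q \<subseteq> cone l T" "cone K Q \<subseteq> cone l' T'"
    by (intro cone_mono; simp add: K_def Q_def)+
  obtain Y where Y: "0 < Y" "\<And>z. z \<in> cone (K / 2) Y \<Longrightarrow> cauchy_F N z \<in> cone K Q"
    using asymp_id_maps_cone[OF real_distribution.asymp_id_cauchy_F[OF N, of "K / 2"], of K Q] K by auto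
  have "cauchy_F N (\<i> * complex_of_real y) = cauchy_F N' (\<i> * complex_of_real y)" if y: "max Y b < y" for y
  proof -
    let ?z = "\<i> * complex_of_real y"
    define u where "u = cauchy_F N ?z"
    have u: "u \<in> cone K Q" unfolding u_def using axis_in_cone[of "K / 2" Y y] Y K y by simp
    have "?z \<in> cone a b" using axis_in_cone[of a b y] ab y by simp
    then have "inv_into (cone a b) (cauchy_F N) u = ?z" using ab(5) by (simp add: u_def)
    then have "inv_into (cone a' b') (cauchy_F N') u = ?z"
      using \<phi>[of u] \<phi>'[of u] eq[of u] u sub[THEN subsetD, of u] by simp
    moreover have "u \<in> cauchy_F N' ` cone a' b'" using u sub ab'(2) by auto
    ultimately have "cauchy_F N' ?z = u" by (metis f_inv_into_f)
    then show ?thesis by (simp add: u_def)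
  qed
  then show ?thesis by blast
qed

lemma free_conv_unique_axis:
  assumes S: "real_distribution S" and M: "real_distribution M"
    and P: "real_distribution P" "free_conv S M P" and P': "free_conv S M P'"
  shows "\<exists>Y. \<forall>y>Y. cauchy_F P (\<i> * complex_of_real y) = cauchy_F P' (\<i> * complex_of_real y)"
proof -
  obtain l T \<phi>S \<phi>M \<phi>P where f: "voiculescu_on S l T \<phi>S" "voiculescu_on M l T \<phi>M" "voiculescu_on P l T \<phi>P"
    and sum: "\<And>z. z \<in> cone l T \<Longrightarrow> \<phi>P z = \<phi>S z + \<phi>M z"
    using P(2) unfolding free_conv_def by blast
  obtain l' T' \<phi>S' \<phi>M' \<phi>P' where f': "voiculescu_on S l' T' \<phi>S'" "voiculescu_on M l' T' \<phi>M'" "voiculescu_on P' l' T' \<phi>P'"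
    and sum': "\<And>z. z \<in> cone l' T' \<Longrightarrow> \<phi>P' z = \<phi>S' z + \<phi>M' z"
    using P' unfolding free_conv_def by blast
  obtain L1 R1 where 1: "0 < L1" "\<And>u. u \<in> cone L1 R1 \<Longrightarrow> \<phi>S u = \<phi>S' u"
    using voiculescu_unique[OF S f(1) f'(1)] by blast
  obtain L2 R2 where 2: "0 < L2" "\<And>u. u \<in> cone L2 R2 \<Longrightarrow> \<phi>M u = \<phi>M' u"
    using voiculescu_unique[OF M f(2) f'(2)] by blast
  define L where "L = min (min l l') (min L1 L2)"
  define R where "R = max (max T T') (max R1 R2)"
  have "0 < L" using 1 2 f f' by (simp add: L_def voiculescu_on_def)
  moreover have "cone L R \<subseteq> cone L1 R1" "cone L R \<subseteq> cone L2 R2" "cone L R \<subseteq> cone l T" "cone L R \<subseteq> cone l' T'"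
    by (intro cone_mono; simp add: L_def R_def)+
  then have "\<phi>P u = \<phi>P' u" if "u \<in> cone L R" for u
    using that by (metis (no_types, lifting) 1(2) 2(2) sum sum' subsetD)
  ultimately show ?thesis
    using voiculescu_eq_imp_axis_eq[OF P(1) f(3) f'(3)] by blast
qed

text \<open>High on the axis both candidates take values in a cone on which
  \<open>cauchy_F S\<close> is injective, so it can be cancelled; analytic continuation and
  Stieltjes inversion do the rest.\<close>

lemma A_op_unique:
  assumes S: "real_distribution S" and M: "real_distribution M"
    and \<rho>: "real_distribution \<rho>" "real_distribution P" "free_conv S M P" "mono_conv S \<rho> P"
    and \<rho>': "real_distribution \<rho>'" "real_distribution P'" "free_conv S M P'" "mono_conv S \<rho>' P'"
  shows "\<rho> = \<rho>'"
proof -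
  obtain Y where Y: "\<And>y. Y < y \<Longrightarrow> cauchy_F P (\<i> * complex_of_real y) = cauchy_F P' (\<i> * complex_of_real y)"
    using free_conv_unique_axis[OF S M \<rho>(2,3) \<rho>'(3)] by blast
  obtain T where T: "0 < T" "inj_on (cauchy_F S) (cone 1 T)"
    using real_distribution.cauchy_F_inj_on_cone[OF S, of 1] by auto
  have "\<exists>T'>0. \<forall>z\<in>cone (1 / 2) T'. cauchy_F N z \<in> cone 1 T" if "real_distribution N" for N
    using asymp_id_maps_cone[OF real_distribution.asymp_id_cauchy_F[OF that, of "1 / 2"], of 1 T] T by simp
  then obtain T1 T2 where T12: "0 < T1" "\<And>z. z \<in> cone (1 / 2) T1 \<Longrightarrow> cauchy_F \<rho> z \<in> cone 1 T"
    "0 < T2" "\<And>z. z \<in> cone (1 / 2) T2 \<Longrightarrow> cauchy_F \<rho>' z \<in> cone 1 T"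
    using \<rho>(1) \<rho>'(1) by meson
  have ax: "cauchy_F \<rho> (\<i> * complex_of_real y) = cauchy_F \<rho>' (\<i> * complex_of_real y)" if y: "max Y (max T1 T2) < y" for y
  proof -
    let ?z = "\<i> * complex_of_real y"
    have "cauchy_F S (cauchy_F \<rho> ?z) = cauchy_F S (cauchy_F \<rho>' ?z)"
      using \<rho>(4) \<rho>'(4) Y[of y] y T12 by (simp add: mono_conv_def)
    moreover have "cauchy_F \<rho> ?z \<in> cone 1 T" "cauchy_F \<rho>' ?z \<in> cone 1 T"
      using T12 y axis_in_cone[of "1 / 2" T1 y] axis_in_cone[of "1 / 2" T2 y] by auto
    ultimately show ?thesis using T(2) by (auto dest: inj_onD)
  qed
  have "cauchy_F \<rho> z = cauchy_F \<rho>' z" if "0 < Im z" for z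
    by (rule cauchy_F_eq_from_axis[OF real_distribution.holomorphic_cauchy_F[OF \<rho>(1)]
        real_distribution.holomorphic_cauchy_F[OF \<rho>'(1)] ax that])
  then show ?thesis
    by (intro cauchy_G_unique[OF \<rho>(1) \<rho>'(1)])
      (simp add: real_distribution.cauchy_G_eq[OF \<rho>(1)] real_distribution.cauchy_G_eq[OF \<rho>'(1)])
qed

section \<open>The subordination function computes the free convolution\<close>

context subordination
begin

text \<open>For \<open>u = F_P z\<close> the points \<open>\<omega> z\<close> and
  \<open>v = z + u - \<omega> z\<close> are the preimages of \<open>u\<close> under
  \<open>F_S\<close> and \<open>F_M\<close>, so the inverses add up as required. Apertures 1, 2 and
  3 belong to \<open>u\<close>, to \<open>z\<close>, and to the pair \<open>\<omega> z\<close>,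
  \<open>v\<close>; each enlargement leaves room for one asymptotically small displacement.\<close>

lemma free_conv_subordination:
  assumes \<pi>: "real_distribution P" "\<And>z. 0 < Im z \<Longrightarrow> cauchy_F P z = cauchy_F S (\<omega> z)"
  shows "free_conv S M P"
proof -
  obtain TS where TS: "0 < TS" "inj_on (cauchy_F S) (cone 3 TS)"
    using S.cauchy_F_inj_on_cone[of 3] by auto
  obtain TM where TM: "0 < TM" "inj_on (cauchy_F M) (cone 3 TM)"
    using M.cauchy_F_inj_on_cone[of 3] by auto
  obtain TP where TP: "0 < TP" "inj_on (cauchy_F P) (cone 2 TP)"
    using real_distribution.cauchy_F_inj_on_cone[OF \<pi>(1), of 2] by auto
  obtain T1 where T1: "0 < T1" "\<And>z. z \<in> cone 2 T1 \<Longrightarrow> \<omega> z \<in> cone 3 TS"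
    using asymp_id_maps_cone[OF asymp_id_\<omega>[of 2], of 3 TS] TS by auto
  \<comment> \<open>Here \<open>v - z = (F_P z - z) - (\<omega> z - z)\<close>, a difference of two
    quantities already known to be small relative to \<open>z\<close>.\<close>
  have "asymp_id 2 (\<lambda>z. shift_F S z (\<omega> z))"
    unfolding asymp_id_def
  proof (intro allI impI)
    fix e :: real assume e: "0 < e"
    obtain R1 where R1: "0 < R1" "\<And>z. z \<in> cone 2 R1 \<Longrightarrow> cmod (\<omega> z - z) \<le> e / 2 * cmod z"
      using asymp_idD[OF asymp_id_\<omega>[of 2], of "e / 2"] e by auto
    obtain R2 where R2: "0 < R2" "\<And>z. z \<in> cone 2 R2 \<Longrightarrow> cmod (cauchy_F P z - z) \<le> e / 2 * cmod z"
      using real_distribution.cauchy_F_asymptotic[OF \<pi>(1), of 2 "e / 2"] e by auto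
    have "cmod (shift_F S z (\<omega> z) - z) \<le> e * cmod z" if "z \<in> cone 2 (max R1 R2)" for z
    proof -
      have z: "z \<in> cone 2 R1" "z \<in> cone 2 R2" "0 < Im z" using that by (auto simp: cone_def)
      have "shift_F S z (\<omega> z) - z = (cauchy_F P z - z) - (\<omega> z - z)"
        using \<pi>(2)[OF z(3)] by (simp add: shift_F_def)
      then have "cmod (shift_F S z (\<omega> z) - z) \<le> cmod (cauchy_F P z - z) + cmod (\<omega> z - z)"
        by (metis norm_triangle_ineq4)
      then show ?thesis using R1(2)[OF z(1)] R2(2)[OF z(2)] by simp
    qed
    moreover have "0 < max R1 R2" using R1 by simp
    ultimately show "\<exists>T>0. \<forall>z\<in>cone 2 T. cmod (shift_F S z (\<omega> z) - z) \<le> e * cmod z" by blast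
  qed
  from asymp_id_maps_cone[OF this, of 3 TM] obtain T2
    where T2: "0 < T2" "\<And>z. z \<in> cone 2 T2 \<Longrightarrow> shift_F S z (\<omega> z) \<in> cone 3 TM" using TM by auto
  define b where "b = max TP (max T1 T2)"
  have b: "0 < b" "cone 2 b \<subseteq> cone 2 TP" "cone 2 b \<subseteq> cone 2 T1" "cone 2 b \<subseteq> cone 2 T2"
    using T1 by (auto simp: b_def cone_def)
  have injP: "inj_on (cauchy_F P) (cone 2 b)" using TP(2) b(2) by (rule inj_on_subset)
  obtain R where R: "0 < R" "cone 1 R \<subseteq> cauchy_F P ` cone 2 b"
    using real_distribution.cone_subset_cauchy_F_image[OF \<pi>(1), of 1 2 b] by auto
  have key: "inv_into (cone 3 TS) (cauchy_F S) u = \<omega> (inv_into (cone 2 b) (cauchy_F P) u)"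
    "inv_into (cone 3 TM) (cauchy_F M) u = inv_into (cone 2 b) (cauchy_F P) u + u - \<omega> (inv_into (cone 2 b) (cauchy_F P) u)"
    "u \<in> cauchy_F S ` cone 3 TS" "u \<in> cauchy_F M ` cone 3 TM"
    if u: "u \<in> cone 1 R" for u
  proof -
    define z where "z = inv_into (cone 2 b) (cauchy_F P) u"
    have "u \<in> cauchy_F P ` cone 2 b" using u R by blast
    then have z: "z \<in> cone 2 b" "cauchy_F P z = u" by (auto simp: z_def inv_into_into f_inv_into_f)
    then have Imz: "0 < Im z" by (simp add: cone_def)
    have w: "\<omega> z \<in> cone 3 TS" using z b T1 by auto
    have Fw: "cauchy_F S (\<omega> z) = u" using \<pi>(2)[OF Imz] z by simp
    have v: "shift_F S z (\<omega> z) \<in> cone 3 TM" using z b T2 by auto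
    have veq: "shift_F S z (\<omega> z) = z + u - \<omega> z" by (simp add: shift_F_def Fw)
    have "z + cauchy_F M (shift_F S z (\<omega> z)) - shift_F S z (\<omega> z) = \<omega> z"
      using sub_map_\<omega>[OF Imz] by (simp add: sub_map_def shift_F_def[of M])
    then have Fv: "cauchy_F M (shift_F S z (\<omega> z)) = u"
      unfolding veq by (simp add: algebra_simps)
    show "inv_into (cone 3 TS) (cauchy_F S) u = \<omega> (inv_into (cone 2 b) (cauchy_F P) u)"
      unfolding z_def[symmetric] by (rule inv_into_f_eq[OF TS(2) w Fw])
    show "inv_into (cone 3 TM) (cauchy_F M) u = inv_into (cone 2 b) (cauchy_F P) u + u - \<omega> (inv_into (cone 2 b) (cauchy_F P) u)"
      unfolding z_def[symmetric] veq[symmetric] by (rule inv_into_f_eq[OF TM(2) v Fv])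
    show "u \<in> cauchy_F S ` cone 3 TS" "u \<in> cauchy_F M ` cone 3 TM"
      using imageI[OF w, of "cauchy_F S"] imageI[OF v, of "cauchy_F M"] unfolding Fw Fv by simp_all
  qed
  have vI: "voiculescu_on N 1 R (\<lambda>z. inv_into (cone a c) (cauchy_F N) z - z)"
    if "0 < a" "0 < c" "inj_on (cauchy_F N) (cone a c)" "cone 1 R \<subseteq> cauchy_F N ` cone a c" for N a c
    unfolding voiculescu_on_def using that R by auto
  show ?thesis
    unfolding free_conv_def
  proof (intro exI conjI)
    show "voiculescu_on S 1 R (\<lambda>z. inv_into (cone 3 TS) (cauchy_F S) z - z)"
      by (rule vI) (use TS key in auto)
    show "voiculescu_on M 1 R (\<lambda>z. inv_into (cone 3 TM) (cauchy_F M) z - z)"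
      by (rule vI) (use TM key in auto)
    show "voiculescu_on P 1 R (\<lambda>z. inv_into (cone 2 b) (cauchy_F P) z - z)"
      by (rule vI) (use b injP R in auto)
    show "\<forall>z\<in>cone 1 R. inv_into (cone 2 b) (cauchy_F P) z - z =
        inv_into (cone 3 TS) (cauchy_F S) z - z + (inv_into (cone 3 TM) (cauchy_F M) z - z)"
      using key by simp
  qed
qed

theorem cauchy_F_A_op:
  assumes "0 < Im z" shows "cauchy_F (A_op S M) z = \<omega> z"
proof -
  obtain \<rho> P where \<rho>: "real_distribution \<rho>" "\<And>z. 0 < Im z \<Longrightarrow> cauchy_F \<rho> z = \<omega> z"
    and P: "real_distribution P" "\<And>z. 0 < Im z \<Longrightarrow> cauchy_F P z = cauchy_F S (\<omega> z)"
    using exists_subordination by blast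
  have fc: "free_conv S M P" by (rule free_conv_subordination[OF P])
  have mc: "mono_conv S \<rho> P" using \<rho> P by (simp add: mono_conv_def)
  have "A_op S M = \<rho>"
    unfolding A_op_def real_prob_iff
  proof (rule the_equality)
    show "real_distribution \<rho> \<and> (\<exists>\<pi>. real_distribution \<pi> \<and> free_conv S M \<pi> \<and> mono_conv S \<rho> \<pi>)"
      using \<rho>(1) P(1) fc mc by blast
    show "\<rho>' = \<rho>" if "real_distribution \<rho>' \<and> (\<exists>\<pi>. real_distribution \<pi> \<and> free_conv S M \<pi> \<and> mono_conv S \<rho>' \<pi>)" for \<rho>'
      using that \<rho>(1) P(1) fc mc A_op_unique[OF S.real_distribution_axioms M.real_distribution_axioms] by blast
  qed
  then show ?thesis using \<rho>(2)[OF assms] by simp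
qed

end

section \<open>The evolution equation\<close>

text \<open>Brings time derivatives into quotient form, so that they can be checked along sequences,
  the form in which weak continuity is available.\<close>

lemma has_vector_derivative_iff_quotient:
  fixes f :: "real \<Rightarrow> complex"
  shows "(f has_vector_derivative D) (at t within S) \<longleftrightarrow>
    ((\<lambda>s. (f s - f t) / of_real (s - t)) \<longlongrightarrow> D) (at t within S)"
proof -
  have "(f has_vector_derivative D) (at t within S) \<longleftrightarrow>
      ((\<lambda>s. norm (f s - f t - (s - t) *\<^sub>R D) / norm (s - t)) \<longlongrightarrow> 0) (at t within S)"
    unfolding has_vector_derivative_def has_derivative_iff_norm
    using bounded_linear_scaleR_left by blast
  also have "\<dots> \<longleftrightarrow> ((\<lambda>s. norm ((f s - f t) / of_real (s - t) - D)) \<longlongrightarrow> 0) (at t within S)"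
  proof (rule tendsto_cong)
    show "\<forall>\<^sub>F s in at t within S. norm (f s - f t - (s - t) *\<^sub>R D) / norm (s - t) = norm ((f s - f t) / of_real (s - t) - D)"
      using eventually_neq_at_within[of t t S]
    proof eventually_elim
      case (elim s)
      then have "(f s - f t) / of_real (s - t) - D = (f s - f t - (s - t) *\<^sub>R D) / of_real (s - t)"
        by (simp add: diff_divide_distrib scaleR_conv_of_real del: of_real_diff)
      then show ?case by (simp add: norm_divide del: of_real_diff)
    qed
  qed
  also have "\<dots> \<longleftrightarrow> ((\<lambda>s. (f s - f t) / of_real (s - t)) \<longlongrightarrow> D) (at t within S)"
    by (simp only: tendsto_norm_zero_iff LIM_zero_iff)
  finally show ?thesis .
qed

lemma cauchy_F_return_0: "0 < Im z \<Longrightarrow> cauchy_F (return borel 0) z = z"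
  by (simp add: cauchy_F_def cauchy_G_def integral_return)

locale monotone_semigroup =
  fixes \<nu> :: "real \<Rightarrow> real measure" and J :: "complex \<Rightarrow> complex"
  assumes nu_prob: "\<And>t. 0 \<le> t \<Longrightarrow> real_distribution (\<nu> t)"
    and nu_0: "\<nu> 0 = return borel 0"
    and nu_semigroup: "\<And>s t. 0 \<le> s \<Longrightarrow> 0 \<le> t \<Longrightarrow> mono_conv (\<nu> s) (\<nu> t) (\<nu> (s + t))"
    and nu_cont: "\<And>t s. 0 \<le> t \<Longrightarrow> (\<forall>n. 0 \<le> s n) \<Longrightarrow> s \<longlonglongrightarrow> t \<Longrightarrow> weak_conv_m (\<lambda>n. \<nu> (s n)) (\<nu> t)"
    and generator: "\<And>z. 0 < Im z \<Longrightarrow>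
          ((\<lambda>t. cauchy_F (\<nu> t) z) has_vector_derivative J z) (at 0 within {0..})"
begin

text \<open>
  Factoring out the semigroup element with index \<open>min s t\<close> writes the difference quotient as a secant
  slope of \<open>F\<close> times a difference quotient at time \<open>0\<close>, on both sides of \<open>t\<close> alike.
\<close>

lemma has_vector_derivative_time:
  assumes t: "0 \<le> t" and w: "0 < Im w"
  shows "((\<lambda>s. cauchy_F (\<nu> s) w) has_vector_derivative secant_F (\<nu> t) w w * J w) (at t within {0..})"
  unfolding has_vector_derivative_iff_quotient tendsto_at_iff_sequentially comp_def
proof (intro allI impI)
  fix X assume "\<forall>i. X i \<in> {0..} - {t}" and Xt: "X \<longlonglongrightarrow> t"
  then have X: "0 \<le> X i" "X i \<noteq> t" for i by auto
  define m where "m i = min (X i) t" for i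
  define h where "h i = \<bar>X i - t\<bar>" for i
  have m: "0 \<le> m i" for i using X(1)[of i] t by (simp add: m_def)
  have h: "0 < h i" for i using X(2)[of i] by (simp add: h_def)
  have "m \<longlonglongrightarrow> min t t" unfolding m_def by (intro tendsto_intros Xt)
  then have m_lim: "m \<longlonglongrightarrow> t" by simp
  have "h \<longlonglongrightarrow> \<bar>t - t\<bar>" unfolding h_def by (intro tendsto_intros Xt)
  then have h_lim: "h \<longlonglongrightarrow> 0" by simp
  define a where "a i = cauchy_F (\<nu> (h i)) w" for i
  have a_pos: "0 < Im (a i)" for i
    unfolding a_def using h[of i] by (intro real_distribution.Im_cauchy_F_pos nu_prob w) simp
  have "a \<longlonglongrightarrow> cauchy_F (\<nu> 0) w"
    unfolding a_def
    by (rule weak_conv_cauchy_F[OF nu_prob nu_prob nu_cont]) (use h h_lim w in \<open>auto simp: less_imp_le\<close>)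
  then have a_lim: "a \<longlonglongrightarrow> w" using cauchy_F_return_0[OF w] by (simp add: nu_0)
  \<comment> \<open>\<open>F_0\<close> is the identity, so this is the generator's difference
    quotient at time 0, with the positive steps \<open>h i\<close>.\<close>
  have "(\<lambda>i. (a i - w) / of_real (h i)) \<longlonglongrightarrow> J w"
    using generator[OF w, unfolded has_vector_derivative_iff_quotient tendsto_at_iff_sequentially comp_def, rule_format, of h]
      h h_lim cauchy_F_return_0[OF w] by (auto simp: a_def nu_0 less_imp_le less_imp_neq[symmetric])
  moreover have "(\<lambda>i. secant_F (\<nu> (m i)) (a i) w) \<longlonglongrightarrow> secant_F (\<nu> t) w w"
    by (rule weak_conv_secant_F[OF nu_prob nu_prob nu_cont]) (use m m_lim t a_lim a_pos w in auto)
  ultimately have "(\<lambda>i. secant_F (\<nu> (m i)) (a i) w * ((a i - w) / of_real (h i))) \<longlonglongrightarrow> secant_F (\<nu> t) w w * J w"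
    by (intro tendsto_mult)
  moreover have "secant_F (\<nu> (m i)) (a i) w * ((a i - w) / of_real (h i)) =
      (cauchy_F (\<nu> (X i)) w - cauchy_F (\<nu> t) w) / of_real (X i - t)" for i
  proof -
    \<comment> \<open>The common time \<open>m i\<close> acts outermost, so the inner increment
      \<open>a i - w\<close> is the one the generator controls, at the fixed point
      \<open>w\<close>.\<close>
    have "cauchy_F (\<nu> (m i + h i)) w = cauchy_F (\<nu> (m i)) (a i)"
      using nu_semigroup[OF m less_imp_le[OF h], of i i] w by (simp add: mono_conv_def a_def)
    then have eq: "cauchy_F (\<nu> (m i + h i)) w - cauchy_F (\<nu> (m i)) w = (a i - w) * secant_F (\<nu> (m i)) (a i) w"
      using real_distribution.cauchy_F_diff[OF nu_prob[OF m] a_pos w, of i i] by simp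
    consider "X i < t" | "t < X i" using X(2)[of i] by linarith
    then show ?thesis
    proof cases
      case 1
      then have mh: "m i = X i" "m i + h i = t" "X i - t = - h i" by (auto simp: m_def h_def)
      have "cauchy_F (\<nu> (X i)) w - cauchy_F (\<nu> t) w = - ((a i - w) * secant_F (\<nu> (m i)) (a i) w)"
        unfolding eq[unfolded mh(2), symmetric] by (simp add: mh(1))
      then show ?thesis unfolding mh(3) by simp
    next
      case 2
      then have mh: "m i = t" "m i + h i = X i" "X i - t = h i" by (auto simp: m_def h_def)
      have "cauchy_F (\<nu> (X i)) w - cauchy_F (\<nu> t) w = (a i - w) * secant_F (\<nu> (m i)) (a i) w"
        using eq unfolding mh(2) by (simp add: mh(1))
      then show ?thesis unfolding mh(3) by simp
    qed
  qed
  ultimately show "(\<lambda>i. (cauchy_F (\<nu> (X i)) w - cauchy_F (\<nu> t) w) / of_real (X i - t)) \<longlonglongrightarrow> secant_F (\<nu> t) w w * J w"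
    by simp
qed

end

section \<open>Subordination along the semigroup\<close>

locale monotone_semigroup_perturbed = monotone_semigroup +
  fixes \<mu> :: "real measure"
  assumes mu: "real_distribution \<mu>"
begin

lemma subordination_nu: "0 \<le> t \<Longrightarrow> subordination (\<nu> t) \<mu>"
  using nu_prob mu by (simp add: subordination_def)

definition sub_fun :: "real \<Rightarrow> complex \<Rightarrow> complex" where
  "sub_fun t z = subordination.\<omega> (\<nu> t) \<mu> z"

lemma Im_sub_fun_pos: "0 \<le> t \<Longrightarrow> 0 < Im z \<Longrightarrow> 0 < Im (sub_fun t z)"
  unfolding sub_fun_def by (rule subordination.Im_\<omega>_pos[OF subordination_nu])

lemma sub_fun_fix: "0 \<le> t \<Longrightarrow> 0 < Im z \<Longrightarrow> shift_F \<mu> z (shift_F (\<nu> t) z (sub_fun t z)) = sub_fun t z"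
  using subordination.sub_map_\<omega>[OF subordination_nu] by (simp add: sub_fun_def subordination.sub_map_def[OF subordination_nu])

lemma continuous_sub_fun:
  assumes z: "0 < Im z" and t: "0 \<le> t" and X: "\<And>n. 0 \<le> X n" "X \<longlonglongrightarrow> t"
  shows "(\<lambda>n. sub_fun (X n) z) \<longlonglongrightarrow> sub_fun t z"
proof (rule fixpoints_tendsto[where f = "\<lambda>n. subordination.sub_map (\<nu> (X n)) \<mu> z" and c = "\<lambda>n. Im z" and l = "Im z"])
  let ?w = "sub_fun t z"
  have "(\<lambda>n. cauchy_F (\<nu> (X n)) ?w) \<longlonglongrightarrow> cauchy_F (\<nu> t) ?w"
    by (rule weak_conv_cauchy_F[OF nu_prob nu_prob nu_cont]) (use X t z Im_sub_fun_pos in auto)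
  then have "(\<lambda>n. shift_F (\<nu> (X n)) z ?w) \<longlonglongrightarrow> shift_F (\<nu> t) z ?w"
    unfolding shift_F_def by (intro tendsto_intros)
  moreover have "isCont (shift_F \<mu> z) (shift_F (\<nu> t) z ?w)"
    using real_distribution.has_field_derivative_shift_F[OF mu
        subordination.Im_shift_pos[OF subordination_nu[OF t] z Im_sub_fun_pos[OF t z]]] by (rule DERIV_isCont)
  ultimately have "(\<lambda>n. shift_F \<mu> z (shift_F (\<nu> (X n)) z ?w)) \<longlonglongrightarrow> shift_F \<mu> z (shift_F (\<nu> t) z ?w)"
    by (rule isCont_tendsto_compose[rotated])
  then show "(\<lambda>n. subordination.sub_map (\<nu> (X n)) \<mu> z ?w) \<longlonglongrightarrow> ?w"
    using sub_fun_fix[OF t z] by (simp add: subordination.sub_map_def[OF subordination_nu] X)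
next
  show "subordination.sub_map (\<nu> (X n)) \<mu> z (sub_fun (X n) z) = sub_fun (X n) z" for n
    unfolding sub_fun_def by (rule subordination.sub_map_\<omega>[OF subordination_nu[OF X(1)] z])
qed (use z t X in \<open>auto intro: subordination.holomorphic_sub_map subordination.Im_sub_map_ge subordination_nu Im_sub_fun_pos\<close>)

text \<open>The increment of \<open>F_s\<close> at its moving argument is split into a spatial part,
  a secant of \<open>\<nu> (X n)\<close>, and a temporal part at the fixed point \<open>w\<close>.
  The former joins the linear equation for \<open>w' n - w\<close>; the latter is its
  inhomogeneity.\<close>

lemma has_vector_derivative_sub_fun:
  assumes z: "0 < Im z" and t: "0 \<le> t"
  defines "w \<equiv> sub_fun t z"
  defines "v \<equiv> shift_F (\<nu> t) z w"
  shows "((\<lambda>s. sub_fun s z) has_vector_derivative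
    (secant_F \<mu> v v - 1) * (secant_F (\<nu> t) w w * J w) /
    (1 - (secant_F \<mu> v v - 1) * (secant_F (\<nu> t) w w - 1))) (at t within {0..})"
  unfolding has_vector_derivative_iff_quotient tendsto_at_iff_sequentially comp_def
proof (intro allI impI)
  fix X assume "\<forall>i. X i \<in> {0..} - {t}" and Xt: "X \<longlonglongrightarrow> t"
  then have X: "0 \<le> X i" "X i \<noteq> t" for i by auto
  define w' where "w' n = sub_fun (X n) z" for n
  define v' where "v' n = shift_F (\<nu> (X n)) z (w' n)" for n
  have Im: "0 < Im (w' n)" "0 < Im (v' n)" "0 < Im w" "0 < Im v" for n
    using X t z by (auto simp: w'_def v'_def w_def v_def intro!: Im_sub_fun_pos subordination.Im_shift_pos[OF subordination_nu])
  have w'_lim: "w' \<longlonglongrightarrow> w" unfolding w'_def w_def by (rule continuous_sub_fun[OF z t X(1) Xt])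
  have wc: "weak_conv_m (\<lambda>n. \<nu> (X n)) (\<nu> t)" using t X Xt by (intro nu_cont) auto
  have "(\<lambda>n. cauchy_F (\<nu> (X n)) (w' n)) \<longlonglongrightarrow> cauchy_F (\<nu> t) w"
    by (rule weak_conv_cauchy_F[OF nu_prob nu_prob wc]) (use X t w'_lim Im in auto)
  then have v'_lim: "v' \<longlonglongrightarrow> v"
    unfolding v'_def v_def shift_F_def by (intro tendsto_intros w'_lim)
  define sM where "sM n = secant_F \<mu> (v' n) v" for n
  define sS where "sS n = secant_F (\<nu> (X n)) (w' n) w" for n
  have sM_lim: "sM \<longlonglongrightarrow> secant_F \<mu> v v" unfolding sM_def
    by (rule weak_conv_secant_F[OF mu mu weak_conv_m_const]) (use v'_lim Im in auto)
  have sS_lim: "sS \<longlonglongrightarrow> secant_F (\<nu> t) w w" unfolding sS_def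
    by (rule weak_conv_secant_F[OF nu_prob nu_prob wc]) (use X t w'_lim Im in auto)
  have ne: "1 - (secant_F \<mu> v v - 1) * (secant_F (\<nu> t) w w - 1) \<noteq> 0"
    unfolding v_def w_def sub_fun_def
    by (rule subordination.multiplier_ne_1[OF subordination_nu[OF t] z subordination.sub_fix_\<omega>[OF subordination_nu[OF t] z]])
  define q where "q n = (cauchy_F (\<nu> (X n)) w - cauchy_F (\<nu> t) w) / of_real (X n - t)" for n
  have q_lim: "q \<longlonglongrightarrow> secant_F (\<nu> t) w w * J w"
    using has_vector_derivative_time[OF t Im(3), unfolded has_vector_derivative_iff_quotient tendsto_at_iff_sequentially comp_def,
        rule_format, of X] X Xt by (simp add: q_def[abs_def])
  have den_lim: "(\<lambda>n. 1 - (sM n - 1) * (sS n - 1)) \<longlonglongrightarrow> 1 - (secant_F \<mu> v v - 1) * (secant_F (\<nu> t) w w - 1)"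
    by (intro tendsto_intros sM_lim sS_lim)
  \<comment> \<open>The counterpart of the identity for the \<open>z\<close>-derivative: the same
    denominator, with a source from the change of measure in place of the change of
    \<open>z\<close>.\<close>
  have rel: "(w' n - w) * (1 - (sM n - 1) * (sS n - 1)) = (sM n - 1) * (cauchy_F (\<nu> (X n)) w - cauchy_F (\<nu> t) w)" for n
  proof -
    have "v' n - v = (sS n - 1) * (w' n - w) + (cauchy_F (\<nu> (X n)) w - cauchy_F (\<nu> t) w)"
      using real_distribution.shift_F_diff[OF nu_prob[OF X(1)] Im(1,3), of n z n z]
      by (simp add: v'_def v_def sS_def shift_F_def algebra_simps)
    moreover have "w' n - w = (sM n - 1) * (v' n - v)"
      using real_distribution.shift_F_diff[OF mu Im(2,4), of z n z] sub_fun_fix[OF X(1)[of n] z] sub_fun_fix[OF t z]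
      by (simp add: v'_def v_def w'_def w_def sM_def)
    ultimately show ?thesis by algebra
  qed
  show "(\<lambda>n. (sub_fun (X n) z - sub_fun t z) / of_real (X n - t)) \<longlonglongrightarrow>
      (secant_F \<mu> v v - 1) * (secant_F (\<nu> t) w w * J w) / (1 - (secant_F \<mu> v v - 1) * (secant_F (\<nu> t) w w - 1))"
  proof (rule Lim_transform_eventually)
    show "(\<lambda>n. (sM n - 1) * q n / (1 - (sM n - 1) * (sS n - 1))) \<longlonglongrightarrow>
        (secant_F \<mu> v v - 1) * (secant_F (\<nu> t) w w * J w) / (1 - (secant_F \<mu> v v - 1) * (secant_F (\<nu> t) w w - 1))"
      by (intro tendsto_divide tendsto_mult tendsto_diff tendsto_const sM_lim q_lim den_lim sS_lim ne)
    show "\<forall>\<^sub>F n in sequentially. (sM n - 1) * q n / (1 - (sM n - 1) * (sS n - 1)) = (sub_fun (X n) z - sub_fun t z) / of_real (X n - t)"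
      using tendsto_imp_eventually_ne[OF den_lim ne]
    proof eventually_elim
      case (elim n)
      define d where "d = 1 - (sM n - 1) * (sS n - 1)"
      have "w' n - w = (sM n - 1) * (cauchy_F (\<nu> (X n)) w - cauchy_F (\<nu> t) w) / d"
        using rel[of n] elim unfolding d_def[symmetric] by (simp add: nonzero_eq_divide_eq)
      then show ?case unfolding d_def[symmetric] q_def by (simp add: w'_def w_def)
    qed
  qed
qed

lemma sub_fun_pde:
  assumes z: "0 < Im z" and t: "0 \<le> t"
  shows "\<exists>D. ((\<lambda>s. sub_fun s z) has_vector_derivative J (sub_fun t z) * (D - 1)) (at t within {0..}) \<and>
    (sub_fun t has_field_derivative D) (at z)"
proof -
  define w where "w = sub_fun t z"
  define v where "v = shift_F (\<nu> t) z w"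
  define sM where "sM = secant_F \<mu> v v"
  define sS where "sS = secant_F (\<nu> t) w w"
  define D where "D = sM / (1 - (sM - 1) * (sS - 1))"
  have "sub_fix (\<nu> t) \<mu> z w"
    unfolding w_def sub_fun_def by (rule subordination.sub_fix_\<omega>[OF subordination_nu[OF t] z])
  then have ne: "1 - (sM - 1) * (sS - 1) \<noteq> 0"
    unfolding sM_def sS_def v_def by (rule subordination.multiplier_ne_1[OF subordination_nu[OF t] z])
  have der: "(sub_fun t has_field_derivative D) (at z)"
    using subordination.has_field_derivative_\<omega>[OF subordination_nu[OF t] z]
    by (simp add: D_def sM_def sS_def v_def w_def sub_fun_def[abs_def])
  \<comment> \<open>Both derivatives carry the same denominator \<open>d\<close>, and
    \<open>sM - d = (sM - 1) * sS\<close> relates their numerators.\<close>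
  have key: "(sM - 1) * (sS * J w) / (1 - (sM - 1) * (sS - 1)) = J w * (D - 1)"
  proof -
    define d where "d = 1 - (sM - 1) * (sS - 1)"
    have "J w * (D - 1) = J w * (sM - d) / d"
      using ne unfolding D_def d_def[symmetric] by (simp add: field_simps)
    also have "sM - d = (sM - 1) * sS" by (simp add: d_def algebra_simps)
    finally show ?thesis unfolding d_def[symmetric] by (simp add: mult_ac)
  qed
  have "((\<lambda>s. sub_fun s z) has_vector_derivative J w * (D - 1)) (at t within {0..})"
    using has_vector_derivative_sub_fun[OF z t]
    unfolding w_def[symmetric] v_def[symmetric] sM_def[symmetric] sS_def[symmetric] key .
  with der show ?thesis unfolding w_def by blast
qed

end

theorem theorem1p4:
  fixes \<mu> :: "real measure" and \<nu> :: "real \<Rightarrow> real measure"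
    and J :: "complex \<Rightarrow> complex"
  assumes mu: "real_prob \<mu>"
    and nu_prob: "\<And>t. t \<ge> 0 \<Longrightarrow> real_prob (\<nu> t)"
    and nu_0: "\<nu> 0 = return borel 0"
    and nu_semigroup: "\<And>s t. s \<ge> 0 \<Longrightarrow> t \<ge> 0 \<Longrightarrow> mono_conv (\<nu> s) (\<nu> t) (\<nu> (s + t))"
    and nu_cont: "\<And>t s. t \<ge> 0 \<Longrightarrow> (\<forall>n. s n \<ge> 0) \<Longrightarrow> s \<longlonglongrightarrow> t \<Longrightarrow>
                    weak_conv_m (\<lambda>n. \<nu> (s n)) (\<nu> t)"
    and generator: "\<And>z. Im z > 0 \<Longrightarrow>
          ((\<lambda>t. cauchy_F (\<nu> t) z) has_vector_derivative J z) (at 0 within {0..})"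
  shows "\<forall>t\<ge>0. \<forall>z. Im z > 0 \<longrightarrow>
           (let G = (\<lambda>s w. w - cauchy_F (A_op (\<nu> s) \<mu>) w) in
            \<exists>Gt Gz. ((\<lambda>s. G s z) has_vector_derivative Gt) (at t within {0..}) \<and>
                    ((\<lambda>w. G t w) has_field_derivative Gz) (at z) \<and>
                    Gt = J (z - G t z) * Gz)"
proof -
  interpret monotone_semigroup_perturbed \<nu> J \<mu>
  proof (intro monotone_semigroup_perturbed.intro monotone_semigroup.intro monotone_semigroup_perturbed_axioms.intro)
    show "real_distribution (\<nu> t)" if "0 \<le> t" for t
      using nu_prob[OF that] by (simp only: real_prob_iff)
    show "real_distribution \<mu>" using mu by (simp only: real_prob_iff)
  qed (rule nu_0 nu_semigroup nu_cont generator; assumption)+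
  have A: "cauchy_F (A_op (\<nu> s) \<mu>) w = sub_fun s w" if "0 \<le> s" "0 < Im w" for s w
    unfolding sub_fun_def using subordination.cauchy_F_A_op[OF subordination_nu] that by blast
  show ?thesis
    unfolding Let_def
  proof (intro allI impI)
    fix t z assume t: "0 \<le> (t::real)" and z: "0 < Im z"
    obtain D where Dt: "((\<lambda>s. sub_fun s z) has_vector_derivative J (sub_fun t z) * (D - 1)) (at t within {0..})"
      and Dz: "(sub_fun t has_field_derivative D) (at z)"
      using sub_fun_pde[OF z t] by blast
    have "((\<lambda>s. z - sub_fun s z) has_vector_derivative 0 - J (sub_fun t z) * (D - 1)) (at t within {0..})"
      by (intro has_vector_derivative_diff has_vector_derivative_const Dt)
    \<comment> \<open>The identification with \<open>sub_fun\<close> holds for nonnegative times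
      only, so the transfer takes place within \<open>{0..}\<close>.\<close>
    then have 1: "((\<lambda>s. z - cauchy_F (A_op (\<nu> s) \<mu>) z) has_vector_derivative - (J (sub_fun t z) * (D - 1))) (at t within {0..})"
      using has_vector_derivative_transform[of t "{0..}" "\<lambda>s. z - cauchy_F (A_op (\<nu> s) \<mu>) z" "\<lambda>s. z - sub_fun s z"] t A z by simp
    have "((\<lambda>w. w - sub_fun t w) has_field_derivative 1 - D) (at z)"
      by (intro derivative_intros Dz)
    then have 2: "((\<lambda>w. w - cauchy_F (A_op (\<nu> t) \<mu>) w) has_field_derivative 1 - D) (at z)"
      by (rule has_field_derivative_transform_within_open[OF _ open_uhp]) (use z A t in auto)
    \<comment> \<open>Passing from \<open>w\<close> to \<open>G = z - w\<close> negates the time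
      derivative and replaces \<open>D\<close> by \<open>1 - D\<close>, so the two signs
      cancel.\<close>
    have "- (J (sub_fun t z) * (D - 1)) = J (z - (z - cauchy_F (A_op (\<nu> t) \<mu>) z)) * (1 - D)"
      using A[OF t z] by (simp add: algebra_simps)
    with 1 2 show "\<exists>Gt Gz. ((\<lambda>s. z - cauchy_F (A_op (\<nu> s) \<mu>) z) has_vector_derivative Gt) (at t within {0..}) \<and>
        ((\<lambda>w. w - cauchy_F (A_op (\<nu> t) \<mu>) w) has_field_derivative Gz) (at z) \<and>
        Gt = J (z - (z - cauchy_F (A_op (\<nu> t) \<mu>) z)) * Gz"
      by blast
  qed
qed

end
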